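(* Let $\alpha>0$ and $1\le q<p<\infty$. Let $\Omega\subset\mathbb{R}^N$ be a $q$-admissible open set. Then for every $U\in X^{q,p}(\Omega)$ the problem \[ \inf_{\psi\in X^{q,p}(\Omega)}\Big\{\mathfrak{F}_{q,\alpha}(\psi):\psi-U\in W^{1,p}_0(\Omega)\Big\},\qquad\mathfrak{F}_{q,\alpha}(\psi)=\frac1p\int_\Omega|\nabla\psi|^p\,dx-\frac\alpha q\int_\Omega|\psi|^q\,dx, \] admits a solution. Moreover: for $1<q<p$, every minimizer $u$ is a weak solution of $-\Delta_pu=\alpha|u|^{q-2}u$ in $\Omega$; for $q=1$, every minimizer $u$ satisfies $-\alpha\le-\Delta_pu\le\alpha$ in $\Omega$ in the weak sense, i.e. $-\alpha\int_\Omega\psi\le\int_\Omega\langle|\nabla u|^{p-2}\nabla u,\nabla\psi\rangle\le\alpha\int_\Omega\psi$ for all non-negative $\psi\in C^\infty_0(\Omega)$; for $q=1$, every non-negative minimizer $u$ (if any) satisfies $-\Delta_pu=\alpha$ in $\Omega$ in the weak sense.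
   Context: $X^{q,p}(\Omega)=\{\psi\in L^q(\Omega):\nabla\psi\in L^p(\Omega;\mathbb{R}^N)\}$; $W^{1,p}_0(\Omega)$ is the closure of $C^\infty_0(\Omega)$ in $W^{1,p}(\Omega)$. $\Omega$ is $q$-admissible if $\lambda_{p,q}(\Omega):=\inf_{\psi\in C^\infty_0(\Omega)}\{\int_\Omega|\nabla\psi|^p:\int_\Omega|\psi|^q=1\}>0$. Weak solution of $-\Delta_pu=f$: $\int_\Omega\langle|\nabla u|^{p-2}\nabla u,\nabla\psi\rangle=\int_\Omega f\psi$ for all $\psi\in C^\infty_0(\Omega)$. *)

theory Defs
  imports "HOL-Analysis.Analysis"
begin

fun Ck :: "nat \<Rightarrow> ('a::euclidean_space \<Rightarrow> real) \<Rightarrow> bool" where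
  "Ck 0 f = continuous_on UNIV f"
| "Ck (Suc k) f = ((\<forall>x. f differentiable (at x)) \<and>
      (\<forall>v. Ck k (\<lambda>x. frechet_derivative f (at x) v)))"

definition smooth_fun :: "('a::euclidean_space \<Rightarrow> real) \<Rightarrow> bool" where
  "smooth_fun f \<longleftrightarrow> (\<forall>k. Ck k f)"

definition test_fun :: "'a::euclidean_space set \<Rightarrow> ('a \<Rightarrow> real) \<Rightarrow> bool" where
  "test_fun \<Omega> \<phi> \<longleftrightarrow> smooth_fun \<phi> \<and> compact (closure {x. \<phi> x \<noteq> 0})
      \<and> closure {x. \<phi> x \<noteq> 0} \<subseteq> \<Omega>"

definition grad :: "('a::euclidean_space \<Rightarrow> real) \<Rightarrow> 'a \<Rightarrow> 'a" where
  "grad \<phi> x = (\<Sum>i\<in>Basis. frechet_derivative \<phi> (at x) i *\<^sub>R i)"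

definition Lp :: "'a::euclidean_space set \<Rightarrow> real \<Rightarrow> ('a \<Rightarrow> 'b::{real_normed_vector, second_countable_topology}) \<Rightarrow> bool" where
  "Lp \<Omega> p f \<longleftrightarrow> f \<in> borel_measurable (lebesgue_on \<Omega>)
      \<and> integrable (lebesgue_on \<Omega>) (\<lambda>x. norm (f x) powr p)"

definition weak_grad :: "'a::euclidean_space set \<Rightarrow> ('a \<Rightarrow> real) \<Rightarrow> ('a \<Rightarrow> 'a) \<Rightarrow> bool" where
  "weak_grad \<Omega> u g \<longleftrightarrow> (\<forall>\<phi>. test_fun \<Omega> \<phi> \<longrightarrow> (\<forall>i\<in>Basis.
      integral\<^sup>L (lebesgue_on \<Omega>) (\<lambda>x. u x * frechet_derivative \<phi> (at x) i)
      = - integral\<^sup>L (lebesgue_on \<Omega>) (\<lambda>x. (g x \<bullet> i) * \<phi> x)))"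

definition Xqp :: "'a::euclidean_space set \<Rightarrow> real \<Rightarrow> real \<Rightarrow> ('a \<Rightarrow> real) \<Rightarrow> bool" where
  "Xqp \<Omega> q p u \<longleftrightarrow> Lp \<Omega> q u \<and> (\<exists>g. weak_grad \<Omega> u g \<and> Lp \<Omega> p g)"

text \<open>A chosen weak gradient (unique a.e.).\<close>
definition wgrad :: "'a::euclidean_space set \<Rightarrow> real \<Rightarrow> ('a \<Rightarrow> real) \<Rightarrow> 'a \<Rightarrow> 'a" where
  "wgrad \<Omega> p u = (SOME g. weak_grad \<Omega> u g \<and> Lp \<Omega> p g)"

definition W0 :: "'a::euclidean_space set \<Rightarrow> real \<Rightarrow> ('a \<Rightarrow> real) \<Rightarrow> bool" where
  "W0 \<Omega> p v \<longleftrightarrow> Lp \<Omega> p v \<and> (\<exists>g. weak_grad \<Omega> v g \<and> Lp \<Omega> p g \<and>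
      (\<exists>\<phi>. (\<forall>k. test_fun \<Omega> (\<phi> k)) \<and>
        (\<lambda>k. integral\<^sup>L (lebesgue_on \<Omega>) (\<lambda>x. \<bar>\<phi> k x - v x\<bar> powr p)) \<longlonglongrightarrow> 0 \<and>
        (\<lambda>k. integral\<^sup>L (lebesgue_on \<Omega>) (\<lambda>x. norm (grad (\<phi> k) x - g x) powr p)) \<longlonglongrightarrow> 0))"

definition lambda_pq :: "'a::euclidean_space set \<Rightarrow> real \<Rightarrow> real \<Rightarrow> real" where
  "lambda_pq \<Omega> p q = Inf {integral\<^sup>L (lebesgue_on \<Omega>) (\<lambda>x. norm (grad \<phi> x) powr p) | \<phi>.
      test_fun \<Omega> \<phi> \<and> integral\<^sup>L (lebesgue_on \<Omega>) (\<lambda>x. \<bar>\<phi> x\<bar> powr q) = 1}"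

definition q_admissible :: "'a::euclidean_space set \<Rightarrow> real \<Rightarrow> real \<Rightarrow> bool" where
  "q_admissible \<Omega> p q \<longleftrightarrow> lambda_pq \<Omega> p q > 0"

definition Fqa :: "'a::euclidean_space set \<Rightarrow> real \<Rightarrow> real \<Rightarrow> real \<Rightarrow> ('a \<Rightarrow> real) \<Rightarrow> real" where
  "Fqa \<Omega> p q \<alpha> \<psi> = 1 / p * integral\<^sup>L (lebesgue_on \<Omega>) (\<lambda>x. norm (wgrad \<Omega> p \<psi> x) powr p)
      - \<alpha> / q * integral\<^sup>L (lebesgue_on \<Omega>) (\<lambda>x. \<bar>\<psi> x\<bar> powr q)"

definition minimizer :: "'a::euclidean_space set \<Rightarrow> real \<Rightarrow> real \<Rightarrow> real \<Rightarrow> ('a \<Rightarrow> real) \<Rightarrow> ('a \<Rightarrow> real) \<Rightarrow> bool" where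
  "minimizer \<Omega> p q \<alpha> U u \<longleftrightarrow> Xqp \<Omega> q p u \<and> W0 \<Omega> p (\<lambda>x. u x - U x) \<and>
      (\<forall>\<psi>. Xqp \<Omega> q p \<psi> \<and> W0 \<Omega> p (\<lambda>x. \<psi> x - U x) \<longrightarrow> Fqa \<Omega> p q \<alpha> u \<le> Fqa \<Omega> p q \<alpha> \<psi>)"

definition plap_pair :: "'a::euclidean_space set \<Rightarrow> real \<Rightarrow> ('a \<Rightarrow> real) \<Rightarrow> ('a \<Rightarrow> real) \<Rightarrow> real" where
  "plap_pair \<Omega> p u \<phi> = integral\<^sup>L (lebesgue_on \<Omega>)
      (\<lambda>x. (norm (wgrad \<Omega> p u x) powr (p - 2) *\<^sub>R wgrad \<Omega> p u x) \<bullet> grad \<phi> x)"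

definition weak_plap_sol :: "'a::euclidean_space set \<Rightarrow> real \<Rightarrow> ('a \<Rightarrow> real) \<Rightarrow> ('a \<Rightarrow> real) \<Rightarrow> bool" where
  "weak_plap_sol \<Omega> p u f \<longleftrightarrow> (\<forall>\<phi>. test_fun \<Omega> \<phi> \<longrightarrow>
      plap_pair \<Omega> p u \<phi> = integral\<^sup>L (lebesgue_on \<Omega>) (\<lambda>x. f x * \<phi> x))"

end

theory Submission
  imports Defs
begin

text \<open>Admissibility gives the inequality \<open>\<integral>|\<phi>|^q \<le> C (\<integral>|grad \<phi>|^p)^(q/p)\<close> for test functions, and
  because \<open>q < p\<close> its constant tends to zero for test functions supported far from the origin. With
  translation estimates for ball averages this yields the \<open>L^p\<close> Poincare inequality and compactness in
  \<open>L^q\<close> of sets of bounded energy. The functional is coercive, so a minimizing sequence of the form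
  \<open>U\<close> plus test functions has a subsequence converging in \<open>L^q\<close>. Comparing with midpoints, uniform convexity of
  \<open>|.|^p\<close> makes the gradients converge strongly, and the limit is a minimizer. The Euler-Lagrange
  relations follow by differentiating along \<open>u + t \<phi>\<close>; for \<open>q = 1\<close> only the gradient term is
  differentiated, and the increments of \<open>\<integral>|u + t \<phi>|\<close> are bounded directly.\<close>

section \<open>Smooth functions and test functions\<close>

text \<open>The functional is a convex term minus a convex term, so no convexity of the whole is
  available and the subtracted term has to be controlled by strong convergence. Beyond admissibility
  nothing is known about the size or the boundary of \<Omega>, so mass might escape to infinity;
  what excludes this is the mismatch between quantities that add up linearly over separated bumps
  and an inequality of exponent q/p < 1. The same exponent makes the subtracted term sublinear in
  the energy. A second obstacle: admissibility speaks of L^q, whereas W^{1,p}_0 is a closure in the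
  L^p norm. Once both Poincare inequalities hold, Cauchy gradients of test functions give limits in
  L^q and in L^p, and the two limits agree almost everywhere. Hence the infimum may be taken over U
  plus test functions, where gradients are classical: the energy of every admissible function is a
  limit of such values. No weak limit is ever taken. Ball averages play the part of mollifiers;
  their estimates rest on Jensen's inequality, translation invariance and exchange of
  integrals.\<close>

lemma Ck_Suc_imp: "Ck (Suc k) f \<Longrightarrow> Ck k f"
proof (induction k arbitrary: f)
  case 0
  then show ?case
    by (auto simp: continuous_on_eq_continuous_at intro: differentiable_imp_continuous_within)
next
  case (Suc k)
  then show ?case by (simp only: Ck.simps(2)) blast
qed

lemma Ck_const: "Ck k (\<lambda>x::'a::euclidean_space. c)"
proof (induction k arbitrary: c)
  case (Suc k)
  have "frechet_derivative (\<lambda>x::'a. c) (at x) v = 0" for x v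
    by (simp add: frechet_derivative_const)
  then show ?case using Suc by simp
qed simp

lemma frechet_derivative_eqI: "(f has_derivative D) (at x) \<Longrightarrow> frechet_derivative f (at x) v = D v"
  using frechet_derivative_at by metis

lemma frechet_derivative_plus:
  fixes f g :: "'a::euclidean_space \<Rightarrow> real"
  assumes "f differentiable (at x)" "g differentiable (at x)"
  shows "frechet_derivative (\<lambda>x. f x + g x) (at x) v
    = frechet_derivative f (at x) v + frechet_derivative g (at x) v"
proof -
  have "((\<lambda>x. f x + g x) has_derivative (\<lambda>v. frechet_derivative f (at x) v + frechet_derivative g (at x) v)) (at x)"
    using assms by (auto intro!: derivative_eq_intros simp: frechet_derivative_works)
  then show ?thesis by (rule frechet_derivative_eqI)
qed

lemma frechet_derivative_mult:
  fixes f g :: "'a::euclidean_space \<Rightarrow> real"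
  assumes "f differentiable (at x)" "g differentiable (at x)"
  shows "frechet_derivative (\<lambda>x. f x * g x) (at x) v
    = f x * frechet_derivative g (at x) v + frechet_derivative f (at x) v * g x"
proof -
  have "((\<lambda>x. f x * g x) has_derivative (\<lambda>v. f x * frechet_derivative g (at x) v + frechet_derivative f (at x) v * g x)) (at x)"
    using assms by (auto intro!: derivative_eq_intros simp: frechet_derivative_works)
  then show ?thesis by (rule frechet_derivative_eqI)
qed

lemma Ck_add: "Ck k f \<Longrightarrow> Ck k g \<Longrightarrow> Ck k (\<lambda>x. f x + g x)"
proof (induction k arbitrary: f g)
  case 0
  then show ?case by (auto intro: continuous_intros)
next
  case (Suc k)
  then show ?case by (auto simp: frechet_derivative_plus)
qed

lemma Ck_mult: "Ck k f \<Longrightarrow> Ck k g \<Longrightarrow> Ck k (\<lambda>x. f x * g x)"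
proof (induction k arbitrary: f g)
  case 0
  then show ?case by (auto intro: continuous_intros)
next
  case (Suc k)
  \<comment> \<open>The product rule leaves one factor undifferentiated, so the induction hypothesis
    is also applied to \<open>f\<close> and \<open>g\<close> themselves, one order lower.\<close>
  have "Ck k f" "Ck k g" using Suc.prems by (auto intro: Ck_Suc_imp)
  then have "Ck k (\<lambda>x. f x * frechet_derivative g (at x) v + frechet_derivative f (at x) v * g x)" for v
    using Suc by (intro Ck_add Suc.IH) auto
  then show ?case using Suc.prems by (auto simp: frechet_derivative_mult)
qed

lemma smooth_add: "smooth_fun f \<Longrightarrow> smooth_fun g \<Longrightarrow> smooth_fun (\<lambda>x. f x + g x)"
  and smooth_mult: "smooth_fun f \<Longrightarrow> smooth_fun g \<Longrightarrow> smooth_fun (\<lambda>x. f x * g x)"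
  and smooth_const: "smooth_fun (\<lambda>x::'a::euclidean_space. c)"
  by (auto simp: smooth_fun_def Ck_add Ck_mult Ck_const)

lemma smooth_sum:
  assumes "finite I" "\<And>i. i \<in> I \<Longrightarrow> smooth_fun (f i)"
  shows "smooth_fun (\<lambda>x::'a::euclidean_space. \<Sum>i\<in>I. f i x)"
  using assms by (induction I rule: finite_induct) (auto intro: smooth_add smooth_const)

lemma smooth_prod:
  assumes "finite I" "\<And>i. i \<in> I \<Longrightarrow> smooth_fun (f i)"
  shows "smooth_fun (\<lambda>x::'a::euclidean_space. \<Prod>i\<in>I. f i x)"
  using assms by (induction I rule: finite_induct) (auto intro: smooth_mult smooth_const)

section \<open>A smooth function that is flat at the origin\<close>

text \<open>This family, which contains \<open>exp (- 1/t)\<close> extended by \<open>0\<close>, is closed under differentiation, so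
  smoothness of all its members follows by one induction.\<close>
definition flat :: "real poly \<Rightarrow> real \<Rightarrow> real" where
  "flat P t = (if t > 0 then poly P (1/t) * exp (- (1/t)) else 0)"

text \<open>With z = 1/t, differentiation of P(1/t) exp(-1/t) gives z^2 (P - P')(z) exp(-z); the
  factor z^2 is the polynomial \<open>[:0,0,1:]\<close>.\<close>

definition flat_deriv :: "real poly \<Rightarrow> real poly" where
  "flat_deriv P = [:0,0,1:] * (P - pderiv P)"

lemma poly_exp_tendsto_0: "((\<lambda>z::real. poly P z * exp (- z)) \<longlongrightarrow> 0) at_top"
proof -
  have "((\<lambda>z::real. \<Sum>i\<le>degree P. coeff P i * (z ^ i / exp z)) \<longlongrightarrow> (\<Sum>i\<le>degree P. coeff P i * 0)) at_top"
    by (intro tendsto_sum tendsto_mult tendsto_const tendsto_power_div_exp_0)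
  then show ?thesis
    by (simp add: poly_altdef sum_distrib_right exp_minus divide_inverse mult.assoc)
qed

lemma flat_tendsto_0: "(flat P \<longlongrightarrow> 0) (at 0)"
proof -
  have "((\<lambda>t. poly P (inverse t) * exp (- inverse t)) \<longlongrightarrow> 0) (at_right 0)"
    using filterlim_compose[OF poly_exp_tendsto_0 filterlim_inverse_at_top_right] by simp
  then have r: "(flat P \<longlongrightarrow> 0) (at_right 0)"
    by (rule Lim_transform_eventually) (auto simp: eventually_at_filter flat_def divide_inverse)
  have l: "(flat P \<longlongrightarrow> 0) (at_left 0)"
    by (rule Lim_transform_eventually[of "\<lambda>_. 0"]) (auto simp: eventually_at_filter flat_def)
  show ?thesis using l r by (simp add: filterlim_split_at)
qed

lemma flat_has_deriv: "(flat P has_real_derivative flat (flat_deriv P) t) (at t)"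
proof -
  consider "t > 0" | "t < 0" | "t = 0" by linarith
  then show ?thesis
  proof cases
    case 1
    have "((\<lambda>t. poly P (1/t) * exp (- (1/t))) has_real_derivative flat (flat_deriv P) t) (at t)"
      using 1 by (auto intro!: derivative_eq_intros poly_DERIV[THEN DERIV_chain2] simp: flat_def flat_deriv_def
          divide_simps algebra_simps power2_eq_square)
    moreover have "eventually (\<lambda>s. s > 0) (nhds t)"
      using 1 by (intro eventually_nhds_in_open[of "{0<..}", simplified]) auto
    then have "eventually (\<lambda>s. poly P (1/s) * exp (- (1/s)) = flat P s) (nhds t)"
      by eventually_elim (simp add: flat_def)
    ultimately show ?thesis by (subst DERIV_cong_ev[symmetric]) auto
  next
    case 2
    have "((\<lambda>t. 0) has_real_derivative flat (flat_deriv P) t) (at t)"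
      using 2 by (auto intro!: derivative_eq_intros simp: flat_def)
    moreover have "eventually (\<lambda>s. s < 0) (nhds t)"
      using 2 by (intro eventually_nhds_in_open[of "{..<0}", simplified]) auto
    then have "eventually (\<lambda>s. 0 = flat P s) (nhds t)"
      by eventually_elim (simp add: flat_def)
    ultimately show ?thesis by (subst DERIV_cong_ev[symmetric]) auto
  next
    case 3
    \<comment> \<open>Dividing by h multiplies the polynomial in 1/h by its variable, so the
      difference quotient at 0 is itself a member of the family, namely for
      \<open>pCons 0 P\<close>.\<close>
    have "((\<lambda>h. (flat P h - flat P 0) / h) \<longlongrightarrow> 0) (at 0)"
      by (rule Lim_transform_eventually[OF flat_tendsto_0[of "pCons 0 P"]])
        (auto simp: eventually_at_filter flat_def)
    then show ?thesis using 3 by (simp add: DERIV_def flat_def)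
  qed
qed

text \<open>Composition with an affine form is the only composition that occurs: all cutoffs below
  are sums and products of such functions, so smoothness needs no general chain rule for
  \<open>Ck\<close>.\<close>

lemma flat_affine_has_derivative:
  fixes e :: "'a::euclidean_space"
  shows "((\<lambda>x. flat P (x \<bullet> e + d)) has_derivative (\<lambda>v. flat (flat_deriv P) (x \<bullet> e + d) * (v \<bullet> e))) (at x)"
proof -
  have "((\<lambda>x. x \<bullet> e + d) has_derivative (\<lambda>v. v \<bullet> e)) (at x)"
    by (auto intro!: derivative_eq_intros)
  from has_derivative_compose[OF this flat_has_deriv[unfolded has_field_derivative_def]]
  show ?thesis by (simp add: mult.commute)
qed

lemma smooth_flat_affine: "smooth_fun (\<lambda>x::'a::euclidean_space. flat P (x \<bullet> e + d))"
proof -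
  have "Ck k (\<lambda>x. flat P (x \<bullet> e + d))" for k
  proof (induction k arbitrary: P)
    case 0
    have "continuous_on UNIV (\<lambda>x. flat P (x \<bullet> e + d))"
      using flat_affine_has_derivative has_derivative_continuous
      by (metis continuous_at_imp_continuous_on)
    then show ?case by simp
  next
    case (Suc k)
    have "frechet_derivative (\<lambda>x. flat P (x \<bullet> e + d)) (at x) v = flat (flat_deriv P) (x \<bullet> e + d) * (v \<bullet> e)" for x v
      by (rule frechet_derivative_eqI[OF flat_affine_has_derivative])
    moreover have "(\<lambda>x. flat P (x \<bullet> e + d)) differentiable at x" for x
      using flat_affine_has_derivative differentiable_def by blast
    ultimately show ?case using Suc by (auto intro!: Ck_mult Ck_const)
  qed
  then show ?thesis by (simp add: smooth_fun_def)
qed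

section \<open>Calculus of test functions and their gradients\<close>

lemma smooth_continuous: "smooth_fun f \<Longrightarrow> continuous_on UNIV f"
  unfolding smooth_fun_def using Ck.simps(1) by blast

lemma smooth_differentiable: "smooth_fun f \<Longrightarrow> f differentiable (at x)"
  unfolding smooth_fun_def using Ck.simps(2) by blast

lemma smooth_deriv: "smooth_fun f \<Longrightarrow> smooth_fun (\<lambda>x. frechet_derivative f (at x) v)"
  unfolding smooth_fun_def using Ck.simps(2) by blast

lemma test_funI:
  assumes "smooth_fun f" "compact K" "K \<subseteq> \<Omega>" "\<And>x. f x \<noteq> 0 \<Longrightarrow> x \<in> K"
  shows "test_fun \<Omega> f"
proof -
  have "closure {x. f x \<noteq> 0} \<subseteq> K"
    using assms by (intro closure_minimal) (auto simp: compact_imp_closed)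
  moreover have "compact (closure {x. f x \<noteq> 0})"
    using calculation assms(2) closed_closure[of "{x. f x \<noteq> 0}"]
    by (metis compact_Int_closed inf.absorb_iff2)
  ultimately show ?thesis
    using assms(1,3) by (auto simp: test_fun_def)
qed

text \<open>Off its closed support the function vanishes on an open set, so all directional
  derivatives vanish there too. This is what permits passing between integrals over \<Omega> and
  over the whole space.\<close>

lemma test_funE:
  assumes "test_fun \<Omega> f"
  obtains K where "compact K" "K \<subseteq> \<Omega>" "\<And>x. x \<notin> K \<Longrightarrow> f x = 0"
    "\<And>x v. x \<notin> K \<Longrightarrow> frechet_derivative f (at x) v = 0"
proof
  let ?K = "closure {x. f x \<noteq> 0}"
  show "compact ?K" "?K \<subseteq> \<Omega>" using assms by (auto simp: test_fun_def)
  show z: "f x = 0" if "x \<notin> ?K" for x using that closure_subset[of "{x. f x \<noteq> 0}"] by blast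
  show "frechet_derivative f (at x) v = 0" if "x \<notin> ?K" for x v
  proof -
    have "((\<lambda>_. 0) has_derivative (\<lambda>_. 0)) (at x)" by simp
    then have "(f has_derivative (\<lambda>_. 0)) (at x)"
    proof (rule has_derivative_transform_within_open)
      show "open (- ?K)" "x \<in> - ?K" using that by auto
      show "0 = f y" if "y \<in> - ?K" for y
        using z[of y] that unfolding Compl_iff by metis
    qed
    then show ?thesis by (rule frechet_derivative_eqI)
  qed
qed

lemma test_fun_smooth: "test_fun \<Omega> f \<Longrightarrow> smooth_fun f"
  by (simp add: test_fun_def)

lemma test_fun_mult_smooth:
  assumes "test_fun \<Omega> f" "smooth_fun g"
  shows "test_fun \<Omega> (\<lambda>x. g x * f x)"
proof -
  obtain K where K: "compact K" "K \<subseteq> \<Omega>" "\<And>x. x \<notin> K \<Longrightarrow> f x = 0"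
    by (rule test_funE[OF assms(1)], rule that)
  show ?thesis
    by (rule test_funI[OF _ K(1,2)]) (use K assms in \<open>auto intro: smooth_mult test_fun_smooth\<close>)
qed

lemma test_fun_cmult: "test_fun \<Omega> f \<Longrightarrow> test_fun \<Omega> (\<lambda>x. c * f x)"
  by (intro test_fun_mult_smooth smooth_const)

lemma test_fun_add:
  assumes "test_fun \<Omega> f" "test_fun \<Omega> g"
  shows "test_fun \<Omega> (\<lambda>x. f x + g x)"
proof -
  obtain K where K: "compact K" "K \<subseteq> \<Omega>" "\<And>x. x \<notin> K \<Longrightarrow> f x = 0"
    by (rule test_funE[OF assms(1)], rule that)
  obtain L where L: "compact L" "L \<subseteq> \<Omega>" "\<And>x. x \<notin> L \<Longrightarrow> g x = 0"
    by (rule test_funE[OF assms(2)], rule that)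
  show ?thesis
  proof (rule test_funI[of _ "K \<union> L"])
    show "x \<in> K \<union> L" if "f x + g x \<noteq> 0" for x 
      by (cases "x \<in> K"; cases "x \<in> L") (use that K(3)[of x] L(3)[of x] in simp_all)
  qed (use K L assms in \<open>simp_all add: smooth_add test_fun_smooth compact_Un\<close>)
qed

lemma test_fun_diff: "test_fun \<Omega> f \<Longrightarrow> test_fun \<Omega> g \<Longrightarrow> test_fun \<Omega> (\<lambda>x. f x - g x)"
  using test_fun_add[OF _ test_fun_cmult[of \<Omega> g "-1"]] by simp

lemma test_fun_0: "test_fun \<Omega> (\<lambda>x. 0)"
  by (rule test_funI[of _ "{}"]) (auto intro: smooth_const)

lemma grad_inner_Basis: "i \<in> Basis \<Longrightarrow> grad f x \<bullet> i = frechet_derivative f (at x) i"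
  by (simp add: grad_def inner_sum_left_Basis)

lemma frechet_derivative_grad:
  fixes f :: "'a::euclidean_space \<Rightarrow> real"
  assumes "f differentiable (at x)"
  shows "frechet_derivative f (at x) v = grad f x \<bullet> v"
proof -
  interpret bounded_linear "frechet_derivative f (at x)"
    using assms by (simp add: frechet_derivative_works has_derivative_def)
  have "frechet_derivative f (at x) v = frechet_derivative f (at x) (\<Sum>i\<in>Basis. (v \<bullet> i) *\<^sub>R i)"
    by (simp add: euclidean_representation)
  also have "\<dots> = (\<Sum>i\<in>Basis. (v \<bullet> i) * frechet_derivative f (at x) i)"
    by (simp add: sum scale)
  also have "\<dots> = grad f x \<bullet> v"
    by (simp add: grad_def inner_sum_left mult.commute inner_commute[of v])
  finally show ?thesis .
qed

lemma grad_add: "smooth_fun f \<Longrightarrow> smooth_fun g \<Longrightarrow> grad (\<lambda>x. f x + g x) x = grad f x + grad g x"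
  by (simp add: grad_def frechet_derivative_plus smooth_differentiable scaleR_left_distrib sum.distrib)

lemma grad_mult: "smooth_fun f \<Longrightarrow> smooth_fun g
    \<Longrightarrow> grad (\<lambda>x. f x * g x) x = f x *\<^sub>R grad g x + g x *\<^sub>R grad f x"
  by (simp add: grad_def frechet_derivative_mult smooth_differentiable scaleR_left_distrib sum.distrib
      scaleR_sum_right mult.commute)

lemma grad_cmult: "smooth_fun f \<Longrightarrow> grad (\<lambda>x. c * f x) x = c *\<^sub>R grad f x"
  by (simp add: grad_mult smooth_const) (simp add: grad_def frechet_derivative_const)

lemma grad_diff: "smooth_fun f \<Longrightarrow> smooth_fun g \<Longrightarrow> grad (\<lambda>x. f x - g x) x = grad f x - grad g x"
  using grad_add[OF _ smooth_mult[OF smooth_const[of "-1"]], of f g x] grad_cmult[of g "-1" x] by simp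

lemma grad_continuous: "smooth_fun f \<Longrightarrow> continuous_on UNIV (grad f)"
  unfolding grad_def by (intro continuous_intros smooth_continuous smooth_deriv)

section \<open>Spaces of \<open>p\<close>-integrable functions\<close>

text \<open>Young's inequality for x^p and y^p with weights 1/p and 1 - 1/p. Geometrically, the
  graph of t^p lies above its tangent at y.\<close>

lemma powr_tangent:
  fixes p :: real
  assumes "p > 1" "x \<ge> 0" "y \<ge> 0"
  shows "p * y powr (p - 1) * x \<le> x powr p + (p - 1) * y powr p"
proof (cases "x = 0 \<or> y = 0")
  case True
  then show ?thesis using assms by auto
next
  case False
  then have "(x powr p) powr (1/p) * (y powr p) powr (1 - 1/p) \<le> (1/p) * x powr p + (1 - 1/p) * y powr p"
    using assms by (intro Youngs_inequality_0) (auto simp: divide_simps)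
  moreover have "(y powr p) powr (1 - 1/p) = y powr (p - 1)" "(x powr p) powr (1/p) = x"
    using assms False by (auto simp: powr_powr right_diff_distrib)
  ultimately have "p * (x * y powr (p - 1)) \<le> p * ((1/p) * x powr p + (1 - 1/p) * y powr p)"
    using assms by (intro mult_left_mono) auto
  also have "\<dots> = x powr p + (p - 1) * y powr p"
    using assms by (simp add: field_simps)
  finally show ?thesis by (simp add: mult_ac)
qed

text \<open>The tangent at the larger of the two arguments bounds the increment, and its slope is at
  most p R^(p-1).\<close>

lemma powr_lipschitz:
  fixes p :: real
  assumes "p > 1" "0 \<le> x" "x \<le> R" "0 \<le> y" "y \<le> R"
  shows "\<bar>x powr p - y powr p\<bar> \<le> p * R powr (p - 1) * \<bar>x - y\<bar>"
proof -
  have *: "y powr p - x powr p \<le> p * R powr (p - 1) * \<bar>x - y\<bar>"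
    if "0 \<le> x" "x \<le> R" "0 \<le> y" "y \<le> R" for x y
  proof (cases "x \<le> y")
    case True
    have "y powr p = y powr (p - 1) * y"
      using that assms(1) by (cases "y = 0") (simp_all add: powr_diff)
    then have "y powr p - x powr p \<le> p * y powr (p - 1) * (y - x)"
      using powr_tangent[OF assms(1) that(1,3)] by (simp add: algebra_simps)
    also have "\<dots> \<le> p * R powr (p - 1) * (y - x)"
      using that assms True by (intro mult_right_mono mult_left_mono powr_mono2) auto
    finally show ?thesis using True by simp
  next
    case False
    then have "y powr p \<le> x powr p" using that assms(1) by (intro powr_mono2) auto
    moreover have "0 \<le> p * R powr (p - 1) * \<bar>x - y\<bar>" using assms(1) by simp
    ultimately show ?thesis by linarith
  qed
  show ?thesis using *[of x y] *[of y x] assms by (auto simp: abs_if split: if_splits)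
qed

text \<open>Convexity of s^p at a + b = (1 - t) (a / (1 - t)) + t (b / t). The weight t stays free
  so that Minkowski's inequality can choose it from the two norms.\<close>

lemma powr_add_le_weighted:
  fixes p t :: real
  assumes "p \<ge> 1" "0 < t" "t < 1" "a \<ge> 0" "b \<ge> 0"
  shows "(a + b) powr p \<le> (1 - t) powr (1 - p) * a powr p + t powr (1 - p) * b powr p"
proof -
  consider "a = 0" | "b = 0" | "a > 0" "b > 0" using assms by linarith
  then show ?thesis
  proof cases
    case 1
    have "1 * b powr p \<le> t powr (1 - p) * b powr p"
      using assms powr_mono2'[of "1 - p" t 1] by (intro mult_right_mono) auto
    then show ?thesis using 1 assms by simp
  next
    case 2
    have "1 * a powr p \<le> (1 - t) powr (1 - p) * a powr p"
      using assms powr_mono2'[of "1 - p" "1 - t" 1] by (intro mult_right_mono) auto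
    then show ?thesis using 2 assms by simp
  next
    case 3
    have "((1 - t) *\<^sub>R (a / (1 - t)) + t *\<^sub>R (b / t)) powr p
        \<le> (1 - t) * (a / (1 - t)) powr p + t * (b / t) powr p"
      using assms 3 by (intro convex_onD[OF powr_convex[OF assms(1)]]) auto
    also have "(1 - t) *\<^sub>R (a / (1 - t)) + t *\<^sub>R (b / t) = a + b" using assms by simp
    also have "(1 - t) * (a / (1 - t)) powr p = (1 - t) powr (1 - p) * a powr p"
      using assms 3 by (simp add: powr_divide powr_diff)
    also have "t * (b / t) powr p = t powr (1 - p) * b powr p"
      using assms 3 by (simp add: powr_divide powr_diff)
    finally show ?thesis .
  qed
qed

lemma powr_add_le:
  fixes p :: real
  assumes "p \<ge> 0" "a \<ge> 0" "b \<ge> 0"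
  shows "(a + b) powr p \<le> 2 powr p * (a powr p + b powr p)"
proof -
  have "(a + b) powr p \<le> (2 * max a b) powr p" using assms by (intro powr_mono2) auto
  also have "\<dots> = 2 powr p * (max a b) powr p" using assms by (simp add: powr_mult)
  also have "\<dots> \<le> 2 powr p * (a powr p + b powr p)"
    by (intro mult_left_mono) (auto simp: max_def)
  finally show ?thesis .
qed

lemma norm_add_powr_le:
  fixes p :: real
  assumes "p \<ge> 0"
  shows "norm (x + y) powr p \<le> 2 powr p * (norm x powr p + norm y powr p)"
  using powr_mono2[OF assms _ norm_triangle_ineq] powr_add_le[OF assms, of "norm x" "norm y"]
  by (metis norm_ge_zero order_trans)

section \<open>The p-integral, Minkowski's inequality and completeness\<close>

definition inLp :: "'a measure \<Rightarrow> real \<Rightarrow> ('a \<Rightarrow> 'b::euclidean_space) \<Rightarrow> bool" where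
  "inLp M p f \<longleftrightarrow> f \<in> borel_measurable M \<and> integrable M (\<lambda>x. norm (f x) powr p)"

text \<open>The p-th power of the norm is the working quantity: it is additive on disjoint supports
  and enters the functional directly. The measure is arbitrary because the arguments move between
  \<open>lebesgue_on \<Omega>\<close> and \<open>lborel\<close>.\<close>

definition pint :: "'a measure \<Rightarrow> real \<Rightarrow> ('a \<Rightarrow> 'b::euclidean_space) \<Rightarrow> real" where
  "pint M p f = (\<integral>x. norm (f x) powr p \<partial>M)"

definition pnorm :: "'a measure \<Rightarrow> real \<Rightarrow> ('a \<Rightarrow> 'b::euclidean_space) \<Rightarrow> real" where
  "pnorm M p f = pint M p f powr (1/p)"

lemma pint_nonneg: "pint M p f \<ge> 0"
  by (simp add: pint_def)

lemma pnorm_nonneg: "pnorm M p f \<ge> 0"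
  by (simp add: pnorm_def)

lemma pint_eq_pnorm: "p > 0 \<Longrightarrow> pint M p f = pnorm M p f powr p"
  using pint_nonneg[of M p f] by (simp add: pnorm_def powr_powr)

lemma inLp_measurable: "inLp M p f \<Longrightarrow> f \<in> borel_measurable M"
  by (simp add: inLp_def)

lemma inLp_add:
  assumes "p \<ge> 0" "inLp M p f" "inLp M p g"
  shows "inLp M p (\<lambda>x. f x + g x)"
proof -
  note [measurable] = assms(2,3)[THEN inLp_measurable]
  have "integrable M (\<lambda>x. norm (f x + g x) powr p)"
  proof (rule Bochner_Integration.integrable_bound)
    show "integrable M (\<lambda>x. 2 powr p * (norm (f x) powr p + norm (g x) powr p))"
      using assms by (auto simp: inLp_def)
  qed (use norm_add_powr_le[OF assms(1)] in auto)
  then show ?thesis by (simp add: inLp_def)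
qed

lemma inLp_scale: "inLp M p f \<Longrightarrow> inLp M p (\<lambda>x. c *\<^sub>R f x)"
  by (auto simp: inLp_def powr_mult)

lemma pint_scale: "pint M p (\<lambda>x. c *\<^sub>R f x) = \<bar>c\<bar> powr p * pint M p f"
  by (simp add: pint_def powr_mult)

lemma inLp_diff:
  assumes "p \<ge> 0" "inLp M p f" "inLp M p g"
  shows "inLp M p (\<lambda>x. f x - g x)"
  using inLp_add[OF assms(1,2) inLp_scale[OF assms(3), of "-1"]] by simp

lemma pint_add_le:
  assumes "p \<ge> 0" "inLp M p f" "inLp M p g"
  shows "pint M p (\<lambda>x. f x + g x) \<le> 2 powr p * (pint M p f + pint M p g)"
proof -
  have "pint M p (\<lambda>x. f x + g x) \<le> (\<integral>x. 2 powr p * (norm (f x) powr p + norm (g x) powr p) \<partial>M)"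
    unfolding pint_def using inLp_add[OF assms] assms
    by (intro integral_mono norm_add_powr_le) (auto simp: inLp_def)
  also have "\<dots> = 2 powr p * (pint M p f + pint M p g)"
    using assms by (simp add: inLp_def pint_def)
  finally show ?thesis .
qed

lemma pint_minus: "pint M p (\<lambda>x. - f x) = pint M p f"
  by (simp add: pint_def)

lemma pint_commute: "pint M p (\<lambda>x. f x - g x) = pint M p (\<lambda>x. g x - f x)"
  by (simp add: pint_def norm_minus_commute)

lemma pint_diff_le:
  assumes "p \<ge> 0" "inLp M p f" "inLp M p g"
  shows "pint M p (\<lambda>x. f x - g x) \<le> 2 powr p * (pint M p f + pint M p g)"
  using pint_add_le[OF assms(1,2) inLp_scale[OF assms(3), of "-1"]]
  by (simp add: pint_minus)

lemma pint_cong_AE: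
  assumes "f \<in> borel_measurable M" "g \<in> borel_measurable M" "AE x in M. f x = g x"
  shows "pint M p f = pint M p g"
  unfolding pint_def using assms by (intro integral_cong_AE) auto

lemma pnorm_zero_AE:
  assumes "inLp M p f" "pint M p f = 0"
  shows "AE x in M. f x = 0"
  using assms integral_nonneg_eq_0_iff_AE[of M "\<lambda>x. norm (f x) powr p"]
  by (auto simp: inLp_def pint_def)

text \<open>The weighted pointwise inequality with t = B / (A + B), where A and B are the two norms,
  integrates exactly to (A + B)^p. A vanishing norm would spoil the weight and is treated apart, the
  function then being zero almost everywhere.\<close>

lemma pnorm_triangle:
  assumes p: "p \<ge> 1" and f: "inLp M p f" and g: "inLp M p g"
  shows "pnorm M p (\<lambda>x. f x + g x) \<le> pnorm M p f + pnorm M p g"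
proof -
  note meas = f[THEN inLp_measurable] g[THEN inLp_measurable]
  define A where "A = pnorm M p f"
  define B where "B = pnorm M p g"
  have AB: "pint M p f = A powr p" "pint M p g = B powr p" "A \<ge> 0" "B \<ge> 0"
    using p by (auto simp: A_def B_def pint_eq_pnorm pnorm_nonneg)
  consider "A = 0" | "B = 0" | "A > 0" "B > 0" using AB by linarith
  then show ?thesis
  proof cases
    case 1
    then have "AE x in M. f x = 0" using AB f p by (intro pnorm_zero_AE) auto
    then have "pint M p (\<lambda>x. f x + g x) = pint M p g"
      using meas by (intro pint_cong_AE) auto
    then show ?thesis using 1 by (simp add: A_def pnorm_def)
  next
    case 2
    then have "AE x in M. g x = 0" using AB g p by (intro pnorm_zero_AE) auto
    then have "pint M p (\<lambda>x. f x + g x) = pint M p f"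
      using meas by (intro pint_cong_AE) auto
    then show ?thesis using 2 by (simp add: B_def pnorm_def)
  next
    case 3
    define t where "t = B / (A + B)"
    have t: "0 < t" "t < 1" "1 - t = A / (A + B)" using 3 by (auto simp: t_def divide_simps)
    have pw: "norm (f x + g x) powr p
      \<le> (1 - t) powr (1 - p) * norm (f x) powr p + t powr (1 - p) * norm (g x) powr p" for x
      using powr_mono2[OF _ norm_ge_zero norm_triangle_ineq[of "f x" "g x"], of p]
        powr_add_le_weighted[OF p t(1,2), of "norm (f x)" "norm (g x)"] p by auto
    have "pint M p (\<lambda>x. f x + g x) \<le>
      (\<integral>x. (1 - t) powr (1 - p) * norm (f x) powr p + t powr (1 - p) * norm (g x) powr p \<partial>M)"
      unfolding pint_def using pw inLp_add[OF _ f g] f g p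
      by (intro integral_mono) (auto simp: inLp_def)
    also have "\<dots> = (1 - t) powr (1 - p) * A powr p + t powr (1 - p) * B powr p"
      using f g AB by (simp add: inLp_def pint_def)
    also have "\<dots> = (A + B) powr (p - 1) * (A + B)"
    proof -
      have aux: "(X / (A + B)) powr (1 - p) * X powr p = (A + B) powr (p - 1) * X" if "X > 0" for X
      proof -
        have "X powr (1 - p) * X powr p = X" using that by (simp flip: powr_add)
        moreover have "(X / (A + B)) powr (1 - p) = X powr (1 - p) * (A + B) powr (p - 1)"
          using 3 that powr_minus_divide[of "A + B" "p - 1"] by (simp add: powr_divide field_simps)
        ultimately show ?thesis by (metis mult.assoc mult.commute)
      qed
      show ?thesis using aux[of A] aux[of B] 3 unfolding t(3) by (simp add: t_def algebra_simps)
    qed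
    also have "\<dots> = (A + B) powr p" using 3 by (simp add: powr_diff)
    finally have "pint M p (\<lambda>x. f x + g x) powr (1/p) \<le> ((A + B) powr p) powr (1/p)"
      using p by (intro powr_mono2 pint_nonneg) auto
    also have "\<dots> = A + B" using 3 p by (simp add: powr_powr)
    finally show ?thesis by (simp add: pnorm_def A_def B_def)
  qed
qed

lemma pint_tendsto:
  assumes p: "p \<ge> 1" and fn: "\<And>n. inLp M p (f n)" and f: "inLp M p g"
    and lim: "(\<lambda>n. pint M p (\<lambda>x. f n x - g x)) \<longlonglongrightarrow> 0"
  shows "(\<lambda>n. pint M p (f n)) \<longlonglongrightarrow> pint M p g"
proof -
  have p0: "p \<ge> 0" using p by simp
  have d: "(\<lambda>n. pnorm M p (\<lambda>x. f n x - g x)) \<longlonglongrightarrow> 0"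
    unfolding pnorm_def using lim p
    by (intro tendsto_eq_intros | simp add: pint_nonneg)+
  have 1: "pnorm M p (f n) \<le> pnorm M p (\<lambda>x. f n x - g x) + pnorm M p g" for n
    using pnorm_triangle[OF p inLp_diff[OF p0 fn f] f, of n] by simp
  have 2: "pnorm M p g \<le> pnorm M p (\<lambda>x. f n x - g x) + pnorm M p (f n)" for n
    using pnorm_triangle[OF p inLp_diff[OF p0 f fn] fn, of n n]
    by (simp add: pnorm_def pint_commute[of M p g])
  have "(\<lambda>n. pnorm M p (f n) - pnorm M p g) \<longlonglongrightarrow> 0"
  proof (rule tendsto_0_le[OF d, of _ 1], intro always_eventually allI)
    fix n show "norm (pnorm M p (f n) - pnorm M p g) \<le> norm (pnorm M p (\<lambda>x. f n x - g x)) * 1"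
      using 1[of n] 2[of n] pnorm_nonneg[of M p "\<lambda>x. f n x - g x"] by simp
  qed
  then have "(\<lambda>n. pnorm M p (f n)) \<longlonglongrightarrow> pnorm M p g" by (simp add: LIM_zero_iff)
  then have "(\<lambda>n. pnorm M p (f n) powr p) \<longlonglongrightarrow> pnorm M p g powr p"
    using p by (intro tendsto_powr') (auto simp: pnorm_nonneg)
  then show ?thesis using p by (simp add: pint_eq_pnorm)
qed

definition Lp_Cauchy :: "'a measure \<Rightarrow> real \<Rightarrow> (nat \<Rightarrow> 'a \<Rightarrow> 'b::euclidean_space) \<Rightarrow> bool" where
  "Lp_Cauchy M p f \<longleftrightarrow> (\<forall>e>0. \<exists>N. \<forall>m\<ge>N. \<forall>n\<ge>N. pint M p (\<lambda>x. f m x - f n x) < e)"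

text \<open>The Riesz-Fischer argument: along a fast subsequence the increments are dominated almost
  everywhere by a geometric series.\<close>

lemma Lp_Cauchy_subseq_AE_convergent:
  fixes f :: "nat \<Rightarrow> 'a \<Rightarrow> 'b::euclidean_space"
  assumes p: "p \<ge> 1" and f: "\<And>n. inLp M p (f n)" and C: "Lp_Cauchy M p f"
  obtains r where "strict_mono r" "AE x in M. convergent (\<lambda>n. f (r n) x)"
proof -
  have fm[measurable]: "f n \<in> borel_measurable M" for n using f by (simp add: inLp_def)
  \<comment> \<open>The second factor normalizes the n-th increment by 2^(-n), the first makes the
    normalized p-integrals summable. A finite sum c at a point then forces the n-th increment to be
    at most c^(1/p) 2^(-n) there.\<close>
  define \<epsilon> where "\<epsilon> n = (1/2) ^ n * ((1/2) ^ n) powr p" for n :: nat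
  have "\<exists>N. \<forall>m\<ge>N. \<forall>k\<ge>N. pint M p (\<lambda>x. f m x - f k x) < \<epsilon> n" for n
    using C by (auto simp: Lp_Cauchy_def \<epsilon>_def)
  then obtain N where N: "\<And>n m k. m \<ge> N n \<Longrightarrow> k \<ge> N n \<Longrightarrow> pint M p (\<lambda>x. f m x - f k x) < \<epsilon> n"
    by metis
  define r where "r = rec_nat (N 0) (\<lambda>n k. max (Suc k) (N (Suc n)))"
  have r_Suc: "r (Suc n) = max (Suc (r n)) (N (Suc n))" for n by (simp add: r_def)
  have mono: "strict_mono r" unfolding strict_mono_Suc_iff r_Suc by (simp add: less_max_iff_disj)
  have rN: "r n \<ge> N n" for n by (cases n) (simp_all add: r_def)
  have small: "pint M p (\<lambda>x. f (r (Suc n)) x - f (r n) x) < \<epsilon> n" for n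
    using N[OF order_trans[OF rN[of n]], of "r (Suc n)" "r n"] rN[of n] strict_monoD[OF mono, of n "Suc n"] by simp
  define g where "g n x = ennreal (norm (f (r (Suc n)) x - f (r n) x) powr p / ((1/2) ^ n) powr p)" for n x
  have gm[measurable]: "g n \<in> borel_measurable M" for n unfolding g_def by measurable
  have gint: "(\<integral>\<^sup>+x. g n x \<partial>M) \<le> ennreal ((1/2) ^ n)" for n
  proof -
    have i: "integrable M (\<lambda>x. norm (f (r (Suc n)) x - f (r n) x) powr p)"
      using inLp_diff[OF _ f f] p unfolding inLp_def by auto
    have "(\<integral>\<^sup>+x. g n x \<partial>M) = ennreal (pint M p (\<lambda>x. f (r (Suc n)) x - f (r n) x) / ((1/2) ^ n) powr p)"
      unfolding g_def pint_def using i by (subst nn_integral_eq_integral) auto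
    also have "\<dots> \<le> ennreal ((1/2) ^ n)"
      using small[of n] by (intro ennreal_leI) (auto simp: \<epsilon>_def divide_simps)
    finally show ?thesis .
  qed
  have "(\<integral>\<^sup>+x. (\<Sum>n. g n x) \<partial>M) = (\<Sum>n. \<integral>\<^sup>+x. g n x \<partial>M)"
    by (rule nn_integral_suminf) simp
  also have "\<dots> \<le> (\<Sum>n. ennreal ((1/2) ^ n))" by (intro suminf_le gint) auto
  also have "\<dots> = ennreal (\<Sum>n. (1/2) ^ n)" by (intro suminf_ennreal2) (auto intro: summable_geometric)
  also have "\<dots> < \<infinity>" by simp
  finally have "AE x in M. (\<Sum>n. g n x) \<noteq> \<infinity>"
    by (intro nn_integral_PInf_AE) auto
  then have "AE x in M. convergent (\<lambda>n. f (r n) x)"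
  proof eventually_elim
    case (elim x)
    then obtain c where c: "(\<Sum>n. g n x) = ennreal c" "c \<ge> 0"
      by (cases "\<Sum>n. g n x") auto
    have le: "norm (f (r (Suc n)) x - f (r n) x) \<le> c powr (1/p) * (1/2) ^ n" for n
    proof -
      let ?d = "norm (f (r (Suc n)) x - f (r n) x)"
      have "sum (\<lambda>n. g n x) {n} \<le> (\<Sum>n. g n x)" by (rule sum_le_suminf) auto
      then have "?d powr p / ((1/2) ^ n) powr p \<le> c" using c by (simp add: g_def)
      then have "?d powr p \<le> c * ((1/2) ^ n) powr p" by (simp add: divide_simps)
      then have "(?d powr p) powr (1/p) \<le> (c * ((1/2) ^ n) powr p) powr (1/p)"
        using p by (intro powr_mono2) auto
      then show ?thesis using p c by (simp add: powr_powr powr_mult)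
    qed
    have "summable (\<lambda>n. c powr (1/p) * (1/2) ^ n :: real)"
      by (intro summable_mult summable_geometric) simp
    then have "summable (\<lambda>n. f (r (Suc n)) x - f (r n) x)"
      by (rule summable_comparison_test') (rule le)
    then have "(\<lambda>n. (\<Sum>i<n. f (r (Suc i)) x - f (r i) x) + f (r 0) x) \<longlonglongrightarrow>
        (\<Sum>i. f (r (Suc i)) x - f (r i) x) + f (r 0) x"
      by (intro tendsto_add tendsto_const summable_LIMSEQ)
    then show ?case
      using sum_lessThan_telescope[of "\<lambda>i. f (r i) x"] by (auto simp: convergent_def)
  qed
  with mono that show thesis by blast
qed

text \<open>The limit is taken pointwise along the subsequence just found; Fatou's lemma then
  compares every late term of the full sequence with it.\<close>

lemma Lp_complete:
  fixes f :: "nat \<Rightarrow> 'a \<Rightarrow> 'b::euclidean_space"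
  assumes p: "p \<ge> 1" and f: "\<And>n. inLp M p (f n)" and C: "Lp_Cauchy M p f"
  obtains g where "inLp M p g" "(\<lambda>n. pint M p (\<lambda>x. f n x - g x)) \<longlonglongrightarrow> 0"
proof -
  have fm[measurable]: "f n \<in> borel_measurable M" for n using f by (simp add: inLp_def)
  obtain r where r: "strict_mono r" "AE x in M. convergent (\<lambda>n. f (r n) x)"
    using Lp_Cauchy_subseq_AE_convergent[OF assms] by blast
  define g where "g x = lim (\<lambda>n. f (r n) x)" for x
  have gm[measurable]: "g \<in> borel_measurable M" unfolding g_def by measurable
  have lim: "AE x in M. (\<lambda>n. f (r n) x) \<longlonglongrightarrow> g x"
    using r(2) by eventually_elim (simp add: g_def convergent_LIMSEQ_iff)
  have i: "integrable M (\<lambda>x. norm (f m x - f n x) powr p)" for m n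
    using inLp_diff[OF _ f f] p unfolding inLp_def by auto
  have key: "(\<integral>\<^sup>+x. ennreal (norm (f n x - g x) powr p) \<partial>M) \<le> ennreal e"
    if N: "\<forall>m\<ge>N. \<forall>n\<ge>N. pint M p (\<lambda>x. f m x - f n x) < e" and "n \<ge> N" for e n N
  proof -
    have "(\<integral>\<^sup>+x. ennreal (norm (f n x - g x) powr p) \<partial>M)
        = (\<integral>\<^sup>+x. liminf (\<lambda>k. ennreal (norm (f n x - f (r k) x) powr p)) \<partial>M)"
    proof (rule nn_integral_cong_AE, use lim in eventually_elim)
      case (elim x)
      have "(\<lambda>k. norm (f n x - f (r k) x) powr p) \<longlonglongrightarrow> norm (f n x - g x) powr p"
        using elim p by (intro tendsto_powr' tendsto_norm tendsto_diff tendsto_const) auto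
      then show ?case
        by (intro lim_imp_Liminf[symmetric] tendsto_ennrealI) simp
    qed
    also have "\<dots> \<le> liminf (\<lambda>k. \<integral>\<^sup>+x. ennreal (norm (f n x - f (r k) x) powr p) \<partial>M)"
      by (intro nn_integral_liminf) measurable
    also have "\<dots> \<le> ennreal e"
    proof (rule order_trans[OF Liminf_mono Liminf_le[of sequentially "\<lambda>_. ennreal e", simplified]], simp_all)
      show "\<forall>\<^sub>F k in sequentially. (\<integral>\<^sup>+x. ennreal (norm (f n x - f (r k) x) powr p) \<partial>M) \<le> ennreal e"
      proof (rule eventually_sequentiallyI)
        fix k assume "N \<le> k"
        then have "pint M p (\<lambda>x. f n x - f (r k) x) < e"
          using N \<open>n \<ge> N\<close> seq_suble[OF r(1), of k] by auto
        then show "(\<integral>\<^sup>+x. ennreal (norm (f n x - f (r k) x) powr p) \<partial>M) \<le> ennreal e"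
          using i by (subst nn_integral_eq_integral) (auto simp: pint_def intro: ennreal_leI)
      qed
    qed
    finally show ?thesis .
  qed
  have diff: "inLp M p (\<lambda>x. f n x - g x) \<and> pint M p (\<lambda>x. f n x - g x) \<le> e"
    if N: "\<forall>m\<ge>N. \<forall>n\<ge>N. pint M p (\<lambda>x. f m x - f n x) < e" "n \<ge> N" "e > 0" for e n N
  proof -
    have I: "integrable M (\<lambda>x. norm (f n x - g x) powr p)"
    proof (rule integrableI_bounded)
      have "(\<integral>\<^sup>+x. ennreal (norm (norm (f n x - g x) powr p)) \<partial>M) \<le> ennreal e"
        using key[OF N(1,2)] by simp
      then show "(\<integral>\<^sup>+x. ennreal (norm (norm (f n x - g x) powr p)) \<partial>M) < \<infinity>"
        using ennreal_less_top order_le_less_trans by (metis infinity_ennreal_def)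
    qed measurable
    have "ennreal (pint M p (\<lambda>x. f n x - g x)) \<le> ennreal e"
      using key[OF N(1,2)] I by (simp add: pint_def nn_integral_eq_integral)
    then show ?thesis using I N(3) by (simp add: inLp_def)
  qed
  obtain N1 where N1: "\<forall>m\<ge>N1. \<forall>n\<ge>N1. pint M p (\<lambda>x. f m x - f n x) < 1"
    using C zero_less_one unfolding Lp_Cauchy_def by blast
  have "inLp M p (\<lambda>x. f N1 x - g x)"
    using diff[OF N1 order_refl] by simp
  from inLp_diff[OF _ f this, of N1] p have "inLp M p g" by simp
  moreover have "(\<lambda>n. pint M p (\<lambda>x. f n x - g x)) \<longlonglongrightarrow> 0"
  proof (rule LIMSEQ_I)
    fix e :: real assume "e > 0"
    then obtain N where "\<forall>m\<ge>N. \<forall>n\<ge>N. pint M p (\<lambda>x. f m x - f n x) < e / 2"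
      using C unfolding Lp_Cauchy_def by (meson half_gt_zero)
    note N = this
    have "norm (pint M p (\<lambda>x. f n x - g x) - 0) < e" if "n \<ge> N" for n
    proof -
      have "pint M p (\<lambda>x. f n x - g x) \<le> e / 2" using diff[OF N that] \<open>e > 0\<close> by simp
      then show ?thesis using \<open>e > 0\<close> pint_nonneg[of M p "\<lambda>x. f n x - g x"] by simp
    qed
    then show "\<exists>N. \<forall>n\<ge>N. norm (pint M p (\<lambda>x. f n x - g x) - 0) < e" by blast
  qed
  ultimately show thesis by (rule that)
qed

lemma Lp_convergent_Cauchy:
  fixes f :: "nat \<Rightarrow> 'a \<Rightarrow> 'b::euclidean_space"
  assumes p: "p \<ge> 0" and L: "\<And>n. inLp M p (\<lambda>x. f n x - g x)"
    and lim: "(\<lambda>n. pint M p (\<lambda>x. f n x - g x)) \<longlonglongrightarrow> 0"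
  shows "Lp_Cauchy M p f"
  unfolding Lp_Cauchy_def
proof (intro allI impI)
  fix e :: real assume e: "e > 0"
  define d where "d = e / (2 * 2 powr p)"
  have d: "d > 0" using e by (simp add: d_def)
  obtain N where N: "\<And>n. n \<ge> N \<Longrightarrow> pint M p (\<lambda>x. f n x - g x) < d"
    using order_tendstoD(2)[OF lim d] by (auto simp: eventually_sequentially)
  have "pint M p (\<lambda>x. f a x - f b x) < e" if "a \<ge> N" "b \<ge> N" for a b
  proof -
    have "pint M p (\<lambda>x. f a x - f b x) = pint M p (\<lambda>x. (f a x - g x) - (f b x - g x))" by simp
    also have "\<dots> \<le> 2 powr p * (pint M p (\<lambda>x. f a x - g x) + pint M p (\<lambda>x. f b x - g x))"
      by (intro pint_diff_le L p)
    also have "\<dots> < 2 powr p * (d + d)" using N[OF that(1)] N[OF that(2)] by (intro mult_strict_left_mono) auto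
    also have "\<dots> = e" by (simp add: d_def)
    finally show ?thesis .
  qed
  then show "\<exists>N. \<forall>m\<ge>N. \<forall>n\<ge>N. pint M p (\<lambda>x. f m x - f n x) < e" by blast
qed

lemma pint_tendsto_0_subseq_AE:
  fixes f :: "nat \<Rightarrow> 'a \<Rightarrow> 'b::euclidean_space"
  assumes p: "p > 0" and f: "\<And>n. inLp M p (\<lambda>x. f n x - g x)"
    and lim: "(\<lambda>n. pint M p (\<lambda>x. f n x - g x)) \<longlonglongrightarrow> 0"
  obtains r where "strict_mono r" "AE x in M. (\<lambda>n. f (r n) x) \<longlonglongrightarrow> g x"
proof -
  obtain r where r: "strict_mono r" "AE x in M. (\<lambda>n. norm (f (r n) x - g x) powr p) \<longlonglongrightarrow> 0"
    using tendsto_L1_AE_subseq[of M "\<lambda>n x. norm (f n x - g x) powr p"] f lim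
    by (auto simp: inLp_def pint_def)
  from r(2) have "AE x in M. (\<lambda>n. f (r n) x) \<longlonglongrightarrow> g x"
  proof eventually_elim
    case (elim x)
    then have "(\<lambda>n. (norm (f (r n) x - g x) powr p) powr (1/p)) \<longlonglongrightarrow> 0 powr (1/p)"
      using p by (intro tendsto_powr') auto
    then show ?case using p by (simp add: powr_powr tendsto_norm_zero_iff LIM_zero_iff)
  qed
  with r(1) that show thesis by blast
qed

text \<open>The second almost everywhere convergent subsequence is extracted from the first, so both
  limits are seen along the same indices. It identifies limits of one sequence taken in two
  different exponents.\<close>

lemma Lp_limits_AE_eq:
  fixes f :: "nat \<Rightarrow> 'a \<Rightarrow> 'b::euclidean_space"
  assumes "p > 0" "q > 0" and f: "\<And>n. inLp M p (\<lambda>x. f n x - g x)" "\<And>n. inLp M q (\<lambda>x. f n x - h x)"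
    and lim: "(\<lambda>n. pint M p (\<lambda>x. f n x - g x)) \<longlonglongrightarrow> 0" "(\<lambda>n. pint M q (\<lambda>x. f n x - h x)) \<longlonglongrightarrow> 0"
  shows "AE x in M. g x = h x"
proof -
  obtain r where r: "strict_mono r" "AE x in M. (\<lambda>n. f (r n) x) \<longlonglongrightarrow> g x"
    using pint_tendsto_0_subseq_AE[OF assms(1) f(1) lim(1)] by blast
  have "(\<lambda>n. pint M q (\<lambda>x. f (r n) x - h x)) \<longlonglongrightarrow> 0"
    using LIMSEQ_subseq_LIMSEQ[OF lim(2) r(1)] by (simp add: o_def)
  then obtain s where s: "strict_mono s" "AE x in M. (\<lambda>n. f (r (s n)) x) \<longlonglongrightarrow> h x"
    using pint_tendsto_0_subseq_AE[OF assms(2), of M "\<lambda>n. f (r n)" h] f(2) by blast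
  from r(2) s(2) show ?thesis
  proof eventually_elim
    case (elim x)
    then show ?case
      using LIMSEQ_subseq_LIMSEQ[OF elim(1) s(1)] LIMSEQ_unique[OF elim(2)] by (simp add: o_def)
  qed
qed

text \<open>If y exceeds \<delta>, then (y / \<delta>)^(p-1) is at least 1. With \<delta> free this
  takes the place of Hoelder's inequality, without a conjugate exponent and including p = 1.\<close>

lemma le_eps_plus_powr:
  fixes p \<delta> y :: real
  assumes "p \<ge> 1" "\<delta> > 0" "y \<ge> 0"
  shows "y \<le> \<delta> + \<delta> powr (1 - p) * y powr p"
proof (cases "y \<le> \<delta>")
  case False
  then have "\<delta> powr (p - 1) \<le> y powr (p - 1)" using assms by (intro powr_mono2) auto
  then have "1 \<le> \<delta> powr (1 - p) * y powr (p - 1)"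
    using assms mult_left_mono[of "\<delta> powr (p - 1)" "y powr (p - 1)" "\<delta> powr (1 - p)"]
    by (simp flip: powr_add)
  then have "y * 1 \<le> y * (\<delta> powr (1 - p) * y powr (p - 1))" using assms by (intro mult_left_mono) auto
  also have "\<dots> = \<delta> powr (1 - p) * y powr p" using False assms by (simp add: powr_diff)
  finally show ?thesis using assms by simp
next
  case True
  then show ?thesis by (rule add_increasing2[rotated]) simp
qed

lemma inLp_mult_integrable:
  assumes p: "p \<ge> 1" and f: "inLp M p f" and w: "integrable M w"
    and B: "\<And>x. \<bar>w x\<bar> \<le> (B::real)"
  shows "integrable M (\<lambda>x. (f x::real) * w x)"
proof (rule Bochner_Integration.integrable_bound)
  note [measurable] = inLp_measurable[OF f] borel_measurable_integrable[OF w]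
  show "(\<lambda>x. f x * w x) \<in> borel_measurable M" by measurable
  show "integrable M (\<lambda>x. \<bar>w x\<bar> + B * \<bar>f x\<bar> powr p)" using f w by (auto simp: inLp_def)
  show "AE x in M. norm (f x * w x) \<le> norm (\<bar>w x\<bar> + B * \<bar>f x\<bar> powr p)"
  proof (intro AE_I2)
    fix x
    have "B \<ge> 0" using B[of x] by simp
    have "\<bar>f x\<bar> * \<bar>w x\<bar> \<le> (1 + \<bar>f x\<bar> powr p) * \<bar>w x\<bar>"
      using le_eps_plus_powr[OF p, of 1 "\<bar>f x\<bar>"] by (intro mult_right_mono) auto
    also have "\<dots> \<le> \<bar>w x\<bar> + B * \<bar>f x\<bar> powr p"
      using mult_right_mono[OF B[of x], of "\<bar>f x\<bar> powr p"] by (simp add: algebra_simps)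
    finally show "norm (f x * w x) \<le> norm (\<bar>w x\<bar> + B * \<bar>f x\<bar> powr p)"
      using \<open>B \<ge> 0\<close> by (simp add: abs_mult)
  qed
qed

text \<open>Each error integral is at most \<delta> times the L^1 norm of the weight plus a
  multiple, depending on \<delta>, of the p-integral of the difference. First \<delta> is made
  small, then n large.\<close>

lemma Lp_tendsto_integral_mult:
  fixes f :: "nat \<Rightarrow> 'a \<Rightarrow> real"
  assumes p: "p \<ge> 1" and f: "\<And>n. inLp M p (f n)" and g: "inLp M p g" and w: "integrable M w"
    and B: "\<And>x. \<bar>w x\<bar> \<le> B"
    and lim: "(\<lambda>n. pint M p (\<lambda>x. f n x - g x)) \<longlonglongrightarrow> 0"
  shows "(\<lambda>n. \<integral>x. f n x * w x \<partial>M) \<longlonglongrightarrow> (\<integral>x. g x * w x \<partial>M)"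
proof -
  have d: "inLp M p (\<lambda>x. f n x - g x)" for n using inLp_diff[OF _ f g] p by auto
  have bnd: "\<bar>(\<integral>x. f n x * w x \<partial>M) - (\<integral>x. g x * w x \<partial>M)\<bar>
     \<le> \<delta> * (\<integral>x. \<bar>w x\<bar> \<partial>M) + \<delta> powr (1 - p) * B * pint M p (\<lambda>x. f n x - g x)" if "\<delta> > 0" for \<delta> n
  proof -
    have B0: "B \<ge> 0" using B[of undefined] by simp
    have pw: "\<bar>(f n x - g x) * w x\<bar> \<le> \<delta> * \<bar>w x\<bar> + \<delta> powr (1 - p) * B * \<bar>f n x - g x\<bar> powr p" for x
    proof -
      have "\<bar>f n x - g x\<bar> * \<bar>w x\<bar> \<le> (\<delta> + \<delta> powr (1 - p) * \<bar>f n x - g x\<bar> powr p) * \<bar>w x\<bar>"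
        using le_eps_plus_powr[OF p that, of "\<bar>f n x - g x\<bar>"] by (intro mult_right_mono) auto
      also have "\<dots> \<le> \<delta> * \<bar>w x\<bar> + \<delta> powr (1 - p) * B * \<bar>f n x - g x\<bar> powr p"
        using mult_left_mono[OF B[of x], of "\<delta> powr (1 - p) * \<bar>f n x - g x\<bar> powr p"] by (simp add: algebra_simps)
      finally show ?thesis by (simp add: abs_mult)
    qed
    have "(\<integral>x. f n x * w x \<partial>M) - (\<integral>x. g x * w x \<partial>M) = (\<integral>x. (f n x - g x) * w x \<partial>M)"
      using inLp_mult_integrable[OF p _ w B] f g by (simp add: left_diff_distrib)
    also have "\<bar>\<dots>\<bar> \<le> (\<integral>x. \<bar>(f n x - g x) * w x\<bar> \<partial>M)" by (rule integral_abs_bound)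
    also have "\<dots> \<le> (\<integral>x. \<delta> * \<bar>w x\<bar> + \<delta> powr (1 - p) * B * \<bar>f n x - g x\<bar> powr p \<partial>M)"
      using inLp_mult_integrable[OF p d w B] w d[of n] by (intro integral_mono pw) (auto simp: inLp_def)
    also have "\<dots> = \<delta> * (\<integral>x. \<bar>w x\<bar> \<partial>M) + \<delta> powr (1 - p) * B * pint M p (\<lambda>x. f n x - g x)"
      using w d[of n] by (simp add: inLp_def pint_def)
    finally show ?thesis .
  qed
  show ?thesis
  proof (rule LIMSEQ_I)
    fix e :: real assume e: "e > 0"
    define W where "W = (\<integral>x. \<bar>w x\<bar> \<partial>M)"
    have W: "W \<ge> 0" by (simp add: W_def)
    define \<delta> where "\<delta> = e / (2 * (W + 1))"
    have \<delta>: "\<delta> > 0" "\<delta> * W < e / 2" using W e by (auto simp: \<delta>_def divide_simps algebra_simps)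
    have "(\<lambda>n. \<delta> powr (1 - p) * B * pint M p (\<lambda>x. f n x - g x)) \<longlonglongrightarrow> \<delta> powr (1 - p) * B * 0"
      by (intro tendsto_mult tendsto_const lim)
    then have "\<forall>\<^sub>F n in sequentially. \<delta> powr (1 - p) * B * pint M p (\<lambda>x. f n x - g x) < e / 2"
      using e by (intro order_tendstoD(2)) auto
    then obtain N where N: "\<forall>n\<ge>N. \<delta> powr (1 - p) * B * pint M p (\<lambda>x. f n x - g x) < e / 2"
      by (auto simp: eventually_sequentially)
    show "\<exists>N. \<forall>n\<ge>N. norm ((\<integral>x. f n x * w x \<partial>M) - (\<integral>x. g x * w x \<partial>M)) < e"
    proof (intro exI allI impI)
      fix n assume "n \<ge> N"
      then show "norm ((\<integral>x. f n x * w x \<partial>M) - (\<integral>x. g x * w x \<partial>M)) < e"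
        using bnd[OF \<delta>(1), of n] N[rule_format, of n] \<delta>(2) by (simp add: W_def)
    qed
  qed
qed

section \<open>Uniform convexity and differentiability of the \<open>p\<close>-integral\<close>

text \<open>After division by the midpoint m, the strict tangent inequality at 1 is added for x/m
  and y/m; the linear terms cancel because these numbers sum to 2.\<close>

lemma powr_midpoint_less:
  fixes p x y :: real
  assumes p: "p > 1" and "x \<ge> 0" "y \<ge> 0" "x \<noteq> y"
  shows "((x + y) / 2) powr p < (x powr p + y powr p) / 2"
proof -
  have strict: "s powr p > 1 + p * (s - 1)" if s: "s \<ge> 0" "s \<noteq> 1" for s
  proof (cases "s = 0")
    case False
    then have "s > 0" using s by simp
    have der: "((\<lambda>s. s powr p) has_real_derivative p * z powr (p - 1)) (at z)" if "z > 0" for z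
      using that by (auto intro!: derivative_eq_intros)
    consider "s > 1" | "s < 1" using s by linarith
    then show ?thesis
    proof cases
      case 1
      obtain z where z: "1 < z" "z < s" "s powr p - 1 powr p = (s - 1) * (p * z powr (p - 1))"
        using MVT2[OF 1, of "\<lambda>s. s powr p" "\<lambda>z. p * z powr (p - 1)"] der by force
      have "1 < z powr (p - 1)" using z p by (intro gr_one_powr) auto
      then have "(s - 1) * (p * 1) < (s - 1) * (p * z powr (p - 1))"
        using 1 p by (intro mult_strict_left_mono) auto
      then show ?thesis using z by (simp add: algebra_simps)
    next
      case 2
      obtain z where z: "s < z" "z < 1" "1 powr p - s powr p = (1 - s) * (p * z powr (p - 1))"
        using MVT2[OF 2, of "\<lambda>s. s powr p" "\<lambda>z. p * z powr (p - 1)"] der \<open>s > 0\<close> by force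
      have "z powr (p - 1) < 1 powr (p - 1)" using z p \<open>s > 0\<close> by (intro powr_less_mono2) auto
      then have "(1 - s) * (p * z powr (p - 1)) < (1 - s) * (p * 1)"
        using 2 p by (intro mult_strict_left_mono) auto
      then show ?thesis using z by (simp add: algebra_simps)
    qed
  qed (use p in auto)
  define m where "m = (x + y) / 2"
  have m: "m > 0" "x / m \<noteq> 1" "y / m \<noteq> 1" "x / m + y / m = 2"
    using assms by (auto simp: m_def divide_simps)
  have "(x / m) powr p + (y / m) powr p > (1 + p * (x / m - 1)) + (1 + p * (y / m - 1))"
    using assms m by (intro add_strict_mono strict) auto
  also have "(1 + p * (x / m - 1)) + (1 + p * (y / m - 1)) = 2 + p * ((x / m + y / m) - 2)"
    by (simp only: algebra_simps)
  also have "\<dots> = 2" using m by simp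
  finally have "2 < (x powr p + y powr p) / m powr p"
    using m assms by (simp add: powr_divide add_divide_distrib)
  then show ?thesis using m(1) unfolding m_def[symmetric] by (simp add: divide_simps)
qed

text \<open>Strictness has two sources. For distinct norms it comes from strict convexity of the
  power; for equal norms the parallelogram law makes the midpoint strictly shorter.\<close>

lemma norm_powr_midpoint_less:
  fixes a b :: "'b::euclidean_space"
  assumes p: "p > 1" and "a \<noteq> b"
  shows "norm ((1/2) *\<^sub>R (a + b)) powr p < (norm a powr p + norm b powr p) / 2"
proof (cases "norm a = norm b")
  case True
  have "(norm (a + b))\<^sup>2 + (norm (a - b))\<^sup>2 = 4 * (norm a)\<^sup>2"
    unfolding power2_norm_eq_inner using True
    by (simp add: norm_eq inner_simps inner_commute)
  then have "(norm (a + b))\<^sup>2 < (2 * norm a)\<^sup>2" using assms(2)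
    by (simp add: power_mult_distrib algebra_simps) (smt (verit) right_minus_eq zero_less_norm_iff zero_less_power)
  then have "norm (a + b) < 2 * norm a" by (rule power2_less_imp_less) simp
  then have "norm ((1/2) *\<^sub>R (a + b)) powr p < norm a powr p"
    using p by (intro powr_less_mono2) auto
  then show ?thesis using True by simp
next
  case False
  have "norm ((1/2) *\<^sub>R (a + b)) \<le> (norm a + norm b) / 2"
    using norm_triangle_ineq[of a b] by simp
  then have "norm ((1/2) *\<^sub>R (a + b)) powr p \<le> ((norm a + norm b) / 2) powr p"
    using p by (intro powr_mono2) auto
  also have "\<dots> < (norm a powr p + norm b powr p) / 2"
    using p False by (intro powr_midpoint_less) auto
  finally show ?thesis .
qed

lemma norm_powr_midpoint_le:
  fixes a b :: "'b::euclidean_space"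
  assumes p: "p > 1"
  shows "norm ((1/2) *\<^sub>R (a + b)) powr p \<le> (norm a powr p + norm b powr p) / 2"
  using norm_powr_midpoint_less[OF p, of a b] by (cases "a = b") (auto simp flip: scaleR_2)

text \<open>A compactness argument: on the unit sphere of pairs, wherever the \<delta>-term is
  insufficient the midpoint defect is strictly positive, so the quotient of |a - b|^p by the defect
  has a maximum C. All terms are homogeneous of degree p, which extends the estimate to all pairs.
  It covers every p > 1 at once, with no case distinction at p = 2.\<close>

lemma uniform_convexity_pointwise:
  fixes p \<delta> :: real
  assumes p: "p > 1" and \<delta>: "\<delta> > 0"
  obtains C where "C \<ge> 0" "\<And>a b::'b::euclidean_space. norm (a - b) powr p \<le> \<delta> * (norm a powr p + norm b powr p)
      + C * ((norm a powr p + norm b powr p) / 2 - norm ((1/2) *\<^sub>R (a + b)) powr p)"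
proof -
  define S where "S z = norm (fst z) powr p + norm (snd z) powr p" for z :: "'b \<times> 'b"
  define d where "d z = norm (fst z - snd z) powr p" for z :: "'b \<times> 'b"
  define D where "D z = S z / 2 - norm ((1/2) *\<^sub>R (fst z + snd z)) powr p" for z :: "'b \<times> 'b"
  have cont: "continuous_on UNIV S" "continuous_on UNIV d" "continuous_on UNIV D"
    unfolding S_def d_def D_def using p by (auto intro!: continuous_intros continuous_on_powr')
  have D0: "D z \<ge> 0" for z
    using norm_powr_midpoint_le[OF p, of "fst z" "snd z"] by (simp add: D_def S_def)
  have S0: "S z \<ge> 0" for z by (simp add: S_def)
  \<comment> \<open>The unit pairs at which the \<delta>-term alone may fail to dominate; off this
    set the defect term is only required to be nonnegative.\<close>
  define K where "K = sphere 0 1 \<inter> {z. \<delta> * S z \<le> d z}"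
  have "compact K" unfolding K_def
    by (intro compact_Int_closed compact_sphere closed_Collect_le continuous_intros cont)
  have Dpos: "D z > 0" if "z \<in> K" for z
  proof -
    have "fst z \<noteq> snd z"
    proof
      assume eq: "fst z = snd z"
      then have "\<delta> * S z \<le> 0" using that p by (simp add: K_def d_def)
      then have "S z = 0" using \<delta> S0[of z] by (simp add: mult_le_0_iff)
      then have "z = 0" using eq by (simp add: S_def prod_eq_iff)
      then show False using that by (simp add: K_def)
    qed
    then show ?thesis using norm_powr_midpoint_less[OF p] by (simp add: D_def S_def)
  qed
  have "\<exists>C\<ge>0. \<forall>z\<in>sphere 0 1. d z \<le> \<delta> * S z + C * D z"
  proof (cases "K = {}")
    case True
    then show ?thesis by (intro exI[of _ 0]) (force simp: K_def)
  next
    case False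
    have "continuous_on K (\<lambda>z. d z / D z)"
      using cont Dpos by (intro continuous_intros) (auto intro: continuous_on_subset simp: less_imp_neq[symmetric])
    from continuous_attains_sup[OF \<open>compact K\<close> False this]
    obtain w where w: "w \<in> K" "\<And>z. z \<in> K \<Longrightarrow> d z / D z \<le> d w / D w" by blast
    have C0: "d w / D w \<ge> 0" using D0 by (simp add: d_def)
    have "d z \<le> \<delta> * S z + d w / D w * D z" if z: "z \<in> sphere 0 1" for z
    proof (cases "z \<in> K")
      case True
      then have "d z \<le> d w / D w * D z" using w(2)[OF True] Dpos[OF True] by (simp add: pos_divide_le_eq)
      then show ?thesis using S0[of z] \<delta> by (simp add: add_increasing)
    next
      case False
      then have "d z \<le> \<delta> * S z" using z by (simp add: K_def)
      moreover have "0 \<le> d w / D w * D z" using C0 D0[of z] by (rule mult_nonneg_nonneg)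
      ultimately show ?thesis by linarith
    qed
    then show ?thesis using C0 by blast
  qed
  then obtain C where C: "C \<ge> 0" "\<And>z. z \<in> sphere 0 1 \<Longrightarrow> d z \<le> \<delta> * S z + C * D z" by blast
  have "norm (a - b) powr p \<le> \<delta> * (norm a powr p + norm b powr p)
      + C * ((norm a powr p + norm b powr p) / 2 - norm ((1/2) *\<^sub>R (a + b)) powr p)" for a b :: 'b
  proof (cases "(a, b) = 0")
    case True
    then show ?thesis using p by (simp add: zero_prod_def)
  next
    case False
    \<comment> \<open>Scaling to the unit sphere multiplies each of the terms by the same factor
      (1/r)^p, which cancels in the end.\<close>
    define r where "r = norm (a, b)"
    have r: "r > 0" using False unfolding r_def by simp
    define z where "z = (1/r) *\<^sub>R (a, b)"
    have z: "z \<in> sphere 0 1" using r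
      unfolding z_def by (simp add: r_def[symmetric] norm_scaleR[of "1/r" "(a, b)", unfolded scaleR_Pair])
    have f: "fst z = (1/r) *\<^sub>R a" "snd z = (1/r) *\<^sub>R b" by (simp_all add: z_def)
    have dz: "d z = (1/r) powr p * norm (a - b) powr p"
      unfolding d_def f scaleR_diff_right[symmetric] using r by (simp add: powr_mult[symmetric])
    have Sz: "S z = (1/r) powr p * (norm a powr p + norm b powr p)"
      unfolding S_def f using r by (simp add: powr_mult powr_divide add_divide_distrib)
    have mz: "norm ((1/2) *\<^sub>R (fst z + snd z)) powr p = (1/r) powr p * norm ((1/2) *\<^sub>R (a + b)) powr p"
      unfolding f scaleR_add_right[symmetric] scaleR_left_commute[of _ "1/r"] norm_scaleR[of "1/r"] using r
      by (simp add: powr_mult powr_divide)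
    have "(1/r) powr p * norm (a - b) powr p \<le> (1/r) powr p * (\<delta> * (norm a powr p + norm b powr p)
      + C * ((norm a powr p + norm b powr p) / 2 - norm ((1/2) *\<^sub>R (a + b)) powr p))"
      using C(2)[OF z] unfolding D_def mz Sz dz by (simp add: algebra_simps)
    then show ?thesis using r by (simp add: mult_le_cancel_left_pos)
  qed
  with C(1) that show thesis by blast
qed

text \<open>For a = 0 both sides vanish: |t b|^p is o(t) since p > 1, and the inner product is zero,
  whatever the sign of p - 2. Otherwise |v|^p is written as the power p/2 of v \<bullet> v, which is
  smooth near a.\<close>

lemma norm_powr_has_derivative:
  fixes a b :: "'b::euclidean_space"
  assumes p: "p > 1"
  shows "((\<lambda>t. norm (a + t *\<^sub>R b) powr p) has_real_derivative p * (norm a powr (p - 2) * (a \<bullet> b))) (at 0)"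
proof (cases "a = 0")
  case True
  have "((\<lambda>t::real. norm b powr p * (\<bar>t\<bar> powr (p - 1))) \<longlongrightarrow> norm b powr p * \<bar>0\<bar> powr (p - 1)) (at 0)"
    using p by (intro tendsto_mult tendsto_const tendsto_powr' tendsto_rabs tendsto_ident_at) auto
  then have l: "((\<lambda>t::real. norm b powr p * (\<bar>t\<bar> powr (p - 1))) \<longlongrightarrow> 0) (at 0)" by simp
  have "((\<lambda>t. norm (t *\<^sub>R b) powr p / t) \<longlongrightarrow> 0) (at 0)"
  proof (rule tendsto_0_le[OF l, of _ 1], intro always_eventually allI)
    fix t :: real
    show "norm (norm (t *\<^sub>R b) powr p / t) \<le> norm (norm b powr p * \<bar>t\<bar> powr (p - 1)) * 1"
      by (cases "t = 0") (simp_all add: powr_mult powr_diff abs_mult mult.commute)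
  qed
  then show ?thesis using True p by (simp add: DERIV_def)
next
  case False
  have 1: "((\<lambda>t. (a + t *\<^sub>R b) \<bullet> (a + t *\<^sub>R b)) has_real_derivative 2 * (a \<bullet> b)) (at 0)"
    unfolding has_field_derivative_def
    by (auto intro!: derivative_eq_intros simp: fun_eq_iff inner_commute)
  have eq: "norm v powr p = (v \<bullet> v) powr (p/2)" for v :: 'b
    by (simp add: norm_eq_sqrt_inner powr_half_sqrt[symmetric] powr_powr)
  have "((\<lambda>t. ((a + t *\<^sub>R b) \<bullet> (a + t *\<^sub>R b)) powr (p/2)) has_real_derivative
      (p/2) * (a \<bullet> a) powr (p/2 - 1) * (2 * (a \<bullet> b))) (at 0)"
    using False DERIV_fun_powr[OF 1, of "p/2"] by simp
  moreover have "(a \<bullet> a) powr (p/2 - 1) = norm a powr (p - 2)"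
    by (simp add: norm_eq_sqrt_inner powr_half_sqrt[symmetric] powr_powr diff_divide_distrib)
  ultimately show ?thesis unfolding eq by (simp add: mult.assoc)
qed

text \<open>Dominated convergence of the difference quotients along arbitrary null sequences; the
  Lipschitz bound for powers supplies the majorant.\<close>

lemma pint_has_derivative:
  fixes f g :: "'a \<Rightarrow> 'b::euclidean_space"
  assumes p: "p > 1" and f: "inLp M p f" and g: "inLp M p g"
  shows "((\<lambda>t. pint M p (\<lambda>x. f x + t *\<^sub>R g x)) has_real_derivative
      p * (\<integral>x. norm (f x) powr (p - 2) * (f x \<bullet> g x) \<partial>M)) (at 0)"
proof -
  note [measurable] = f[THEN inLp_measurable] g[THEN inLp_measurable]
  have i: "integrable M (\<lambda>x. norm (f x + t *\<^sub>R g x) powr p)" for t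
    using inLp_add[OF _ f inLp_scale[OF g, of t]] p by (auto simp: inLp_def)
  have "((\<lambda>h. (pint M p (\<lambda>x. f x + h *\<^sub>R g x) - pint M p f) / h) \<longlongrightarrow>
      (\<integral>x. p * (norm (f x) powr (p - 2) * (f x \<bullet> g x)) \<partial>M)) (at 0)"
    unfolding tendsto_at_iff_sequentially
  proof (intro allI impI)
    fix h :: "nat \<Rightarrow> real" assume h: "\<forall>i. h i \<in> UNIV - {0}" "h \<longlonglongrightarrow> 0"
    then have h0: "h n \<noteq> 0" for n by auto
    have "bounded (range h)" using h(2) convergent_imp_bounded by blast
    then obtain B where B: "\<And>n. \<bar>h n\<bar> \<le> B" by (auto simp: bounded_iff)
    have B0: "B \<ge> 0" using B[of 0] by simp
    have e: "(pint M p (\<lambda>x. f x + h n *\<^sub>R g x) - pint M p f) / h n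
       = (\<integral>x. (norm (f x + h n *\<^sub>R g x) powr p - norm (f x) powr p) / h n \<partial>M)" for n
      using i[of "h n"] f by (simp add: pint_def inLp_def)
    have "(\<lambda>n. \<integral>x. (norm (f x + h n *\<^sub>R g x) powr p - norm (f x) powr p) / h n \<partial>M)
       \<longlonglongrightarrow> (\<integral>x. p * (norm (f x) powr (p - 2) * (f x \<bullet> g x)) \<partial>M)"
    \<comment> \<open>B bounds the increments |h n|. The base |f| + (B + 1) |g| then dominates both
      |f + h g| and |g|, so one p-th power absorbs the slope and the increment.\<close>
    proof (rule integral_dominated_convergence[where w="\<lambda>x. p * (norm (f x) + (B + 1) * norm (g x)) powr p"])
      have "inLp M p (\<lambda>x. norm (f x) + (B + 1) * norm (g x))"
        using inLp_add[of p M "\<lambda>x. norm (f x)" "\<lambda>x. (B + 1) *\<^sub>R norm (g x)"] inLp_scale[of M p "\<lambda>x. norm (g x)" "B + 1"]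
          f g p by (auto simp: inLp_def)
      then show "integrable M (\<lambda>x. p * (norm (f x) + (B + 1) * norm (g x)) powr p)"
        using B0 by (auto simp: inLp_def)
      show "AE x in M. (\<lambda>n. (norm (f x + h n *\<^sub>R g x) powr p - norm (f x) powr p) / h n)
          \<longlonglongrightarrow> p * (norm (f x) powr (p - 2) * (f x \<bullet> g x))"
      proof (intro AE_I2)
        fix x
        have "((\<lambda>t. (norm (f x + t *\<^sub>R g x) powr p - norm (f x) powr p) / t) \<longlongrightarrow>
           p * (norm (f x) powr (p - 2) * (f x \<bullet> g x))) (at 0)"
          using norm_powr_has_derivative[OF p, of "f x" "g x"] by (simp add: DERIV_def)
        then show "(\<lambda>n. (norm (f x + h n *\<^sub>R g x) powr p - norm (f x) powr p) / h n)
          \<longlonglongrightarrow> p * (norm (f x) powr (p - 2) * (f x \<bullet> g x))"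
          using h unfolding tendsto_at_iff_sequentially by (auto simp: o_def)
      qed
      show "AE x in M. norm ((norm (f x + h n *\<^sub>R g x) powr p - norm (f x) powr p) / h n)
         \<le> p * (norm (f x) + (B + 1) * norm (g x)) powr p" for n
      proof (intro AE_I2)
        fix x
        let ?R = "norm (f x) + (B + 1) * norm (g x)"
        have hg: "norm (h n *\<^sub>R g x) \<le> B * norm (g x)" using B[of n] by (simp add: mult_right_mono)
        have R1: "norm (f x + h n *\<^sub>R g x) \<le> ?R"
          using norm_triangle_ineq[of "f x" "h n *\<^sub>R g x"] hg norm_ge_zero[of "g x"]
          unfolding distrib_right mult_1 by linarith
        have "\<bar>norm (f x + h n *\<^sub>R g x) powr p - norm (f x) powr p\<bar>
            \<le> p * ?R powr (p - 1) * \<bar>norm (f x + h n *\<^sub>R g x) - norm (f x)\<bar>"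
          using R1 B0 by (intro powr_lipschitz[OF p]) auto
        also have "\<dots> \<le> p * ?R powr (p - 1) * (\<bar>h n\<bar> * norm (g x))"
          using norm_triangle_ineq3[of "f x + h n *\<^sub>R g x" "f x"] p by (intro mult_left_mono) auto
        also have "\<dots> \<le> p * ?R powr (p - 1) * (\<bar>h n\<bar> * ?R)"
          using B0 p by (intro mult_left_mono) (auto simp: algebra_simps)
        also have "\<dots> = \<bar>h n\<bar> * (p * ?R powr p)"
        proof -
          have "?R \<ge> 0" using B0 by simp
          then have "?R powr (p - 1) * ?R = ?R powr p" by (cases "?R = 0") (auto simp: powr_diff)
          then show ?thesis by (metis mult.assoc mult.left_commute)
        qed
        finally show "norm ((norm (f x + h n *\<^sub>R g x) powr p - norm (f x) powr p) / h n)
           \<le> p * ?R powr p"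
          using h0[of n] by (simp add: divide_simps mult.commute)
      qed
    qed measurable
    then show "((\<lambda>h. (pint M p (\<lambda>x. f x + h *\<^sub>R g x) - pint M p f) / h) \<circ> h)
      \<longlonglongrightarrow> (\<integral>x. p * (norm (f x) powr (p - 2) * (f x \<bullet> g x)) \<partial>M)"
      by (simp add: o_def e)
  qed
  then show ?thesis by (simp add: DERIV_def)
qed

section \<open>Integration of test functions\<close>

text \<open>A class not tied to \<Omega>: it contains test functions and their gradients together
  with all translates and differences, for which every integral below is finite.\<close>

definition ccont :: "('a::euclidean_space \<Rightarrow> 'b::euclidean_space) \<Rightarrow> bool" where
  "ccont f \<longleftrightarrow> continuous_on UNIV f \<and> (\<exists>K. compact K \<and> (\<forall>x. x \<notin> K \<longrightarrow> f x = 0))"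

lemma ccont_measurable: "ccont f \<Longrightarrow> f \<in> borel_measurable borel"
  by (auto simp: ccont_def intro: borel_measurable_continuous_onI)

lemma ccont_integrable: "ccont f \<Longrightarrow> integrable lborel f"
proof -
  assume "ccont f"
  then obtain K where K: "continuous_on UNIV f" "compact K" "\<And>x. x \<notin> K \<Longrightarrow> f x = 0"
    by (auto simp: ccont_def)
  have "integrable lborel (\<lambda>x. indicator K x *\<^sub>R f x)"
    using K by (intro borel_integrable_compact) (auto intro: continuous_on_subset)
  also have "(\<lambda>x. indicator K x *\<^sub>R f x) = f" using K(3) by (force simp: indicator_def)
  finally show ?thesis .
qed

lemma ccont_bounded:
  assumes "ccont f"
  obtains B where "B \<ge> 0" "\<And>x. norm (f x) \<le> B"
proof -
  obtain K where K: "continuous_on UNIV f" "compact K" "\<And>x. x \<notin> K \<Longrightarrow> f x = 0"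
    using assms by (auto simp: ccont_def)
  have "compact (f ` K)" using K by (intro compact_continuous_image) (auto intro: continuous_on_subset)
  then obtain B where B: "\<forall>x\<in>K. norm (f x) \<le> B"
    by (auto simp: bounded_iff dest!: compact_imp_bounded)
  have "norm (f x) \<le> max 0 B" for x
    using B K(3)[of x] by (cases "x \<in> K") auto
  then show thesis by (intro that[of "max 0 B"]) auto
qed

lemma ccont_powr: "ccont f \<Longrightarrow> p > 0 \<Longrightarrow> ccont (\<lambda>x. norm (f x) powr p)"
  unfolding ccont_def
  by (auto intro!: continuous_intros continuous_on_powr')

lemma ccont_inLp: "ccont f \<Longrightarrow> p > 0 \<Longrightarrow> inLp lborel p f"
  using ccont_integrable[OF ccont_powr, of f p] ccont_measurable[of f] by (simp add: inLp_def)

lemma ccont_add: "ccont f \<Longrightarrow> ccont g \<Longrightarrow> ccont (\<lambda>x. f x + g x)"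
proof -
  assume "ccont f" "ccont g"
  then obtain K L where "compact K" "\<forall>x. x \<notin> K \<longrightarrow> f x = 0" "compact L" "\<forall>x. x \<notin> L \<longrightarrow> g x = 0"
    "continuous_on UNIV f" "continuous_on UNIV g"
    by (auto simp: ccont_def)
  then show ?thesis unfolding ccont_def
    by (intro conjI exI[of _ "K \<union> L"]) (auto intro: continuous_intros)
qed

lemma ccont_scale: "ccont f \<Longrightarrow> ccont (\<lambda>x. c *\<^sub>R f x)"
  by (auto simp: ccont_def intro: continuous_intros)

lemma ccont_diff: "ccont f \<Longrightarrow> ccont g \<Longrightarrow> ccont (\<lambda>x. f x - g x)"
  using ccont_add[OF _ ccont_scale[of g "-1"], of f] by simp

lemma ccont_shift: "ccont f \<Longrightarrow> ccont (\<lambda>x. f (x + h))"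
proof -
  assume "ccont f"
  then obtain K where K: "continuous_on UNIV f" "compact K" "\<forall>x. x \<notin> K \<longrightarrow> f x = 0"
    by (auto simp: ccont_def)
  have "continuous_on UNIV (\<lambda>x. f (x + h))"
    by (intro continuous_on_compose2[OF K(1)] continuous_intros) auto
  moreover have "compact ((\<lambda>x. x - h) ` K)"
    by (intro compact_continuous_image K continuous_intros)
  moreover have "f (x + h) = 0" if "x \<notin> (\<lambda>x. x - h) ` K" for x
    using that K(3) by (metis add_diff_cancel_right' image_eqI)
  ultimately show ?thesis unfolding ccont_def by blast
qed

lemma ccont_test: "test_fun \<Omega> \<phi> \<Longrightarrow> ccont \<phi>"
  unfolding ccont_def by (metis smooth_continuous test_fun_smooth test_funE)

lemma ccont_test_deriv: 
  assumes "test_fun \<Omega> \<phi>" shows "ccont (\<lambda>x. frechet_derivative \<phi> (at x) v)"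
proof -
  obtain K where "compact K" "\<And>x v. x \<notin> K \<Longrightarrow> frechet_derivative \<phi> (at x) v = 0"
    by (rule test_funE[OF assms], rule that)
  then show ?thesis unfolding ccont_def
    using smooth_continuous[OF smooth_deriv[OF test_fun_smooth[OF assms]]] by blast
qed

lemma ccont_test_grad: 
  assumes "test_fun \<Omega> \<phi>" shows "ccont (grad \<phi>)"
proof -
  obtain K where K: "compact K" "\<And>x v. x \<notin> K \<Longrightarrow> frechet_derivative \<phi> (at x) v = 0"
    by (rule test_funE[OF assms], rule that)
  have "grad \<phi> x = 0" if "x \<notin> K" for x using K(2)[OF that] by (simp add: grad_def)
  then show ?thesis unfolding ccont_def
    using grad_continuous[OF test_fun_smooth[OF assms]] K(1) by blast
qed

lemma lborel_integral_shift:
  fixes f :: "'a::euclidean_space \<Rightarrow> 'b::euclidean_space"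
  assumes "f \<in> borel_measurable borel"
  shows "(\<integral>x. f (x + h) \<partial>lborel) = (\<integral>x. f x \<partial>lborel)"
proof -
  have "(\<integral>x. f x \<partial>lborel) = (\<integral>x. f x \<partial>distr lborel borel ((+) h))" by (simp add: lborel_distr_plus)
  also have "\<dots> = (\<integral>x. f (h + x) \<partial>lborel)" using assms by (intro integral_distr) auto
  finally show ?thesis by (simp add: add.commute)
qed

lemma pint_shift: "f \<in> borel_measurable borel \<Longrightarrow> pint lborel p (\<lambda>x. f (x + h)) = pint lborel p f"
  unfolding pint_def using lborel_integral_shift[of "\<lambda>x. norm (f x) powr p" h] by simp

section \<open>Difference quotients and translation estimates\<close>

lemma smooth_has_derivative:
  "smooth_fun f \<Longrightarrow> (f has_derivative (\<lambda>v. grad f x \<bullet> v)) (at x)"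
  using smooth_differentiable[of f x] frechet_derivative_grad[of f x]
  by (metis (no_types, lifting) ext frechet_derivative_works)

lemma smooth_Lipschitz:
  assumes f: "smooth_fun f" and L: "\<And>x. norm (grad f x) \<le> L"
  shows "\<bar>f (x + h) - f x\<bar> \<le> L * norm h"
proof -
  have "norm (f (x + h) - f x) \<le> L * norm ((x + h) - x)"
  proof (rule differentiable_bound[of UNIV])
    show "(f has_derivative (\<lambda>v. grad f x \<bullet> v)) (at x within UNIV)" for x
      by (rule smooth_has_derivative[OF f])
    show "onorm (\<lambda>v. grad f x \<bullet> v) \<le> L" for x
    proof (rule onorm_bound)
      show "0 \<le> L" using L[of x] norm_ge_zero order_trans by blast
      show "norm (grad f x \<bullet> v) \<le> L * norm v" for v
        using Cauchy_Schwarz_ineq2[of "grad f x" v] mult_right_mono[OF L[of x], of "norm v"] by auto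
    qed
  qed auto
  then show ?thesis by simp
qed

abbreviation diff_quot :: "('a::euclidean_space \<Rightarrow> real) \<Rightarrow> 'a \<Rightarrow> nat \<Rightarrow> 'a \<Rightarrow> real" where
  "diff_quot \<phi> v n x \<equiv> real (Suc n) * (\<phi> (x + (1 / real (Suc n)) *\<^sub>R v) - \<phi> x)"

text \<open>One majorant for all n. The Lipschitz bound controls the quotient, and at distance more
  than R + |v| from the origin both x and its shift miss the support.\<close>

lemma difference_quotient_bound:
  assumes "test_fun \<Omega> \<phi>"
  obtains L K where "L \<ge> 0" "compact K" 
    "\<And>x n. \<bar>diff_quot \<phi> v n x\<bar> \<le> L * indicator K x"
proof -
  obtain L where L: "L \<ge> 0" "\<And>x. norm (grad \<phi> x) \<le> L"
    using ccont_bounded[OF ccont_test_grad[OF assms]] by blast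
  obtain K0 where K0: "compact K0" "\<And>x. x \<notin> K0 \<Longrightarrow> \<phi> x = 0"
    by (rule test_funE[OF assms], rule that)
  obtain R where R: "\<And>x. x \<in> K0 \<Longrightarrow> norm x \<le> R" 
    using compact_imp_bounded[OF K0(1)] by (auto simp: bounded_iff)
  have b: "\<bar>diff_quot \<phi> v n x\<bar> \<le> L * norm v * indicator (cball 0 (R + norm v)) x" for x n
  proof (cases "x \<in> cball 0 (R + norm v)")
    case True
    have "\<bar>\<phi> (x + (1 / real (Suc n)) *\<^sub>R v) - \<phi> x\<bar> \<le> L * norm ((1 / real (Suc n)) *\<^sub>R v)"
      by (rule smooth_Lipschitz[OF test_fun_smooth[OF assms] L(2)])
    also have "\<dots> = (1 / real (Suc n)) * (L * norm v)" by simp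
    finally have "real (Suc n) * \<bar>\<phi> (x + (1 / real (Suc n)) *\<^sub>R v) - \<phi> x\<bar> \<le> real (Suc n) * ((1 / real (Suc n)) * (L * norm v))"
      by (intro mult_left_mono) auto
    then show ?thesis using True by (simp add: abs_mult)
  next
    case False
    have h: "norm ((1 / real (Suc n)) *\<^sub>R v) \<le> norm v"
      using mult_right_mono[of "1 / real (Suc n)" 1 "norm v"] by simp
    have nx: "norm x > R + norm v" using False by simp
    have "x \<notin> K0"
    proof
      assume "x \<in> K0"
      then show False using R[of x] nx norm_ge_zero[of v] by linarith
    qed
    moreover have "norm x \<le> norm (x + (1 / real (Suc n)) *\<^sub>R v) + norm ((1 / real (Suc n)) *\<^sub>R v)"
      using norm_triangle_ineq4[of "x + (1 / real (Suc n)) *\<^sub>R v" "(1 / real (Suc n)) *\<^sub>R v"] by simp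
    then have "\<not> norm (x + (1 / real (Suc n)) *\<^sub>R v) \<le> R" using h nx by linarith
    then have "x + (1 / real (Suc n)) *\<^sub>R v \<notin> K0" using R by blast
    ultimately show ?thesis using K0(2) False by simp
  qed
  show thesis by (rule that[OF _ compact_cball b]) (simp add: L(1))
qed

lemma difference_quotient_tendsto:
  assumes "smooth_fun \<phi>"
  shows "(\<lambda>n. diff_quot \<phi> v n x) \<longlonglongrightarrow> frechet_derivative \<phi> (at x) v"
proof -
  have "((\<lambda>t. \<phi> (x + t *\<^sub>R v)) has_real_derivative grad \<phi> x \<bullet> v) (at 0)"
  proof -
    have "((\<lambda>t. \<phi> (x + t *\<^sub>R v)) has_derivative (\<lambda>t. grad \<phi> x \<bullet> (t *\<^sub>R v))) (at 0)"
      by (rule has_derivative_compose[where g=\<phi> and f="\<lambda>t. x + t *\<^sub>R v"])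
        (auto intro!: derivative_eq_intros smooth_has_derivative assms)
    then show ?thesis by (simp add: has_field_derivative_def mult_commute_abs)
  qed
  then have "((\<lambda>h. (\<phi> (x + h *\<^sub>R v) - \<phi> x) / h) \<longlongrightarrow> grad \<phi> x \<bullet> v) (at 0)"
    by (simp add: DERIV_def)
  moreover have "filterlim (\<lambda>n. 1 / real (Suc n)) (at 0) sequentially"
    using LIMSEQ_Suc[OF lim_1_over_n] by (auto simp: filterlim_at)
  ultimately have "(\<lambda>n. (\<phi> (x + (1 / real (Suc n)) *\<^sub>R v) - \<phi> x) / (1 / real (Suc n))) \<longlonglongrightarrow> grad \<phi> x \<bullet> v"
    by (rule filterlim_compose)
  then show ?thesis
    using frechet_derivative_grad[OF smooth_differentiable[OF assms]] by (simp add: mult.commute)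
qed

text \<open>Every difference quotient has integral zero by translation invariance, and the dominated
  limit inherits it.\<close>

lemma integral_test_deriv:
  assumes t: "test_fun \<Omega> \<phi>"
  shows "(\<integral>x. frechet_derivative \<phi> (at x) v \<partial>lborel) = 0"
proof -
  obtain L K where LK: "L \<ge> 0" "compact K" 
    "\<And>x n. \<bar>diff_quot \<phi> v n x\<bar> \<le> L * indicator K x"
    by (rule difference_quotient_bound[OF t, of v], rule that)
  note [measurable] = ccont_measurable[OF ccont_test[OF t]] ccont_measurable[OF ccont_test_deriv[OF t]]
  have [measurable]: "K \<in> sets borel" using LK by (simp add: compact_imp_closed borel_closed)
  have z: "(\<integral>x. diff_quot \<phi> v n x \<partial>lborel) = 0" for n
    using lborel_integral_shift[of \<phi> "(1 / real (Suc n)) *\<^sub>R v"]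
      ccont_integrable[OF ccont_shift[OF ccont_test[OF t]]] ccont_integrable[OF ccont_test[OF t]]
      ccont_measurable[OF ccont_test[OF t]]
    by simp
  have "(\<lambda>n. \<integral>x. diff_quot \<phi> v n x \<partial>lborel)
      \<longlonglongrightarrow> (\<integral>x. frechet_derivative \<phi> (at x) v \<partial>lborel)"
  proof (rule integral_dominated_convergence[where w="\<lambda>x. L * indicator K x"])
    show "integrable lborel (\<lambda>x. L * indicator K x :: real)"
      using borel_integrable_compact[OF LK(2), of "\<lambda>_. L"] by (simp add: mult.commute)
  qed (use LK(3) difference_quotient_tendsto[OF test_fun_smooth[OF t]] in \<open>auto\<close>)
  then show ?thesis unfolding z by (simp add: LIMSEQ_const_iff)
qed

lemma test_fun_weak_grad_lborel:
  assumes "test_fun \<Omega> \<phi>" "test_fun \<Omega> \<psi>"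
  shows "(\<integral>x. \<phi> x * frechet_derivative \<psi> (at x) v \<partial>lborel)
    = - (\<integral>x. frechet_derivative \<phi> (at x) v * \<psi> x \<partial>lborel)"
proof -
  have s: "smooth_fun \<phi>" "smooth_fun \<psi>" using assms by (auto intro: test_fun_smooth)
  have cm: "ccont (\<lambda>x. f x * g x)" if "ccont f" "ccont g" for f g :: "'a \<Rightarrow> real"
    using that unfolding ccont_def by (auto intro: continuous_intros)
  have "0 = (\<integral>x. frechet_derivative (\<lambda>x. \<phi> x * \<psi> x) (at x) v \<partial>lborel)"
    using integral_test_deriv[OF test_fun_mult_smooth[OF assms(2) s(1)]] by simp
  also have "\<dots> = (\<integral>x. \<phi> x * frechet_derivative \<psi> (at x) v + frechet_derivative \<phi> (at x) v * \<psi> x \<partial>lborel)"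
    by (simp add: frechet_derivative_mult smooth_differentiable s)
  also have "\<dots> = (\<integral>x. \<phi> x * frechet_derivative \<psi> (at x) v \<partial>lborel)
    + (\<integral>x. frechet_derivative \<phi> (at x) v * \<psi> x \<partial>lborel)"
    using assms by (intro Bochner_Integration.integral_add ccont_integrable cm ccont_test ccont_test_deriv)
  finally show ?thesis by simp
qed

text \<open>The p-energy controls the L^p modulus of continuity. Minkowski's inequality over n + 1
  equal steps bounds the translation difference by the n-th difference quotient; in the limit this
  is the directional derivative.\<close>

lemma pint_translation_le:
  assumes p: "p \<ge> 1" and t: "test_fun \<Omega> \<phi>"
  shows "pint lborel p (\<lambda>x. \<phi> (x + v) - \<phi> x) \<le> norm v powr p * pint lborel p (grad \<phi>)"
proof -
  have p0: "p > 0" using p by simp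
  note c = ccont_test[OF t]
  note [measurable] = ccont_measurable[OF c] ccont_measurable[OF ccont_test_deriv[OF t]]
  obtain L K where LK: "L \<ge> 0" "compact K" 
    "\<And>x n. \<bar>diff_quot \<phi> v n x\<bar> \<le> L * indicator K x"
    by (rule difference_quotient_bound[OF t, of v], rule that)
  have [measurable]: "K \<in> sets borel" using LK by (simp add: compact_imp_closed borel_closed)
  \<comment> \<open>Splitting the translation into \<open>n\<close> small steps replaces Fubini along segments.\<close>
  have iter: "pnorm lborel p (\<lambda>x. \<phi> (x + real k *\<^sub>R w) - \<phi> x) \<le> real k * pnorm lborel p (\<lambda>x. \<phi> (x + w) - \<phi> x)" for k w
  proof (induction k)
    case 0
    then show ?case by (simp add: pnorm_def pint_def p0)
  next
    case (Suc k)
    let ?d = "\<lambda>x. \<phi> (x + w) - \<phi> x"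
    have cd: "ccont ?d" by (intro ccont_diff ccont_shift c)
    have "pnorm lborel p (\<lambda>x. \<phi> (x + real (Suc k) *\<^sub>R w) - \<phi> x)
      = pnorm lborel p (\<lambda>x. ?d (x + real k *\<^sub>R w) + (\<phi> (x + real k *\<^sub>R w) - \<phi> x))"
      by (simp add: algebra_simps)
    also have "\<dots> \<le> pnorm lborel p (\<lambda>x. ?d (x + real k *\<^sub>R w)) + pnorm lborel p (\<lambda>x. \<phi> (x + real k *\<^sub>R w) - \<phi> x)"
      by (intro pnorm_triangle p ccont_inLp ccont_shift[OF cd] ccont_diff ccont_shift c p0)
    also have "pnorm lborel p (\<lambda>x. ?d (x + real k *\<^sub>R w)) = pnorm lborel p ?d"
      unfolding pnorm_def by (subst pint_shift) auto
    finally show ?case using Suc by (simp add: algebra_simps)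
  qed
  have le: "pint lborel p (\<lambda>x. \<phi> (x + v) - \<phi> x) \<le> pint lborel p (\<lambda>x. diff_quot \<phi> v n x)" for n
  proof -
    have "pnorm lborel p (\<lambda>x. \<phi> (x + v) - \<phi> x) \<le> real (Suc n) * pnorm lborel p (\<lambda>x. \<phi> (x + (1 / real (Suc n)) *\<^sub>R v) - \<phi> x)"
      using iter[of "Suc n" "(1 / real (Suc n)) *\<^sub>R v"] by simp
    then have "pnorm lborel p (\<lambda>x. \<phi> (x + v) - \<phi> x) powr p
       \<le> (real (Suc n) * pnorm lborel p (\<lambda>x. \<phi> (x + (1 / real (Suc n)) *\<^sub>R v) - \<phi> x)) powr p"
      using p0 by (intro powr_mono2 pnorm_nonneg) auto
    also have "\<dots> = real (Suc n) powr p * pint lborel p (\<lambda>x. \<phi> (x + (1 / real (Suc n)) *\<^sub>R v) - \<phi> x)"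
      using p0 by (simp add: powr_mult pnorm_nonneg pint_eq_pnorm)
    also have "\<dots> = pint lborel p (\<lambda>x. diff_quot \<phi> v n x)"
      using pint_scale[of lborel p "real (Suc n)" "\<lambda>x. \<phi> (x + (1 / real (Suc n)) *\<^sub>R v) - \<phi> x"] by simp
    finally show ?thesis using p0 by (simp add: pint_eq_pnorm)
  qed
  have "(\<lambda>n. pint lborel p (\<lambda>x. diff_quot \<phi> v n x))
      \<longlonglongrightarrow> pint lborel p (\<lambda>x. frechet_derivative \<phi> (at x) v)"
    unfolding pint_def
  proof (rule integral_dominated_convergence[where w="\<lambda>x. L powr p * indicator K x"])
    show "integrable lborel (\<lambda>x. L powr p * indicator K x :: real)"
      using borel_integrable_compact[OF LK(2), of "\<lambda>_. L powr p"] by (simp add: mult.commute)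
    show "AE x in lborel. (\<lambda>n. norm (diff_quot \<phi> v n x) powr p)
       \<longlonglongrightarrow> norm (frechet_derivative \<phi> (at x) v) powr p"
      using p0 by (intro AE_I2 tendsto_powr' tendsto_norm tendsto_const
          difference_quotient_tendsto[OF test_fun_smooth[OF t]]) auto
    show "AE x in lborel. norm (norm (diff_quot \<phi> v n x) powr p)
       \<le> L powr p * indicator K x" for n
    proof (intro AE_I2)
      fix x
      have "norm (diff_quot \<phi> v n x) powr p \<le> (L * indicator K x) powr p"
        using LK(3)[of n x] p0 by (intro powr_mono2) auto
      also have "\<dots> = L powr p * indicator K x" using p0 by (simp add: indicator_def)
      finally show "norm (norm (diff_quot \<phi> v n x) powr p)
       \<le> L powr p * indicator K x" by simp
    qed
  qed measurable
  then have "pint lborel p (\<lambda>x. \<phi> (x + v) - \<phi> x) \<le> pint lborel p (\<lambda>x. frechet_derivative \<phi> (at x) v)"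
    using le by (intro LIMSEQ_le_const) auto
  also have "\<dots> \<le> (\<integral>x. norm v powr p * norm (grad \<phi> x) powr p \<partial>lborel)"
    unfolding pint_def
  proof (rule integral_mono)
    show "integrable lborel (\<lambda>x. norm (frechet_derivative \<phi> (at x) v) powr p)"
      using ccont_inLp[OF ccont_test_deriv[OF t] p0] by (simp add: inLp_def)
    show "integrable lborel (\<lambda>x. norm v powr p * norm (grad \<phi> x) powr p)"
      using ccont_inLp[OF ccont_test_grad[OF t] p0] by (simp add: inLp_def)
    fix x
    have "norm (frechet_derivative \<phi> (at x) v) \<le> norm v * norm (grad \<phi> x)"
      using frechet_derivative_grad[OF smooth_differentiable[OF test_fun_smooth[OF t]]]
        Cauchy_Schwarz_ineq2[of "grad \<phi> x" v] by (simp add: mult.commute)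
    then show "norm (frechet_derivative \<phi> (at x) v) powr p \<le> norm v powr p * norm (grad \<phi> x) powr p"
      using p0 by (subst powr_mult[symmetric]) (auto intro: powr_mono2)
  qed
  also have "\<dots> = norm v powr p * pint lborel p (grad \<phi>)" by (simp add: pint_def)
  finally show ?thesis .
qed

section \<open>Uniqueness of weak gradients\<close>

lemma flat_1_bounds: "0 \<le> flat 1 t" "flat 1 t \<le> 1"
  by (auto simp: flat_def)

lemma flat_1_tendsto_1: "t > 0 \<Longrightarrow> (\<lambda>n. flat 1 (real n * t)) \<longlonglongrightarrow> 1"
proof -
  assume t: "t > 0"
  have "(\<lambda>n. exp (- ((1 / t) * (1 / real n)))) \<longlonglongrightarrow> exp (- ((1 / t) * 0))"
    by (intro tendsto_intros lim_1_over_n)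
  moreover have "\<forall>\<^sub>F n in sequentially. exp (- ((1 / t) * (1 / real n))) = flat 1 (real n * t)"
    using eventually_gt_at_top[of 0] by eventually_elim (use t in \<open>auto simp: flat_def mult.commute\<close>)
  ultimately show ?thesis using Lim_transform_eventually by fastforce
qed

text \<open>Since \<open>flat 1 (n * t)\<close> tends to 1 for t > 0 and is 0 otherwise, these
  products converge to the indicator of the open box while vanishing outside it; they are admissible
  as soon as the closed box lies in \<Omega>.\<close>

definition box_bump :: "'a::euclidean_space \<Rightarrow> 'a \<Rightarrow> nat \<Rightarrow> 'a \<Rightarrow> real" where
  "box_bump a b n x = (\<Prod>i\<in>Basis. flat 1 (real n * (x \<bullet> i - a \<bullet> i)) * flat 1 (real n * (b \<bullet> i - x \<bullet> i)))"

lemma box_bump_bounds: "0 \<le> box_bump a b n x" "box_bump a b n x \<le> 1"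
  unfolding box_bump_def
  by (auto intro!: prod_nonneg prod_le_1 mult_nonneg_nonneg mult_le_one flat_1_bounds)

lemma box_bump_outside: "x \<notin> box a b \<Longrightarrow> box_bump a b n x = 0"
  by (force simp: box_bump_def box_def flat_def not_less zero_less_mult_iff)

lemma smooth_box_bump: "smooth_fun (box_bump a b n)"
proof -
  have "smooth_fun (\<lambda>x::'a. \<Prod>i\<in>Basis. flat 1 (x \<bullet> (real n *\<^sub>R i) + (- real n * (a \<bullet> i))) *
     flat 1 (x \<bullet> (- real n *\<^sub>R i) + real n * (b \<bullet> i)))"
    by (intro smooth_prod smooth_mult smooth_flat_affine) simp
  then show ?thesis unfolding box_bump_def[abs_def] by (simp add: algebra_simps)
qed

lemma box_bump_test: "cbox a b \<subseteq> \<Omega> \<Longrightarrow> test_fun \<Omega> (box_bump a b n)"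
  by (rule test_funI[OF smooth_box_bump compact_cbox]) (use box_bump_outside box_subset_cbox in blast)+

lemma box_bump_tendsto: "(\<lambda>n. box_bump a b n x) \<longlonglongrightarrow> indicator (box a b) x"
proof (cases "x \<in> box a b")
  case True
  then have "(\<lambda>n. box_bump a b n x) \<longlonglongrightarrow> (\<Prod>i\<in>(Basis::'a set). 1 * 1)"
    unfolding box_bump_def by (intro tendsto_prod tendsto_mult flat_1_tendsto_1) (auto simp: box_def)
  then show ?thesis using True by simp
qed (simp add: box_bump_outside)

lemma ccont_lebesgue_on_integrable:
  fixes f :: "'a::euclidean_space \<Rightarrow> 'b::euclidean_space"
  assumes "ccont f" "open \<Omega>"
  shows "integrable (lebesgue_on \<Omega>) f"
proof -
  have "integrable lebesgue f"
    using ccont_integrable[OF assms(1)] ccont_measurable[OF assms(1)] by (simp add: integrable_completion)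
  then have "integrable lebesgue (\<lambda>x. indicator \<Omega> x *\<^sub>R f x)"
    using assms(2) by (intro integrable_mult_indicator) auto
  then show ?thesis using assms(2) by (subst integrable_restrict_space) auto
qed

lemma lebesgue_on_integral_lborel:
  fixes f :: "'a::euclidean_space \<Rightarrow> 'b::euclidean_space"
  assumes "f \<in> borel_measurable borel" "open \<Omega>" "\<And>x. x \<notin> \<Omega> \<Longrightarrow> f x = 0"
  shows "integral\<^sup>L (lebesgue_on \<Omega>) f = integral\<^sup>L lborel f"
proof -
  have eq: "(\<lambda>x. indicator \<Omega> x *\<^sub>R f x) = f" using assms(3) by (force simp: indicator_def)
  have "integral\<^sup>L (lebesgue_on \<Omega>) f = integral\<^sup>L lebesgue (\<lambda>x. indicator \<Omega> x *\<^sub>R f x)"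
    using assms(2) by (intro integral_restrict_space) auto
  then show ?thesis unfolding eq using assms(1) by (simp add: integral_completion)
qed

text \<open>A pi-lambda argument: boxes are stable under intersection and generate the Borel sets.
  The vanishing total integral is what carries the complement step.\<close>

lemma integral_zero_boxes_AE_zero:
  fixes H :: "'a::euclidean_space \<Rightarrow> real"
  assumes H: "integrable lborel H" and tot: "(\<integral>x. H x \<partial>lborel) = 0"
    and box: "\<And>a b. (\<integral>x. indicator (box a b) x * H x \<partial>lborel) = 0"
  shows "AE x in lborel. H x = 0"
proof (rule density_unique_real[OF H, of "\<lambda>_. 0"])
  fix A :: "'a set" assume "A \<in> sets lborel"
  then have "A \<in> sigma_sets UNIV (range (\<lambda>(a, b). box a b))" by (simp add: borel_eq_box)
  note A = this
  have stable: "Int_stable (range (\<lambda>(a, b). box a b :: 'a set))"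
    by (auto simp: Int_stable_def box_Int_box)
  have setI: "set_integrable lborel B H" if "B \<in> sigma_sets UNIV (range (\<lambda>(a, b). box a b))" for B
    unfolding set_integrable_def
    by (intro integrable_mult_indicator H) (use that in \<open>simp add: borel_eq_box\<close>)
  have "set_lebesgue_integral lborel A H = 0"
  proof (rule sigma_sets_induct_disjoint[OF stable _ A], goal_cases)
    case 1 then show ?case by simp
  next
    case (2 A) then show ?case using box by (auto simp: set_lebesgue_integral_def)
  next
    case 3 then show ?case by (simp add: set_lebesgue_integral_def)
  next
    case (4 A)
    have "set_lebesgue_integral lborel (UNIV - A) H = (\<integral>x. H x - indicator A x *\<^sub>R H x \<partial>lborel)"
      unfolding set_lebesgue_integral_def by (intro Bochner_Integration.integral_cong) (auto simp: indicator_def)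
    also have "\<dots> = (\<integral>x. H x \<partial>lborel) - set_lebesgue_integral lborel A H"
      unfolding set_lebesgue_integral_def using H setI[OF 4(1)]
      by (intro Bochner_Integration.integral_diff) (auto simp: set_integrable_def)
    finally show ?case using tot 4 by simp
  next
    case (5 A)
    have "set_lebesgue_integral lborel (\<Union>i. A i) H = (\<Sum>i. set_lebesgue_integral lborel (A i) H)"
    proof (rule lebesgue_integral_countable_add)
      show "A i \<in> sets lborel" for i using 5(2) by (auto simp: borel_eq_box)
      show "A i \<inter> A j = {}" if "i \<noteq> j" for i j using 5(1) that by (auto simp: disjoint_family_on_def)
      show "set_integrable lborel (\<Union>i. A i) H" using 5(2) by (intro setI sigma_sets.Union) auto
    qed
    then show ?case using 5 by simp
  qed
  then show "set_lebesgue_integral lborel A H = set_lebesgue_integral lborel A (\<lambda>_. 0)"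
    by (simp add: set_lebesgue_integral_def)
qed simp

lemma AE_lebesgue_on_iff:
  "open \<Omega> \<Longrightarrow> (AE x in lebesgue_on \<Omega>. P x) \<longleftrightarrow> (AE x in lborel. x \<in> \<Omega> \<longrightarrow> P x)"
  by (subst AE_restrict_space_iff) (auto simp: AE_completion_iff)

text \<open>The fundamental lemma of the calculus of variations. Smooth bumps yield vanishing
  integrals over boxes well inside \<Omega>. Restricting h to one such box makes it integrable, so
  it vanishes there almost everywhere, and countably many rational boxes exhaust \<Omega>.\<close>

lemma test_orthogonal_AE_zero:
  fixes h :: "'a::euclidean_space \<Rightarrow> real"
  assumes \<Omega>: "open \<Omega>" and p: "p \<ge> 1" and h: "inLp (lebesgue_on \<Omega>) p h"
    and ort: "\<And>\<phi>. test_fun \<Omega> \<phi> \<Longrightarrow> (\<integral>x. h x * \<phi> x \<partial>lebesgue_on \<Omega>) = 0"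
  shows "AE x in lebesgue_on \<Omega>. h x = 0"
proof -
  have \<Omega>m[simp]: "\<Omega> \<in> sets lebesgue" using \<Omega> by auto
  have indi: "integrable (lebesgue_on \<Omega>) (indicator (box a b) :: 'a \<Rightarrow> real)" for a b
  proof -
    have "integrable lebesgue (indicator (box a b) :: 'a \<Rightarrow> real)"
      by (intro integrable_real_indicator) (auto simp: emeasure_lborel_box_eq)
    then have "integrable lebesgue (\<lambda>x. indicator \<Omega> x *\<^sub>R (indicator (box a b) x :: real))"
      by (intro integrable_mult_indicator) auto
    then show ?thesis by (subst integrable_restrict_space) auto
  qed
  have box0: "(\<integral>x. h x * indicator (box a b) x \<partial>lebesgue_on \<Omega>) = 0" if sub: "cbox a b \<subseteq> \<Omega>" for a b
  proof -
    have "(\<lambda>n. \<integral>x. h x * box_bump a b n x \<partial>lebesgue_on \<Omega>) \<longlonglongrightarrow> (\<integral>x. h x * indicator (box a b) x \<partial>lebesgue_on \<Omega>)"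
    proof (rule integral_dominated_convergence[where w="\<lambda>x. \<bar>h x * indicator (box a b) x\<bar>"])
      have hm[measurable]: "h \<in> borel_measurable (lebesgue_on \<Omega>)" by (rule inLp_measurable[OF h])
      have [measurable]: "box_bump a b n \<in> borel_measurable (lebesgue_on \<Omega>)" for n
        using ccont_lebesgue_on_integrable[OF ccont_test[OF box_bump_test[OF sub]] \<Omega>]
        by (rule borel_measurable_integrable)
      show "(\<lambda>x. h x * box_bump a b n x) \<in> borel_measurable (lebesgue_on \<Omega>)" for n by measurable
      show i: "integrable (lebesgue_on \<Omega>) (\<lambda>x. \<bar>h x * indicator (box a b) x\<bar>)"
        using inLp_mult_integrable[OF p h indi, where B=1] by (auto simp: indicator_def)
      show "(\<lambda>x. h x * indicator (box a b) x) \<in> borel_measurable (lebesgue_on \<Omega>)"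
        using borel_measurable_integrable[OF indi[of a b]] by measurable
      show "AE x in lebesgue_on \<Omega>. (\<lambda>n. h x * box_bump a b n x) \<longlonglongrightarrow> h x * indicator (box a b) x"
        by (intro AE_I2 tendsto_mult tendsto_const box_bump_tendsto)
      show "AE x in lebesgue_on \<Omega>. norm (h x * box_bump a b n x) \<le> \<bar>h x * indicator (box a b) x\<bar>" for n
      proof (intro AE_I2)
        fix x
        have "\<bar>h x\<bar> * box_bump a b n x \<le> \<bar>h x\<bar> * indicator (box a b) x"
          using box_bump_bounds[of a b n x] box_bump_outside[of x a b n]
          by (intro mult_left_mono) (auto simp: indicator_def)
        then show "norm (h x * box_bump a b n x) \<le> \<bar>h x * indicator (box a b) x\<bar>"
          using box_bump_bounds[of a b n x] by (simp add: abs_mult)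
      qed
    qed
    then show ?thesis using ort[OF box_bump_test[OF sub]] by (simp add: LIMSEQ_const_iff)
  qed
  have loc: "AE x in lborel. x \<in> box c d \<longrightarrow> h x = 0" if cd: "cbox c d \<subseteq> \<Omega>" for c d
  proof -
    have bs: "box c d \<subseteq> \<Omega>" using cd box_subset_cbox by blast
    define H where "H x = indicator (box c d) x * h x" for x
    have "integrable (lebesgue_on \<Omega>) (\<lambda>x. h x * indicator (box c d) x)"
      by (rule inLp_mult_integrable[OF p h indi, where B=1]) (auto simp: indicator_def)
    then have "integrable lebesgue (\<lambda>x. indicator \<Omega> x *\<^sub>R (h x * indicator (box c d) x))"
      by (subst (asm) integrable_restrict_space) auto
    also have "(\<lambda>x. indicator \<Omega> x *\<^sub>R (h x * indicator (box c d) x)) = H"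
      using bs by (auto simp: H_def indicator_def fun_eq_iff)
    finally have HI: "integrable lebesgue H" .
    \<comment> \<open>The box argument lives on the Borel sets, whereas h is only measurable for the
      completion; hence the passage to a Borel representative.\<close>
    obtain H' where H'm[measurable]: "H' \<in> borel_measurable lborel" and HH': "AE x in lborel. H x = H' x"
      using completion_ex_borel_measurable_real[OF borel_measurable_integrable[OF HI]] by blast
    have HH'c: "AE x in lebesgue. H x = H' x" using HH' by (rule AE_completion)
    have H'c: "H' \<in> borel_measurable lebesgue" using H'm by (rule measurable_completion)
    have "integrable lebesgue H'"
      using HI HH'c H'c borel_measurable_integrable[OF HI] integrable_cong_AE by blast
    then have H'I: "integrable lborel H'" using H'm by (simp add: integrable_completion)
    have int0: "(\<integral>x. indicator (box a b) x * H' x \<partial>lborel) = 0" for a b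
    proof -
      have "(\<integral>x. indicator (box a b) x * H' x \<partial>lborel) = (\<integral>x. indicator (box a b) x * H' x \<partial>lebesgue)"
        by (rule integral_completion[symmetric]) measurable
      also have "\<dots> = (\<integral>x. indicator (box a b) x * H x \<partial>lebesgue)"
        using HH'c H'c borel_measurable_integrable[OF HI] by (intro integral_cong_AE borel_measurable_times borel_measurable_indicator) auto
      also have "\<dots> = 0"
      proof -
        \<comment> \<open>The intersection is again a box, and when nonempty its closure stays
          inside \<open>cbox c d\<close>, so the vanishing of integrals over interior boxes applies
          to it.\<close>
        obtain u v where uv: "box a b \<inter> box c d = box u v" using box_Int_box by blast
        show ?thesis
        proof (cases "box u v = {}")
          case True
          then have "(\<lambda>x. indicator (box a b) x * H x) = (\<lambda>_. 0)"
            using uv by (auto simp: H_def indicator_def fun_eq_iff)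
          then show ?thesis by simp
        next
          case False
          have "box u v \<subseteq> box c d" using uv by blast
          then have "cbox u v \<subseteq> cbox c d" 
            using False by (metis closure_box closure_mono closure_minimal closed_cbox box_subset_cbox subset_trans)
          then have "(\<integral>x. h x * indicator (box u v) x \<partial>lebesgue_on \<Omega>) = 0" using box0 cd by blast
          then have "(\<integral>x. indicator \<Omega> x *\<^sub>R (h x * indicator (box u v) x) \<partial>lebesgue) = 0"
            by (subst (asm) integral_restrict_space) auto
          also have "(\<lambda>x. indicator \<Omega> x *\<^sub>R (h x * indicator (box u v) x)) = (\<lambda>x. indicator (box a b) x * H x)"
            using bs uv by (auto simp: H_def indicator_def fun_eq_iff set_eq_iff)
          finally show ?thesis .
        qed
      qed
      finally show ?thesis .
    qed
    have tot: "(\<integral>x. H' x \<partial>lborel) = 0"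
    proof -
      have "(\<integral>x. H' x \<partial>lborel) = (\<integral>x. indicator (box c d) x * H' x \<partial>lborel)"
      proof (rule integral_cong_AE)
        show "AE x in lborel. H' x = indicator (box c d) x * H' x"
          using HH' by eventually_elim (auto simp: H_def indicator_def split: if_splits)
      qed measurable
      then show ?thesis using int0 by simp
    qed
    have "AE x in lborel. H' x = 0" by (rule integral_zero_boxes_AE_zero[OF H'I tot int0])
    with HH' show ?thesis by eventually_elim (auto simp: H_def)
  qed
  \<comment> \<open>A rational box is encoded by the pairs of its corner coordinates, as a function
    on the finite set \<open>Basis\<close>; this makes the family countable.\<close>
  define a' where "a' f = (\<Sum>i\<in>Basis. fst (f i) *\<^sub>R i)" for f :: "'a \<Rightarrow> real \<times> real"
  define b' where "b' f = (\<Sum>i\<in>Basis. snd (f i) *\<^sub>R i)" for f :: "'a \<Rightarrow> real \<times> real"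
  define I where "I = {f\<in>Basis \<rightarrow>\<^sub>E \<rat> \<times> \<rat>. cbox (a' f) (b' f) \<subseteq> \<Omega>}"
  have cI: "countable I"
    unfolding I_def by (intro countable_subset[OF Collect_restrict] countable_PiE countable_SIGMA countable_rat) auto
  have "\<Omega> \<subseteq> (\<Union>f\<in>I. box (a' f) (b' f))"
  proof
    fix x assume "x \<in> \<Omega>"
    then obtain e where e: "e > 0" "ball x e \<subseteq> \<Omega>" using \<Omega> open_contains_ball by blast
    obtain a b where ab: "\<forall>i\<in>Basis. a \<bullet> i \<in> \<rat> \<and> b \<bullet> i \<in> \<rat>" "x \<in> box a b" "box a b \<subseteq> ball x (e/2)"
      using rational_boxes[of "e/2" x] e(1) by auto
    have "cbox a b = closure (box a b)" using ab(2) by (intro closure_box[symmetric]) auto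
    also have "\<dots> \<subseteq> cball x (e/2)" using ab(3) ball_subset_cball by (intro closure_minimal) auto
    also have "\<dots> \<subseteq> ball x e" using e(1) by (intro cball_subset_ball_iff[THEN iffD2]) auto
    finally have sub: "cbox a b \<subseteq> \<Omega>" using e(2) by blast
    define f where "f = (\<lambda>i\<in>Basis. (a \<bullet> i, b \<bullet> i))"
    have "a' f = a" "b' f = b" by (simp_all add: a'_def b'_def f_def euclidean_representation)
    moreover have "f \<in> Basis \<rightarrow>\<^sub>E \<rat> \<times> \<rat>" using ab(1) by (auto simp: f_def)
    ultimately have "f \<in> I" "x \<in> box (a' f) (b' f)" using ab(2) sub by (auto simp: I_def)
    then show "x \<in> (\<Union>f\<in>I. box (a' f) (b' f))" by blast
  qed
  moreover have "AE x in lborel. \<forall>f\<in>I. x \<in> box (a' f) (b' f) \<longrightarrow> h x = 0"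
    using cI loc by (subst AE_ball_countable) (auto simp: I_def)
  ultimately have "AE x in lborel. x \<in> \<Omega> \<longrightarrow> h x = 0"
    by (auto elim!: eventually_mono)
  then show ?thesis using \<Omega> by (simp add: AE_lebesgue_on_iff)
qed

lemma Lp_inLp: "Lp \<Omega> p f \<longleftrightarrow> inLp (lebesgue_on \<Omega>) p f"
  by (simp add: Lp_def inLp_def)

lemma inLp_inner:
  fixes g :: "'a \<Rightarrow> 'b::euclidean_space"
  assumes "p \<ge> 0" "inLp M p g" "i \<in> Basis"
  shows "inLp M p (\<lambda>x. g x \<bullet> i)"
proof -
  note [measurable] = inLp_measurable[OF assms(2)]
  have "integrable M (\<lambda>x. \<bar>g x \<bullet> i\<bar> powr p)"
    by (rule Bochner_Integration.integrable_bound[of M "\<lambda>x. norm (g x) powr p"])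
      (use assms in \<open>auto simp: inLp_def intro!: powr_mono2 Basis_le_norm\<close>)
  then show ?thesis by (simp add: inLp_def)
qed

text \<open>Each component of the difference is orthogonal to all test functions. This makes the
  energy independent of which weak gradient is chosen.\<close>

lemma weak_grad_unique:
  fixes u :: "'a::euclidean_space \<Rightarrow> real"
  assumes \<Omega>: "open \<Omega>" and p: "p \<ge> 1" and g: "inLp (lebesgue_on \<Omega>) p g" "inLp (lebesgue_on \<Omega>) p g'"
    and w: "weak_grad \<Omega> u g" "weak_grad \<Omega> u g'"
  shows "AE x in lebesgue_on \<Omega>. g x = g' x"
proof -
  have "AE x in lebesgue_on \<Omega>. (g x - g' x) \<bullet> i = 0" if i: "i \<in> Basis" for i
  proof (rule test_orthogonal_AE_zero[OF \<Omega> p])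
    have d: "inLp (lebesgue_on \<Omega>) p (\<lambda>x. g x - g' x)" using g p by (intro inLp_diff) auto
    show "inLp (lebesgue_on \<Omega>) p (\<lambda>x. (g x - g' x) \<bullet> i)" using d p i by (intro inLp_inner) auto
    fix \<phi> assume t: "test_fun \<Omega> \<phi>"
    obtain B where B: "\<And>x. norm (\<phi> x) \<le> B" using ccont_bounded[OF ccont_test[OF t]] by blast
    have I: "integrable (lebesgue_on \<Omega>) (\<lambda>x. (g x \<bullet> i) * \<phi> x)" if "inLp (lebesgue_on \<Omega>) p g" for g
      using that p i B ccont_lebesgue_on_integrable[OF ccont_test[OF t] \<Omega>]
      by (intro inLp_mult_integrable[OF p inLp_inner]) auto
    have "(\<integral>x. (g x - g' x) \<bullet> i * \<phi> x \<partial>lebesgue_on \<Omega>)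
      = (\<integral>x. (g x \<bullet> i) * \<phi> x \<partial>lebesgue_on \<Omega>) - (\<integral>x. (g' x \<bullet> i) * \<phi> x \<partial>lebesgue_on \<Omega>)"
      using I g by (simp add: inner_diff_left left_diff_distrib)
    also have "\<dots> = 0"
    proof -
      have "- (\<integral>x. (g x \<bullet> i) * \<phi> x \<partial>lebesgue_on \<Omega>) = - (\<integral>x. (g' x \<bullet> i) * \<phi> x \<partial>lebesgue_on \<Omega>)"
        using w t i unfolding weak_grad_def by simp
      then show ?thesis by simp
    qed
    finally show "(\<integral>x. (g x - g' x) \<bullet> i * \<phi> x \<partial>lebesgue_on \<Omega>) = 0" .
  qed
  then have "AE x in lebesgue_on \<Omega>. \<forall>i\<in>Basis. (g x - g' x) \<bullet> i = 0"
    by (subst AE_ball_countable) (auto simp: countable_finite)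
  then show ?thesis
    by eventually_elim (metis euclidean_all_zero_iff right_minus_eq)
qed

section \<open>Ball averages\<close>

text \<open>The tangent to t^q at the mean m of |g| is integrated. On a space of mass one the term
  of degree one integrates to q m^q, and (q - 1) m^q cancels against it.\<close>

lemma jensen_powr:
  fixes g :: "'a \<Rightarrow> real"
  assumes M: "emeasure M (space M) = 1" and [measurable]: "g \<in> borel_measurable M"
    and B: "\<And>x. \<bar>g x\<bar> \<le> B" and q: "q \<ge> 1"
  shows "\<bar>\<integral>x. g x \<partial>M\<bar> powr q \<le> (\<integral>x. \<bar>g x\<bar> powr q \<partial>M)" "integrable M (\<lambda>x. \<bar>g x\<bar> powr q)"
proof -
  interpret finite_measure M by standard (simp add: M)
  have m1: "measure M (space M) = 1" using M by (simp add: measure_def)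
  have B0: "B \<ge> 0" using B[of undefined] by simp
  have i1: "integrable M (\<lambda>x. \<bar>g x\<bar>)" by (rule integrable_const_bound[of _ B]) (use B in auto)
  show iq: "integrable M (\<lambda>x. \<bar>g x\<bar> powr q)"
    by (rule integrable_const_bound[of _ "B powr q"]) (use B q in \<open>auto intro!: powr_mono2\<close>)
  show "\<bar>\<integral>x. g x \<partial>M\<bar> powr q \<le> (\<integral>x. \<bar>g x\<bar> powr q \<partial>M)"
  proof (cases "q = 1")
    case True
    then show ?thesis by simp
  next
    case False
    define m where "m = (\<integral>x. \<bar>g x\<bar> \<partial>M)"
    have m0: "m \<ge> 0" by (simp add: m_def)
    have "\<bar>\<integral>x. g x \<partial>M\<bar> powr q \<le> m powr q"
      unfolding m_def using q by (intro powr_mono2 integral_abs_bound) auto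
    also have "m powr q \<le> (\<integral>x. \<bar>g x\<bar> powr q \<partial>M)"
    proof -
      have le: "(\<integral>x. q * m powr (q - 1) * \<bar>g x\<bar> \<partial>M) \<le> (\<integral>x. \<bar>g x\<bar> powr q + (q - 1) * m powr q \<partial>M)"
        using False q i1 iq m0 by (intro integral_mono powr_tangent) auto
      have l: "(\<integral>x. q * m powr (q - 1) * \<bar>g x\<bar> \<partial>M) = q * m powr (q - 1) * m"
        unfolding m_def by (rule integral_mult_right_zero)
      have e: "q * m powr (q - 1) * m = q * m powr q"
        using m0 q False by (cases "m = 0") (simp_all add: powr_diff)
      have r: "(\<integral>x. \<bar>g x\<bar> powr q + (q - 1) * m powr q \<partial>M) = (\<integral>x. \<bar>g x\<bar> powr q \<partial>M) + (q - 1) * m powr q"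
        using iq by (simp add: m1)
      from le have "q * m powr q \<le> (\<integral>x. \<bar>g x\<bar> powr q \<partial>M) + (q - 1) * m powr q"
        unfolding l e r .
      then show ?thesis by (simp add: left_diff_distrib)
    qed
    finally show ?thesis .
  qed
qed

text \<open>The Steklov mean over the ball of radius e about x. Writing it as an integral against a
  probability measure lets Jensen's inequality apply directly.\<close>

definition avg :: "real \<Rightarrow> ('a::euclidean_space \<Rightarrow> real) \<Rightarrow> 'a \<Rightarrow> real" where
  "avg e f x = (\<integral>h. f (x + h) \<partial>uniform_measure lborel (cball 0 e))"

lemma uniform_cball:
  assumes "e > 0"
  shows "emeasure lborel (cball (0::'a::euclidean_space) e) = ennreal (measure lborel (cball (0::'a) e))"
    and "measure lborel (cball (0::'a) e) > 0"
    and "emeasure (uniform_measure lborel (cball (0::'a) e)) (space (uniform_measure lborel (cball (0::'a) e))) = 1"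
    and "AE h in uniform_measure lborel (cball (0::'a) e). norm h \<le> e"
proof -
  have fin: "emeasure lborel (cball (0::'a) e) < \<infinity>"
    by (rule emeasure_compact_finite[OF compact_cball])
  then show eq: "emeasure lborel (cball (0::'a) e) = ennreal (measure lborel (cball (0::'a) e))"
    by (intro emeasure_eq_ennreal_measure) auto
  show pos: "measure lborel (cball (0::'a) e) > 0"
    using content_cball_pos[OF assms, of "0::'a"] by simp
  then have n0: "emeasure lborel (cball (0::'a) e) \<noteq> 0" unfolding eq by simp
  have "emeasure (uniform_measure lborel (cball (0::'a) e)) UNIV =
     emeasure lborel (cball (0::'a) e) / emeasure lborel (cball (0::'a) e)"
    by (subst emeasure_uniform_measure) auto
  then show "emeasure (uniform_measure lborel (cball (0::'a) e)) (space (uniform_measure lborel (cball (0::'a) e))) = 1"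
    unfolding eq using pos by (simp add: divide_ennreal)
  show "AE h in uniform_measure lborel (cball (0::'a) e). norm h \<le> e"
    using fin n0 by (subst AE_uniform_measure) auto
qed

text \<open>Jensen's inequality over the ball, followed by enlarging the domain of integration to
  the whole space; the inverse volume is the price of the normalization.\<close>

lemma avg_pointwise:
  fixes f :: "'a::euclidean_space \<Rightarrow> real"
  assumes e: "e > 0" and q: "q \<ge> 1" and f: "ccont f"
  shows "\<bar>avg e f x\<bar> powr q \<le> pint lborel q f / measure lborel (cball (0::'a) e)"
proof -
  let ?U = "uniform_measure lborel (cball (0::'a) e)"
  note [measurable] = ccont_measurable[OF f]
  obtain B where B: "\<And>x. norm (f x) \<le> B" using ccont_bounded[OF f] by blast
  have m: "(\<lambda>h. f (x + h)) \<in> borel_measurable ?U" by measurable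
  have cs: "ccont (\<lambda>h. f (h + x))" by (rule ccont_shift[OF f])
  have Bs: "\<bar>f (x + h)\<bar> \<le> B" for h using B[of "x + h"] by simp
  note J = jensen_powr[OF uniform_cball(3)[OF e] m Bs q]
  have "ennreal (\<bar>avg e f x\<bar> powr q) \<le> ennreal (\<integral>h. \<bar>f (x + h)\<bar> powr q \<partial>?U)"
    using J(1) unfolding avg_def by (rule ennreal_leI)
  also have "\<dots> = (\<integral>\<^sup>+h. \<bar>f (x + h)\<bar> powr q \<partial>?U)"
    using J(2) by (intro nn_integral_eq_integral[symmetric]) auto
  also have "\<dots> = (\<integral>\<^sup>+h. ennreal (\<bar>f (x + h)\<bar> powr q) * indicator (cball 0 e) h \<partial>lborel) / emeasure lborel (cball (0::'a) e)"
    by (rule nn_integral_uniform_measure) measurable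
  also have "\<dots> \<le> (\<integral>\<^sup>+h. ennreal (\<bar>f (x + h)\<bar> powr q) \<partial>lborel) / emeasure lborel (cball (0::'a) e)"
    by (intro divide_right_mono_ennreal nn_integral_mono) (auto simp: indicator_def)
  also have "(\<integral>\<^sup>+h. ennreal (\<bar>f (x + h)\<bar> powr q) \<partial>lborel) = ennreal (pint lborel q (\<lambda>h. f (h + x)))"
    unfolding pint_def using ccont_inLp[OF cs, of q] q
    by (subst nn_integral_eq_integral[symmetric]) (auto simp: inLp_def add.commute)
  also have "pint lborel q (\<lambda>h. f (h + x)) = pint lborel q f" by (rule pint_shift) measurable
  also have "ennreal (pint lborel q f) / emeasure lborel (cball (0::'a) e)
    = ennreal (pint lborel q f / measure lborel (cball (0::'a) e))"
    unfolding uniform_cball(1)[OF e] using uniform_cball(2)[OF e] pint_nonneg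
    by (subst divide_ennreal) auto
  finally show ?thesis
    using uniform_cball(2)[OF e, where 'a='a] pint_nonneg[of lborel q f] by (subst (asm) ennreal_le_iff) auto
qed

lemma avg_bound:
  fixes f :: "'a::euclidean_space \<Rightarrow> real"
  assumes e: "e > 0" and q: "q \<ge> 1" and f: "ccont f" and K: "pint lborel q f \<le> K"
  shows "\<bar>avg e f x\<bar> \<le> (K / measure lborel (cball (0::'a) e)) powr (1/q)"
proof -
  have "\<bar>avg e f x\<bar> powr q \<le> K / measure lborel (cball (0::'a) e)"
    using avg_pointwise[OF e q f, of x] divide_right_mono[OF K, of "measure lborel (cball (0::'a) e)"] by simp
  then have "(\<bar>avg e f x\<bar> powr q) powr (1/q) \<le> (K / measure lborel (cball (0::'a) e)) powr (1/q)"
    using q by (intro powr_mono2) auto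
  then show ?thesis using q by (simp add: powr_powr)
qed

text \<open>Jensen's inequality in h and then Tonelli: averaging functions whose q-integrals are at
  most c does not exceed c. The average itself (G x h = f (x + h)) and its error (G x h = \<phi> x -
  \<phi> (x + h)) are both instances.\<close>

lemma parametric_average_Lq:
  fixes G :: "'a::euclidean_space \<Rightarrow> 'a \<Rightarrow> real"
  assumes e: "e > 0" and q: "q \<ge> 1"
    and cont: "continuous_on UNIV (\<lambda>(x, h). G x h)"
    and B: "\<And>x h. \<bar>G x h\<bar> \<le> B"
    and Lq: "\<And>h. norm h \<le> e \<Longrightarrow> inLp lborel q (\<lambda>x. G x h) \<and> pint lborel q (\<lambda>x. G x h) \<le> c"
  shows "inLp lborel q (\<lambda>x. \<integral>h. G x h \<partial>uniform_measure lborel (cball 0 e))"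
    and "pint lborel q (\<lambda>x. \<integral>h. G x h \<partial>uniform_measure lborel (cball 0 e)) \<le> c"
proof -
  let ?U = "uniform_measure lborel (cball (0::'a) e)"
  define k where "k x = (\<integral>h. G x h \<partial>?U)" for x
  interpret U: finite_measure ?U by standard (simp only: uniform_cball(3)[OF e], simp)
  interpret P: pair_sigma_finite lborel ?U ..
  have Gm[measurable]: "(\<lambda>(x, h). G x h) \<in> borel_measurable (lborel \<Otimes>\<^sub>M ?U)"
  proof -
    have "sets ((lborel :: 'a measure) \<Otimes>\<^sub>M ?U) = sets (borel \<Otimes>\<^sub>M (borel :: 'a measure))"
      by (intro sets_pair_measure_cong) auto
    also have "\<dots> = sets (borel :: ('a \<times> 'a) measure)" by (rule arg_cong[OF borel_prod])
    finally show ?thesis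
      using borel_measurable_continuous_onI[OF cont] measurable_cong_sets by blast
  qed
  have Gx: "G x \<in> borel_measurable ?U" for x
    using measurable_compose_Pair1[OF _ Gm, of x] by simp
  have km[measurable]: "k \<in> borel_measurable lborel"
    unfolding k_def using Gm by (rule U.borel_measurable_lebesgue_integral)
  note J = jensen_powr[OF uniform_cball(3)[OF e] Gx B q]
  have c0: "c \<ge> 0" using Lq[of 0] e pint_nonneg order_trans by (metis less_imp_le norm_zero)
  have bound: "(\<integral>\<^sup>+x. ennreal (\<bar>k x\<bar> powr q) \<partial>lborel) \<le> ennreal c"
  proof -
    have "(\<integral>\<^sup>+x. ennreal (\<bar>k x\<bar> powr q) \<partial>lborel) \<le> (\<integral>\<^sup>+x. \<integral>\<^sup>+h. ennreal (\<bar>G x h\<bar> powr q) \<partial>?U \<partial>lborel)"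
    proof (rule nn_integral_mono)
      fix x
      have "ennreal (\<bar>k x\<bar> powr q) \<le> ennreal (\<integral>h. \<bar>G x h\<bar> powr q \<partial>?U)"
        using J(1) unfolding k_def by (rule ennreal_leI)
      also have "\<dots> = (\<integral>\<^sup>+h. ennreal (\<bar>G x h\<bar> powr q) \<partial>?U)"
        using J(2) by (intro nn_integral_eq_integral[symmetric]) auto
      finally show "ennreal (\<bar>k x\<bar> powr q) \<le> (\<integral>\<^sup>+h. ennreal (\<bar>G x h\<bar> powr q) \<partial>?U)" .
    qed
    also have "\<dots> = (\<integral>\<^sup>+h. \<integral>\<^sup>+x. ennreal (\<bar>G x h\<bar> powr q) \<partial>lborel \<partial>?U)"
      by (rule P.Fubini'[symmetric]) measurable
    also have "\<dots> \<le> (\<integral>\<^sup>+h. ennreal c \<partial>?U)"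
    proof (rule nn_integral_mono_AE, use uniform_cball(4)[OF e] in eventually_elim)
      case (elim h)
      have "(\<integral>\<^sup>+x. ennreal (\<bar>G x h\<bar> powr q) \<partial>lborel) = ennreal (pint lborel q (\<lambda>x. G x h))"
        unfolding pint_def using Lq[OF elim] by (subst nn_integral_eq_integral) (auto simp: inLp_def)
      then show ?case using Lq[OF elim] by (simp add: ennreal_leI)
    qed
    also have "\<dots> = ennreal c" using uniform_cball(3)[OF e, where 'a='a] by simp
    finally show ?thesis .
  qed
  have I: "integrable lborel (\<lambda>x. \<bar>k x\<bar> powr q)"
  proof (rule integrableI_bounded)
    have "(\<integral>\<^sup>+x. ennreal (norm (\<bar>k x\<bar> powr q)) \<partial>lborel) \<le> ennreal c" using bound by simp
    then show "(\<integral>\<^sup>+x. ennreal (norm (\<bar>k x\<bar> powr q)) \<partial>lborel) < \<infinity>"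
      using ennreal_less_top order_le_less_trans by (metis infinity_ennreal_def)
  qed measurable
  then show "inLp lborel q (\<lambda>x. \<integral>h. G x h \<partial>?U)" 
    using km unfolding inLp_def k_def[symmetric] by simp
  have "ennreal (pint lborel q k) \<le> ennreal c"
    using bound I by (simp add: pint_def nn_integral_eq_integral)
  then show "pint lborel q (\<lambda>x. \<integral>h. G x h \<partial>?U) \<le> c" using c0 by (simp add: k_def[symmetric] cong: if_cong)
qed

lemma avg_Lq:
  fixes f :: "'a::euclidean_space \<Rightarrow> real"
  assumes e: "e > 0" and q: "q \<ge> 1" and f: "ccont f"
  shows "inLp lborel q (avg e f)" "pint lborel q (avg e f) \<le> pint lborel q f"
proof -
  obtain B where B: "\<And>x. norm (f x) \<le> B" using ccont_bounded[OF f] by blast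
  have c: "continuous_on UNIV f" using f by (simp add: ccont_def)
  have 1: "continuous_on UNIV (\<lambda>(x, h). f (x + h))"
    unfolding split_def by (intro continuous_on_compose2[OF c] continuous_intros) auto
  have 2: "\<bar>f (x + h)\<bar> \<le> B" for x h using B[of "x + h"] by simp
  have 3: "inLp lborel q (\<lambda>x. f (x + h)) \<and> pint lborel q (\<lambda>x. f (x + h)) \<le> pint lborel q f" for h
    using ccont_inLp[OF ccont_shift[OF f]] q ccont_measurable[OF f] by (simp add: pint_shift)
  show "inLp lborel q (avg e f)" "pint lborel q (avg e f) \<le> pint lborel q f"
    unfolding avg_def[abs_def] using parametric_average_Lq[OF e q 1 2 3] by auto
qed

lemma avg_diff_Lp:
  fixes \<phi> :: "'a::euclidean_space \<Rightarrow> real"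
  assumes e: "e > 0" and p: "p \<ge> 1" and t: "test_fun \<Omega> \<phi>"
  shows "inLp lborel p (\<lambda>x. \<phi> x - avg e \<phi> x)"
    "pint lborel p (\<lambda>x. \<phi> x - avg e \<phi> x) \<le> e powr p * pint lborel p (grad \<phi>)"
proof -
  let ?U = "uniform_measure lborel (cball (0::'a) e)"
  note f = ccont_test[OF t]
  note [measurable] = ccont_measurable[OF f]
  interpret U: finite_measure ?U by standard (simp only: uniform_cball(3)[OF e], simp)
  obtain B where B: "\<And>x. norm (\<phi> x) \<le> B" using ccont_bounded[OF f] by blast
  have c: "continuous_on UNIV \<phi>" using f by (simp add: ccont_def)
  have 1: "continuous_on UNIV (\<lambda>(x, h). \<phi> x - \<phi> (x + h))"
    unfolding split_def by (intro continuous_on_compose2[OF c] continuous_intros) auto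
  have 2: "\<bar>\<phi> x - \<phi> (x + h)\<bar> \<le> 2 * B" for x h using B[of "x + h"] B[of x] by simp
  have 3: "inLp lborel p (\<lambda>x. \<phi> x - \<phi> (x + h)) \<and>
      pint lborel p (\<lambda>x. \<phi> x - \<phi> (x + h)) \<le> e powr p * pint lborel p (grad \<phi>)" if "norm h \<le> e" for h
  proof
    show "inLp lborel p (\<lambda>x. \<phi> x - \<phi> (x + h))"
      using p by (intro ccont_inLp ccont_diff ccont_shift f) auto
    have "pint lborel p (\<lambda>x. \<phi> x - \<phi> (x + h)) = pint lborel p (\<lambda>x. \<phi> (x + h) - \<phi> x)" by (rule pint_commute)
    also have "\<dots> \<le> norm h powr p * pint lborel p (grad \<phi>)" by (rule pint_translation_le[OF p t])
    also have "\<dots> \<le> e powr p * pint lborel p (grad \<phi>)"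
      using that p by (intro mult_right_mono powr_mono2 pint_nonneg) auto
    finally show "pint lborel p (\<lambda>x. \<phi> x - \<phi> (x + h)) \<le> e powr p * pint lborel p (grad \<phi>)" .
  qed
  have eq: "(\<integral>h. \<phi> x - \<phi> (x + h) \<partial>?U) = \<phi> x - avg e \<phi> x" for x
  proof -
    have "integrable ?U (\<lambda>h. \<phi> (x + h))" by (rule U.integrable_const_bound[of _ B]) (use B in auto)
    moreover have "measure ?U UNIV = 1" using uniform_cball(3)[OF e, where 'a='a] by (simp add: measure_def)
    ultimately show ?thesis by (simp add: avg_def)
  qed
  show "inLp lborel p (\<lambda>x. \<phi> x - avg e \<phi> x)"
    "pint lborel p (\<lambda>x. \<phi> x - avg e \<phi> x) \<le> e powr p * pint lborel p (grad \<phi>)"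
    using parametric_average_Lq[OF e p 1 2 3] unfolding eq by auto
qed

lemma avg_diff:
  fixes f g :: "'a::euclidean_space \<Rightarrow> real"
  assumes e: "e > 0" and f: "ccont f" "ccont g"
  shows "avg e (\<lambda>x. f x - g x) x = avg e f x - avg e g x"
proof -
  let ?U = "uniform_measure lborel (cball (0::'a) e)"
  interpret U: finite_measure ?U by standard (simp only: uniform_cball(3)[OF e], simp)
  have "integrable ?U (\<lambda>h. f (x + h))" if c: "ccont f" for f :: "'a \<Rightarrow> real"
  proof -
    obtain B where B: "\<And>x. norm (f x) \<le> B" using ccont_bounded[OF c] by blast
    note [measurable] = ccont_measurable[OF c]
    show ?thesis by (rule U.integrable_const_bound[of _ B]) (use B in auto)
  qed
  then show ?thesis using f by (simp add: avg_def)
qed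

text \<open>A translate of an average is the average of the translate, so the pointwise bound
  applies to the translation difference. After a p-th root this is a Lipschitz estimate depending
  only on the energy and the radius.\<close>

lemma avg_translation:
  fixes \<phi> :: "'a::euclidean_space \<Rightarrow> real"
  assumes e: "e > 0" and p: "p \<ge> 1" and t: "test_fun \<Omega> \<phi>"
  shows "\<bar>avg e \<phi> (x + k) - avg e \<phi> x\<bar> powr p
     \<le> norm k powr p * pint lborel p (grad \<phi>) / measure lborel (cball (0::'a) e)"
proof -
  note c = ccont_test[OF t]
  have "avg e (\<lambda>x. \<phi> (x + k)) x = avg e \<phi> (x + k)"
    unfolding avg_def by (simp add: algebra_simps)
  then have "\<bar>avg e \<phi> (x + k) - avg e \<phi> x\<bar> powr p = \<bar>avg e (\<lambda>x. \<phi> (x + k) - \<phi> x) x\<bar> powr p"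
    by (simp add: avg_diff[OF e ccont_shift[OF c] c])
  also have "\<dots> \<le> pint lborel p (\<lambda>x. \<phi> (x + k) - \<phi> x) / measure lborel (cball (0::'a) e)"
    by (intro avg_pointwise e p ccont_diff ccont_shift c)
  also have "\<dots> \<le> norm k powr p * pint lborel p (grad \<phi>) / measure lborel (cball (0::'a) e)"
    by (intro divide_right_mono pint_translation_le[OF p t]) simp
  finally show ?thesis .
qed

section \<open>Consequences of admissibility\<close>

lemma test_fun_pint:
  assumes "open \<Omega>" "test_fun \<Omega> \<phi>"
  shows "pint (lebesgue_on \<Omega>) r \<phi> = pint lborel r \<phi>"
    "pint (lebesgue_on \<Omega>) r (grad \<phi>) = pint lborel r (grad \<phi>)"
proof -
  obtain K where K: "K \<subseteq> \<Omega>" "\<And>x. x \<notin> K \<Longrightarrow> \<phi> x = 0" "\<And>x v. x \<notin> K \<Longrightarrow> frechet_derivative \<phi> (at x) v = 0"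
    by (rule test_funE[OF assms(2)], rule that)
  note [measurable] = ccont_measurable[OF ccont_test[OF assms(2)]] ccont_measurable[OF ccont_test_grad[OF assms(2)]]
  show "pint (lebesgue_on \<Omega>) r \<phi> = pint lborel r \<phi>"
    unfolding pint_def by (rule lebesgue_on_integral_lborel[OF _ assms(1)]) (use K in auto)
  show "pint (lebesgue_on \<Omega>) r (grad \<phi>) = pint lborel r (grad \<phi>)"
  proof -
    have "grad \<phi> x = 0" if "x \<notin> \<Omega>" for x
    proof -
      have "x \<notin> K" using that K(1) by blast
      then show ?thesis using K(3) by (simp add: grad_def)
    qed
    then show ?thesis
      unfolding pint_def by (intro lebesgue_on_integral_lborel[OF _ assms(1)]) auto
  qed
qed

lemma pint_test_cmult:
  assumes "test_fun \<Omega> \<phi>"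
  shows "pint M r (\<lambda>x. c * \<phi> x) = \<bar>c\<bar> powr r * pint M r \<phi>"
    "pint M r (grad (\<lambda>x. c * \<phi> x)) = \<bar>c\<bar> powr r * pint M r (grad \<phi>)"
  using pint_scale[of M r c \<phi>] pint_scale[of M r c "grad \<phi>"] grad_cmult[OF test_fun_smooth[OF assms], of c]
  by (auto simp: pint_def)

text \<open>A test function with positive q-integral Q is rescaled by Q^(-1/q) to meet the
  constraint in the infimum. Homogeneity turns this into an inequality for all test functions, with
  C = (1/l)^(q/p) for l the infimum; if Q = 0 there is nothing to show.\<close>

lemma q_admissible_bound:
  fixes \<Omega> :: "'a::euclidean_space set"
  assumes \<Omega>: "open \<Omega>" and q: "q \<ge> 1" and p: "p \<ge> 1" and adm: "q_admissible \<Omega> p q"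
  obtains C where "C > 0" "\<And>\<phi>. test_fun \<Omega> \<phi> \<Longrightarrow> pint lborel q \<phi> \<le> C * pint lborel p (grad \<phi>) powr (q/p)"
proof -
  define l where "l = lambda_pq \<Omega> p q"
  have l: "l > 0" using adm by (simp add: l_def q_admissible_def)
  show thesis
  proof (rule that)
    show "(1 / l) powr (q/p) > 0" using l by simp
    fix \<phi> assume t: "test_fun \<Omega> \<phi>"
    define Q where "Q = pint lborel q \<phi>"
    have Q0: "Q \<ge> 0" by (simp add: Q_def pint_nonneg)
    show "pint lborel q \<phi> \<le> (1 / l) powr (q/p) * pint lborel p (grad \<phi>) powr (q/p)"
    proof (cases "Q = 0")
      case True
      then show ?thesis by (simp add: Q_def)
    next
      case False
      define s where "s = Q powr (- 1 / q)"
      have s: "s > 0" using False by (simp add: s_def)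
      have "s powr q = Q powr (-1)" using q by (simp add: s_def powr_powr)
      then have sq: "s powr q * Q = 1" using False Q0 by (simp add: powr_minus)
      have t': "test_fun \<Omega> (\<lambda>x. s * \<phi> x)" by (rule test_fun_cmult[OF t])
      have "pint (lebesgue_on \<Omega>) q (\<lambda>x. s * \<phi> x) = 1"
        unfolding pint_test_cmult[OF t] test_fun_pint[OF \<Omega> t] using s sq by (simp add: Q_def)
      then have "l \<le> pint (lebesgue_on \<Omega>) p (grad (\<lambda>x. s * \<phi> x))"
        unfolding l_def lambda_pq_def
        by (intro cInf_lower bdd_belowI[of _ 0]) (use t' in \<open>auto simp: pint_def\<close>)
      also have "\<dots> = s powr p * pint lborel p (grad \<phi>)"
        unfolding pint_test_cmult[OF t] test_fun_pint[OF \<Omega> t] using s by simp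
      finally have "1 \<le> (1 / l) * (s powr p * pint lborel p (grad \<phi>))" using l by (simp add: divide_simps)
      then have "1 powr (q/p) \<le> ((1 / l) * (s powr p * pint lborel p (grad \<phi>))) powr (q/p)"
        using q p by (intro powr_mono2) auto
      also have "\<dots> = (1 / l) powr (q/p) * (s powr q * pint lborel p (grad \<phi>) powr (q/p))"
        using l s p pint_nonneg[of lborel p "grad \<phi>"] by (simp add: powr_mult powr_powr powr_divide)
      finally have "Q * 1 \<le> Q * ((1 / l) powr (q/p) * (s powr q * pint lborel p (grad \<phi>) powr (q/p)))"
        using Q0 by (intro mult_left_mono) auto
      also have "\<dots> = (s powr q * Q) * ((1 / l) powr (q/p) * pint lborel p (grad \<phi>) powr (q/p))"
        by (simp add: mult_ac)
      finally show ?thesis unfolding sq by (simp add: Q_def)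
    qed
  qed
qed

section \<open>The inequality far away from the origin\<close>

lemma pint_add_disjoint:
  assumes "inLp M p f" "inLp M p g" "\<And>x. f x = 0 \<or> g x = 0"
  shows "pint M p (\<lambda>x. f x + g x) = pint M p f + pint M p g"
proof -
  have "norm (f x + g x) powr p = norm (f x) powr p + norm (g x) powr p" for x
    using assms(3)[of x] by auto
  then show ?thesis using assms(1,2) by (simp add: pint_def inLp_def)
qed

text \<open>A ball for the maximum norm, chosen so that the matching cutoff is a sum of functions of
  single coordinates.\<close>

definition origin_box :: "real \<Rightarrow> 'a::euclidean_space set" where
  "origin_box R = {x. \<forall>i\<in>Basis. \<bar>x \<bullet> i\<bar> < R}"

lemma origin_box_eq: "origin_box R = box (- (R *\<^sub>R One)) (R *\<^sub>R (One::'a::euclidean_space))"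
  by (auto simp: origin_box_def box_def abs_less_iff)

lemma open_origin_box: "open (origin_box R)"
  by (simp add: origin_box_eq open_box)

text \<open>If the Poincare constant did not improve far away, widely separated bumps could be added up:
  the \<open>q\<close>-integral and the \<open>p\<close>-energy of \<open>m\<close> of them both grow linearly in \<open>m\<close>, which for
  \<open>q < p\<close> contradicts the scaling of the Poincare inequality.\<close>
lemma bound_improves_at_infinity:
  fixes \<Omega> :: "'a::euclidean_space set"
  assumes q: "q \<ge> 1" and qp: "q < p"
    and C: "\<And>\<phi>. test_fun \<Omega> \<phi> \<Longrightarrow> pint lborel q \<phi> \<le> C * pint lborel p (grad \<phi>) powr (q/p)"
    and \<epsilon>: "\<epsilon> > 0"
  obtains R where "R > 0" "\<And>\<phi>. test_fun \<Omega> \<phi> \<Longrightarrow> (\<And>x. x \<in> origin_box R \<Longrightarrow> \<phi> x = 0)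
     \<Longrightarrow> pint lborel q \<phi> \<le> \<epsilon> * pint lborel p (grad \<phi>) powr (q/p)"
proof (rule ccontr)
  note thesisI = that
  assume "\<not> thesis"
  then have neg: "\<exists>\<phi>. test_fun \<Omega> \<phi> \<and> (\<forall>x\<in>origin_box R. \<phi> x = 0) \<and>
      pint lborel q \<phi> > \<epsilon> * pint lborel p (grad \<phi>) powr (q/p)" if "R > 0" for R
    using thesisI[OF that] by (meson not_le)
  have p: "p > 0" using q qp by simp
  \<comment> \<open>The largest energy that a counterexample for the constant \<epsilon> can have
    once its q-integral is normalized to 1; it does not depend on R.\<close>
  define L where "L = (1/\<epsilon>) powr (p/q)"
  have L0: "L > 0" using \<epsilon> by (simp add: L_def)
  have bad: "\<exists>\<psi>. test_fun \<Omega> \<psi> \<and> (\<forall>x\<in>origin_box R. \<psi> x = 0) \<and> pint lborel q \<psi> = 1 \<and> pint lborel p (grad \<psi>) \<le> L"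
    if R: "R > 0" for R
  proof -
    obtain \<phi> where t: "test_fun \<Omega> \<phi>" and z: "\<forall>x\<in>origin_box R. \<phi> x = 0"
      and gt: "pint lborel q \<phi> > \<epsilon> * pint lborel p (grad \<phi>) powr (q/p)"
      using neg[OF R] by blast
    define Q where "Q = pint lborel q \<phi>"
    define P where "P = pint lborel p (grad \<phi>)"
    have P0: "P \<ge> 0" by (simp add: P_def pint_nonneg)
    have "0 \<le> \<epsilon> * P powr (q/p)" using \<epsilon> by simp
    then have Q0: "Q > 0" using gt by (simp add: Q_def P_def)
    define s where "s = Q powr (- 1 / q)"
    have s: "s > 0" using Q0 by (simp add: s_def)
    have "s powr q = Q powr (-1)" using q by (simp add: s_def powr_powr)
    then have sq: "s powr q * Q = 1" using Q0 by (simp add: powr_minus)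
    have "(\<epsilon> * P powr (q/p)) powr (p/q) \<le> Q powr (p/q)"
      using gt \<epsilon> q p by (intro powr_mono2) (auto simp: P_def Q_def)
    then have "\<epsilon> powr (p/q) * P \<le> Q powr (p/q)"
      using \<epsilon> q p P0 by (simp add: powr_mult powr_powr)
    then have "P \<le> L * Q powr (p/q)" using \<epsilon> by (simp add: L_def powr_divide divide_simps mult.commute)
    then have "s powr p * P \<le> s powr p * (L * Q powr (p/q))" by (intro mult_left_mono) auto
    also have "\<dots> = L" using Q0 by (simp add: s_def powr_powr mult_ac flip: powr_add)
    finally have sP: "s powr p * P \<le> L" .
    show ?thesis
    proof (intro exI conjI ballI)
      show "test_fun \<Omega> (\<lambda>x. s * \<phi> x)" by (rule test_fun_cmult[OF t])
      show "pint lborel q (\<lambda>x. s * \<phi> x) = 1" "pint lborel p (grad (\<lambda>x. s * \<phi> x)) \<le> L"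
        unfolding pint_test_cmult[OF t] using sq sP s by (auto simp: Q_def P_def)
    qed (simp add: z)
  qed
  have multi: "\<exists>\<Phi>. test_fun \<Omega> \<Phi> \<and> pint lborel q \<Phi> = real m \<and> pint lborel p (grad \<Phi>) \<le> real m * L" for m
  proof (induction m)
    case 0
    have "grad (\<lambda>x::'a. 0::real) = (\<lambda>_. 0)" by (simp add: grad_def fun_eq_iff frechet_derivative_const)
    then have "test_fun \<Omega> (\<lambda>x. 0) \<and> pint lborel q (\<lambda>x::'a. 0::real) = real 0 \<and> pint lborel p (grad (\<lambda>x::'a. 0)) \<le> real 0 * L"
      by (simp add: test_fun_0 pint_def)
    then show ?case by blast
  next
    case (Suc m)
    then obtain \<Phi> where \<Phi>: "test_fun \<Omega> \<Phi>" "pint lborel q \<Phi> = real m" "pint lborel p (grad \<Phi>) \<le> real m * L" by blast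
    obtain K where K: "compact K" "K \<subseteq> \<Omega>" "\<And>x. x \<notin> K \<Longrightarrow> \<Phi> x = 0" "\<And>x v. x \<notin> K \<Longrightarrow> frechet_derivative \<Phi> (at x) v = 0"
      by (rule test_funE[OF \<Phi>(1)], rule that)
    obtain B where B: "\<forall>x\<in>K. norm x \<le> B" using compact_imp_bounded[OF K(1)] by (auto simp: bounded_iff)
    \<comment> \<open>The open box must contain the whole support of the bumps collected so far; the
      next bump vanishes on the box and is therefore disjoint from them, gradients included.\<close>
    define R where "R = max B 0 + 1"
    have R0: "R > 0" by (simp add: R_def add_nonneg_pos)
    have KR: "K \<subseteq> origin_box R"
    proof
      fix x assume "x \<in> K"
      then have "norm x < R" using B by (auto simp: R_def)
      then show "x \<in> origin_box R" using Basis_le_norm[of _ x] by (force simp: origin_box_def)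
    qed
    obtain \<psi> where \<psi>: "test_fun \<Omega> \<psi>" "\<forall>x\<in>origin_box R. \<psi> x = 0" "pint lborel q \<psi> = 1" "pint lborel p (grad \<psi>) \<le> L"
      using bad[of R] R0 by blast
    have g\<psi>: "grad \<psi> x = 0" if "x \<in> origin_box R" for x
    proof -
      have "((\<lambda>_. 0) has_derivative (\<lambda>_. 0)) (at x)" by simp
      then have "(\<psi> has_derivative (\<lambda>_. 0)) (at x)"
        by (rule has_derivative_transform_within_open[OF _ open_origin_box that]) (simp add: \<psi>(2))
      then show ?thesis by (simp add: grad_def frechet_derivative_eqI)
    qed
    have g\<Phi>: "grad \<Phi> x = 0" if "x \<notin> K" for x using K(4)[OF that] by (simp add: grad_def)
    have 1: "pint lborel q (\<lambda>x. \<Phi> x + \<psi> x) = pint lborel q \<Phi> + pint lborel q \<psi>"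
      using K(3) KR \<psi>(2) q by (intro pint_add_disjoint ccont_inLp ccont_test[OF \<Phi>(1)] ccont_test[OF \<psi>(1)]) auto
    have "grad (\<lambda>x. \<Phi> x + \<psi> x) = (\<lambda>x. grad \<Phi> x + grad \<psi> x)"
      using grad_add[OF test_fun_smooth[OF \<Phi>(1)] test_fun_smooth[OF \<psi>(1)]] by blast
    then have 2: "pint lborel p (grad (\<lambda>x. \<Phi> x + \<psi> x)) = pint lborel p (grad \<Phi>) + pint lborel p (grad \<psi>)"
      using g\<psi> g\<Phi> KR p
      by (simp only:) (intro pint_add_disjoint ccont_inLp ccont_test_grad[OF \<Phi>(1)] ccont_test_grad[OF \<psi>(1)]; auto)
    show ?case
      using 1 2 \<Phi> \<psi> test_fun_add[OF \<Phi>(1) \<psi>(1)]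
      by (intro exI[of _ "\<lambda>x. \<Phi> x + \<psi> x"]) (auto simp: algebra_simps)
  qed
  define s where "s = 1 - q/p"
  have s: "s > 0" using qp p by (simp add: s_def)
  \<comment> \<open>A negative constant is refuted by a single bump; nonnegativity is required for
    monotonicity in the energy below.\<close>
  have C0: "C \<ge> 0"
  proof (rule ccontr)
    assume "\<not> C \<ge> 0"
    obtain \<Phi> where \<Phi>: "test_fun \<Omega> \<Phi>" "pint lborel q \<Phi> = real 1" using multi by blast
    have "C * pint lborel p (grad \<Phi>) powr (q/p) \<le> 0" using \<open>\<not> C \<ge> 0\<close> by (intro mult_nonpos_nonneg) auto
    then show False using C[OF \<Phi>(1)] \<Phi>(2) by simp
  qed
  have le: "real m powr s \<le> C * L powr (q/p)" if m: "m > 0" for m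
  proof -
    obtain \<Phi> where \<Phi>: "test_fun \<Omega> \<Phi>" "pint lborel q \<Phi> = real m" "pint lborel p (grad \<Phi>) \<le> real m * L"
      using multi by blast
    have "real m \<le> C * pint lborel p (grad \<Phi>) powr (q/p)" using C[OF \<Phi>(1)] \<Phi>(2) by simp
    also have "\<dots> \<le> C * (real m * L) powr (q/p)"
      using C0 \<Phi>(3) q p by (intro mult_left_mono powr_mono2 pint_nonneg) auto
    also have "\<dots> = real m powr (q/p) * (C * L powr (q/p))" using L0 by (simp add: powr_mult)
    finally have "real m / real m powr (q/p) \<le> C * L powr (q/p)"
      using m by (simp add: divide_simps mult.commute)
    then show ?thesis using m by (simp add: s_def powr_diff)
  qed
  \<comment> \<open>The bound on m^(1 - q/p) fails for large m. The added 1 keeps the base positive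
    and makes the contradiction strict.\<close>
  obtain m :: nat where m: "real m > (C * L powr (q/p) + 1) powr (1/s)" using reals_Archimedean2 by blast
  have K0: "C * L powr (q/p) + 1 > 0" using C0 by (simp add: add_nonneg_pos)
  have "(C * L powr (q/p) + 1) powr (1/s) > 0" using K0 by simp
  then have "m > 0" using m by (metis of_nat_0_less_iff order.strict_trans)
  have "((C * L powr (q/p) + 1) powr (1/s)) powr s \<le> real m powr s"
    using m s by (intro powr_mono2) auto
  then have "C * L powr (q/p) + 1 \<le> real m powr s" using K0 s by (simp add: powr_powr)
  then show False using le[OF \<open>m > 0\<close>] by simp
qed

text \<open>It vanishes on the box of half-width R and is at least exp(-1) outside that of
  half-width R + 1, because exp(-1/t) is at least exp(-1) for t at least 1. It need not be 1 at
  infinity: a positive lower bound suffices, and the bounds on it and on its gradient are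
  independent of R.\<close>

definition far_cutoff :: "real \<Rightarrow> 'a::euclidean_space \<Rightarrow> real" where
  "far_cutoff R x = (\<Sum>i\<in>Basis. flat 1 (x \<bullet> i + - R) + flat 1 (x \<bullet> - i + - R))"

lemma smooth_far_cutoff: "smooth_fun (far_cutoff R)"
  unfolding far_cutoff_def[abs_def] by (intro smooth_sum smooth_add smooth_flat_affine) simp

lemma flat_1_deriv_bound: "\<bar>flat (flat_deriv 1) t\<bar> \<le> 2"
proof (cases "t > 0")
  case True
  define z where "z = 1 / t"
  have z: "z > 0" using True by (simp add: z_def)
  have "z\<^sup>2 / 2 \<le> exp z" using exp_lower_Taylor_quadratic[of z] z by simp
  then have "z\<^sup>2 * exp (- z) \<le> 2" by (simp add: exp_minus divide_simps)
  moreover have "flat (flat_deriv 1) t = z\<^sup>2 * exp (- z)"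
    using True by (simp add: flat_def flat_deriv_def z_def power2_eq_square)
  ultimately show ?thesis by simp
qed (simp add: flat_def)

lemma far_cutoff_bounds: "0 \<le> far_cutoff R x" "far_cutoff R (x::'a::euclidean_space) \<le> 2 * DIM('a)"
proof -
  show "0 \<le> far_cutoff R x" by (auto simp: far_cutoff_def intro!: sum_nonneg add_nonneg_nonneg flat_1_bounds)
  have "far_cutoff R x \<le> (\<Sum>i\<in>(Basis::'a set). 1 + 1)"
    unfolding far_cutoff_def by (intro sum_mono add_mono flat_1_bounds)
  then show "far_cutoff R x \<le> 2 * DIM('a)" by simp
qed

lemma far_cutoff_zero: "x \<in> origin_box R \<Longrightarrow> far_cutoff R x = 0"
  by (auto simp: far_cutoff_def origin_box_def flat_def abs_less_iff intro!: sum.neutral)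

lemma far_cutoff_ge:
  assumes "x \<notin> origin_box (R + 1)"
  shows "far_cutoff R x \<ge> exp (-1)"
proof -
  have f1: "flat 1 t \<ge> exp (-1)" if "t \<ge> 1" for t
    using that by (simp add: flat_def divide_simps)
  obtain i where i: "i \<in> Basis" "\<bar>x \<bullet> i\<bar> \<ge> R + 1" using assms by (auto simp: origin_box_def not_less)
  let ?f = "\<lambda>i. flat 1 (x \<bullet> i + - R) + flat 1 (x \<bullet> - i + - R)"
  have "exp (-1) \<le> ?f i"
  proof (cases "x \<bullet> i \<ge> 0")
    case True
    then show ?thesis using i f1[of "x \<bullet> i + - R"] flat_1_bounds(1)[of "x \<bullet> - i + - R"] by simp
  next
    case False
    then show ?thesis using i f1[of "x \<bullet> - i + - R"] flat_1_bounds(1)[of "x \<bullet> i + - R"] by simp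
  qed
  also have "?f i \<le> (\<Sum>i\<in>Basis. ?f i)"
    using i by (intro member_le_sum) (auto intro!: add_nonneg_nonneg flat_1_bounds)
  finally show ?thesis by (simp add: far_cutoff_def)
qed

text \<open>The derivative is evaluated in the direction of the gradient v itself, which gives
  |v|^2. Every coordinate contributes two summands, each at most 2 |v|.\<close>

lemma norm_grad_far_cutoff: "norm (grad (far_cutoff R) (x::'a::euclidean_space)) \<le> 4 * DIM('a)"
proof -
  let ?v = "grad (far_cutoff R) x"
  let ?D = "\<lambda>v. \<Sum>i\<in>Basis. flat (flat_deriv 1) (x \<bullet> i + - R) * (v \<bullet> i) + flat (flat_deriv 1) (x \<bullet> - i + - R) * (v \<bullet> - i)"
  have "(far_cutoff R has_derivative ?D) (at x)"
    unfolding far_cutoff_def[abs_def] by (intro has_derivative_sum has_derivative_add flat_affine_has_derivative)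
  then have "?v \<bullet> ?v = ?D ?v"
    by (rule trans[OF frechet_derivative_grad[OF smooth_differentiable[OF smooth_far_cutoff], symmetric]
        frechet_derivative_eqI])
  also have "\<dots> \<le> (\<Sum>i\<in>(Basis::'a set). 2 * norm ?v + 2 * norm ?v)"
  proof (intro sum_mono add_mono)
    fix i :: 'a assume i: "i \<in> Basis"
    have "\<bar>flat (flat_deriv 1) t * (?v \<bullet> i)\<bar> \<le> 2 * norm ?v" for t
      unfolding abs_mult using flat_1_deriv_bound[of t] Basis_le_norm[OF i, of ?v] by (intro mult_mono) auto
    then show "flat (flat_deriv 1) (x \<bullet> i + - R) * (?v \<bullet> i) \<le> 2 * norm ?v"
      "flat (flat_deriv 1) (x \<bullet> - i + - R) * (?v \<bullet> - i) \<le> 2 * norm ?v"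
      by (auto simp: abs_le_iff)
  qed
  also have "\<dots> = 4 * DIM('a) * norm ?v" by simp
  finally have "norm ?v * norm ?v \<le> 4 * DIM('a) * norm ?v" by (simp add: norm_eq_sqrt_inner)
  then show ?thesis by (cases "norm ?v = 0") auto
qed

lemma pint_grad_far_cutoff_mult:
  assumes t: "test_fun \<Omega> (\<phi> :: 'a::euclidean_space \<Rightarrow> real)" and p: "p > 0"
  shows "pint lborel p (grad (\<lambda>x. far_cutoff R x * \<phi> x))
    \<le> 2 powr p * (4 * DIM('a)) powr p * (pint lborel p \<phi> + pint lborel p (grad \<phi>))"
proof -
  have cR: "ccont (\<lambda>x. far_cutoff R x * \<phi> x)" "test_fun \<Omega> (\<lambda>x. far_cutoff R x * \<phi> x)"
    using test_fun_mult_smooth[OF t smooth_far_cutoff] ccont_test by auto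
  let ?k = "4 * real DIM('a)"
  have pw: "norm (grad (\<lambda>x. far_cutoff R x * \<phi> x) x) powr p
     \<le> 2 powr p * ?k powr p * (norm (\<phi> x) powr p + norm (grad \<phi> x) powr p)" for x
  proof -
    have "norm (grad (\<lambda>x. far_cutoff R x * \<phi> x) x) \<le> norm (far_cutoff R x *\<^sub>R grad \<phi> x) + norm (\<phi> x *\<^sub>R grad (far_cutoff R) x)"
      unfolding grad_mult[OF smooth_far_cutoff test_fun_smooth[OF t]] by (rule norm_triangle_ineq)
    also have "\<dots> \<le> ?k * norm (grad \<phi> x) + ?k * norm (\<phi> x)"
    proof (intro add_mono)
      have "\<bar>far_cutoff R x\<bar> \<le> ?k" using far_cutoff_bounds[of R x] by simp
      then show "norm (far_cutoff R x *\<^sub>R grad \<phi> x) \<le> ?k * norm (grad \<phi> x)"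
        unfolding norm_scaleR by (rule mult_right_mono) simp
      have "norm (grad (far_cutoff R) x) * \<bar>\<phi> x\<bar> \<le> ?k * \<bar>\<phi> x\<bar>"
        by (intro mult_right_mono) (use norm_grad_far_cutoff[of R x] in auto)
      then show "norm (\<phi> x *\<^sub>R grad (far_cutoff R) x) \<le> ?k * norm (\<phi> x)"
        by (simp add: mult.commute)
    qed
    finally have "norm (grad (\<lambda>x. far_cutoff R x * \<phi> x) x) powr p \<le> (?k * (norm (\<phi> x) + norm (grad \<phi> x))) powr p"
      using p by (intro powr_mono2) (auto simp: algebra_simps)
    also have "\<dots> = ?k powr p * (norm (\<phi> x) + norm (grad \<phi> x)) powr p" by (simp add: powr_mult)
    also have "\<dots> \<le> ?k powr p * (2 powr p * (norm (\<phi> x) powr p + norm (grad \<phi> x) powr p))"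
      using p by (intro mult_left_mono powr_add_le) auto
    finally show ?thesis by (simp add: mult_ac)
  qed
  have I: "integrable lborel (\<lambda>x. norm (\<phi> x) powr p)" "integrable lborel (\<lambda>x. norm (grad \<phi> x) powr p)"
    using ccont_inLp[OF ccont_test[OF t] p] ccont_inLp[OF ccont_test_grad[OF t] p] by (auto simp: inLp_def)
  have "pint lborel p (grad (\<lambda>x. far_cutoff R x * \<phi> x))
    \<le> (\<integral>x. 2 powr p * ?k powr p * (norm (\<phi> x) powr p + norm (grad \<phi> x) powr p) \<partial>lborel)"
    unfolding pint_def using I ccont_inLp[OF ccont_test_grad[OF cR(2)] p]
    by (intro integral_mono pw) (auto simp: inLp_def)
  also have "\<dots> = 2 powr p * ?k powr p * (pint lborel p \<phi> + pint lborel p (grad \<phi>))"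
    using I by (simp add: pint_def)
  finally show ?thesis by simp
qed

text \<open>Split \<phi> into its average over unit balls and the error. The error is bounded in L^p
  by the energy through translations. The average is bounded both in L^q and pointwise, hence in L^p
  by interpolation; the result is a multiple of Q^(p/q), which admissibility bounds by the energy to
  the first power.\<close>

lemma Poincare_Lp:
  fixes \<Omega> :: "'a::euclidean_space set"
  assumes q: "q \<ge> 1" and qp: "q < p" and C0: "C > 0"
    and C: "\<And>\<phi>. test_fun \<Omega> \<phi> \<Longrightarrow> pint lborel q \<phi> \<le> C * pint lborel p (grad \<phi>) powr (q/p)"
  obtains D where "D > 0" "\<And>\<phi>. test_fun \<Omega> \<phi> \<Longrightarrow> pint lborel p \<phi> \<le> D * pint lborel p (grad \<phi>)"
proof -
  define v where "v = measure lborel (cball (0::'a) 1)"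
  have v: "v > 0" using uniform_cball(2)[of 1, where 'a='a] by (simp add: v_def)
  have p: "p \<ge> 1" "p > 0" using q qp by auto
  define D where "D = 2 powr p * (1 + (1 / v) powr ((p - q)/q) * C powr (p/q))"
  have D0: "D > 0" unfolding D_def by (intro mult_pos_pos add_pos_nonneg) auto
  have "pint lborel p \<phi> \<le> D * pint lborel p (grad \<phi>)" if t: "test_fun \<Omega> \<phi>" for \<phi>
  proof -
    note c = ccont_test[OF t]
    define P where "P = pint lborel p (grad \<phi>)"
    define Q where "Q = pint lborel q \<phi>"
    have P0: "P \<ge> 0" and Q0: "Q \<ge> 0" by (simp_all add: P_def Q_def pint_nonneg)
    have QP: "Q powr (p/q) \<le> C powr (p/q) * P"
    proof -
      have "Q powr (p/q) \<le> (C * P powr (q/p)) powr (p/q)"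
        using C[OF t] p q Q0 by (intro powr_mono2) (auto simp: P_def Q_def)
      then show ?thesis using C0 P0 q p by (simp add: powr_mult powr_powr)
    qed
    have diff: "inLp lborel p (\<lambda>x. \<phi> x - avg 1 \<phi> x)" "pint lborel p (\<lambda>x. \<phi> x - avg 1 \<phi> x) \<le> P"
      using avg_diff_Lp[of 1 p \<Omega> \<phi>] p t by (auto simp: P_def)
    note aq = avg_Lq[of 1 q \<phi>, OF _ q c]
    \<comment> \<open>The interpolation: the power p splits into p - q and q, and the pointwise
      bound on averages controls the factor with exponent p - q.\<close>
    have pw: "\<bar>avg 1 \<phi> x\<bar> powr p \<le> (Q / v) powr ((p - q)/q) * \<bar>avg 1 \<phi> x\<bar> powr q" for x
    proof -
      have "(\<bar>avg 1 \<phi> x\<bar> powr q) powr ((p - q)/q) \<le> (Q / v) powr ((p - q)/q)"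
        using avg_pointwise[of 1 q \<phi> x] q qp c by (intro powr_mono2) (auto simp: Q_def v_def)
      then have "\<bar>avg 1 \<phi> x\<bar> powr (p - q) \<le> (Q / v) powr ((p - q)/q)" using q by (simp add: powr_powr)
      then have "\<bar>avg 1 \<phi> x\<bar> powr (p - q) * \<bar>avg 1 \<phi> x\<bar> powr q \<le> (Q / v) powr ((p - q)/q) * \<bar>avg 1 \<phi> x\<bar> powr q"
        by (intro mult_right_mono) auto
      then show ?thesis by (simp flip: powr_add)
    qed
    have i: "integrable lborel (\<lambda>x. (Q / v) powr ((p - q)/q) * \<bar>avg 1 \<phi> x\<bar> powr q)"
      using aq(1) by (auto simp: inLp_def)
    have ip: "inLp lborel p (avg 1 \<phi>)"
      using aq(1) unfolding inLp_def
      by (auto intro!: Bochner_Integration.integrable_bound[OF i] simp: pw)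
    have "pint lborel p (avg 1 \<phi>) \<le> (\<integral>x. (Q / v) powr ((p - q)/q) * \<bar>avg 1 \<phi> x\<bar> powr q \<partial>lborel)"
      unfolding pint_def using ip i pw by (intro integral_mono) (auto simp: inLp_def)
    also have "\<dots> = (Q / v) powr ((p - q)/q) * pint lborel q (avg 1 \<phi>)" by (simp add: pint_def)
    also have "\<dots> \<le> (Q / v) powr ((p - q)/q) * Q"
      using aq(2) by (intro mult_left_mono) (auto simp: Q_def)
    also have "\<dots> = (1 / v) powr ((p - q)/q) * Q powr (p/q)"
      using v Q0 q by (cases "Q = 0") (auto simp: powr_divide diff_divide_distrib powr_diff)
    also have "\<dots> \<le> (1 / v) powr ((p - q)/q) * (C powr (p/q) * P)" by (intro mult_left_mono QP) auto
    finally have a: "pint lborel p (avg 1 \<phi>) \<le> (1 / v) powr ((p - q)/q) * (C powr (p/q) * P)" .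
    have "pint lborel p \<phi> = pint lborel p (\<lambda>x. (\<phi> x - avg 1 \<phi> x) + avg 1 \<phi> x)" by simp
    also have "\<dots> \<le> 2 powr p * (pint lborel p (\<lambda>x. \<phi> x - avg 1 \<phi> x) + pint lborel p (avg 1 \<phi>))"
      using p by (intro pint_add_le diff ip) auto
    also have "\<dots> \<le> 2 powr p * (P + (1 / v) powr ((p - q)/q) * (C powr (p/q) * P))"
      using diff a by (intro mult_left_mono add_mono) auto
    also have "\<dots> = D * P" by (simp add: D_def algebra_simps)
    finally show ?thesis by (simp add: P_def)
  qed
  with D0 that show thesis by blast
qed

text \<open>The cut-off function vanishes on the inner box, so the improved constant applies to it,
  and outside the larger box it is comparable to \<phi>. Its energy involves \<phi>
  undifferentiated; the L^p Poincare inequality bounds that part by the energy of \<phi>.\<close>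

lemma tail_estimate:
  fixes \<Omega> :: "'a::euclidean_space set"
  assumes q: "q \<ge> 1" and qp: "q < p" and C0: "C > 0"
    and C: "\<And>\<phi>. test_fun \<Omega> \<phi> \<Longrightarrow> pint lborel q \<phi> \<le> C * pint lborel p (grad \<phi>) powr (q/p)"
    and \<epsilon>: "\<epsilon> > 0"
  obtains R where "R > 0" "\<And>\<phi>. test_fun \<Omega> \<phi> \<Longrightarrow>
    (\<integral>x. indicator (- origin_box R) x * \<bar>\<phi> x\<bar> powr q \<partial>lborel) \<le> \<epsilon> * pint lborel p (grad \<phi>) powr (q/p)"
proof -
  have p: "p > 0" using q qp by simp
  obtain D where D: "D > 0" "\<And>\<phi>. test_fun \<Omega> \<phi> \<Longrightarrow> pint lborel p \<phi> \<le> D * pint lborel p (grad \<phi>)"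
    using Poincare_Lp[OF q qp C0 C] by blast
  define k where "k = 2 powr p * (4 * real DIM('a)) powr p * (D + 1)"
  have k: "k > 0" using D(1) by (simp add: k_def)
  \<comment> \<open>Compensates both losses: the factor exp 1 from the lower bound of the cutoff,
    and k from the energy of the product. Since k is independent of R, the radius may be chosen
    afterwards.\<close>
  define \<delta> where "\<delta> = \<epsilon> / (exp 1 powr q * k powr (q/p))"
  have \<delta>: "\<delta> > 0" using \<epsilon> k by (simp add: \<delta>_def)
  obtain R where R: "R > 0" "\<And>\<phi>. test_fun \<Omega> \<phi> \<Longrightarrow> (\<And>x. x \<in> origin_box R \<Longrightarrow> \<phi> x = 0)
     \<Longrightarrow> pint lborel q \<phi> \<le> \<delta> * pint lborel p (grad \<phi>) powr (q/p)"
    using bound_improves_at_infinity[OF q qp C \<delta>] by blast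
  show thesis
  proof (rule that)
    show "R + 1 > 0" using R(1) by simp
    fix \<phi> assume t: "test_fun \<Omega> \<phi>"
    let ?\<psi> = "\<lambda>x. far_cutoff R x * \<phi> x"
    have t': "test_fun \<Omega> ?\<psi>" by (rule test_fun_mult_smooth[OF t smooth_far_cutoff])
    have pw: "indicator (- origin_box (R + 1)) x * \<bar>\<phi> x\<bar> powr q \<le> exp 1 powr q * norm (?\<psi> x) powr q" for x
    proof (cases "x \<in> origin_box (R + 1)")
      case False
      have "\<bar>\<phi> x\<bar> = exp 1 * (exp (-1) * \<bar>\<phi> x\<bar>)" by (simp flip: mult.assoc exp_add)
      also have "\<dots> \<le> exp 1 * (far_cutoff R x * \<bar>\<phi> x\<bar>)"
        using far_cutoff_ge[OF False] by (intro mult_left_mono mult_right_mono) auto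
      also have "\<dots> = exp 1 * norm (?\<psi> x)" using far_cutoff_bounds(1)[of R x] by (simp add: abs_mult)
      finally have "\<bar>\<phi> x\<bar> powr q \<le> (exp 1 * norm (?\<psi> x)) powr q" using q by (intro powr_mono2) auto
      then show ?thesis using False by (simp add: powr_mult)
    qed simp
    have I: "integrable lborel (\<lambda>x. norm (?\<psi> x) powr q)" "integrable lborel (\<lambda>x. norm (\<phi> x) powr q)"
      using ccont_inLp[OF ccont_test[OF t], of q] ccont_inLp[OF ccont_test[OF t'], of q] q by (auto simp: inLp_def)
    have "(\<integral>x. indicator (- origin_box (R + 1)) x * \<bar>\<phi> x\<bar> powr q \<partial>lborel)
      \<le> (\<integral>x. exp 1 powr q * norm (?\<psi> x) powr q \<partial>lborel)"
    proof (rule integral_mono)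
      have "open (origin_box (R + 1) :: 'a set)" by (rule open_origin_box)
      then have "integrable lborel (\<lambda>x. indicator (- origin_box (R + 1)) x *\<^sub>R (norm (\<phi> x) powr q))"
        by (intro integrable_mult_indicator I) auto
      then show "integrable lborel (\<lambda>x. indicator (- origin_box (R + 1)) x * \<bar>\<phi> x\<bar> powr q)" by simp
    qed (use I pw in auto)
    also have "\<dots> = exp 1 powr q * pint lborel q ?\<psi>" by (simp add: pint_def)
    also have "\<dots> \<le> exp 1 powr q * (\<delta> * pint lborel p (grad ?\<psi>) powr (q/p))"
      using R(2)[OF t'] far_cutoff_zero by (intro mult_left_mono) auto
    also have "\<dots> \<le> exp 1 powr q * (\<delta> * (k * pint lborel p (grad \<phi>)) powr (q/p))"
    proof (intro mult_left_mono powr_mono2 pint_nonneg)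
      have "pint lborel p (grad ?\<psi>) \<le> 2 powr p * (4 * real DIM('a)) powr p * (pint lborel p \<phi> + pint lborel p (grad \<phi>))"
        using pint_grad_far_cutoff_mult[OF t p, of R] by simp
      also have "\<dots> \<le> 2 powr p * (4 * real DIM('a)) powr p * ((D + 1) * pint lborel p (grad \<phi>))"
        using D(2)[OF t] by (intro mult_left_mono) (auto simp: algebra_simps)
      finally show "pint lborel p (grad ?\<psi>) \<le> k * pint lborel p (grad \<phi>)" by (simp add: k_def mult_ac)
    qed (use \<delta> q p in auto)
    also have "\<dots> = \<epsilon> * pint lborel p (grad \<phi>) powr (q/p)"
      using k pint_nonneg[of lborel p "grad \<phi>"] by (simp add: \<delta>_def powr_mult)
    finally show "(\<integral>x. indicator (- origin_box (R + 1)) x * \<bar>\<phi> x\<bar> powr q \<partial>lborel)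
        \<le> \<epsilon> * pint lborel p (grad \<phi>) powr (q/p)" .
  qed
qed

section \<open>Compactness\<close>

text \<open>Diagonal extraction by Tychonoff: a product of countably many compact intervals is
  sequentially compact, and the coordinates are continuous.\<close>

lemma diagonal_subsequence_bounded:
  fixes F :: "nat \<Rightarrow> nat \<Rightarrow> real"
  assumes B: "\<And>n j. \<bar>F n j\<bar> \<le> M j"
  obtains r where "strict_mono r" "\<And>j. convergent (\<lambda>n. F (r n) j)"
proof -
  let ?S = "PiE UNIV (\<lambda>j. {- M j .. M j})"
  have "compactin (product_topology (\<lambda>_::nat. euclideanreal) UNIV) ?S"
    by (simp add: compactin_PiE)
  then have "compact ?S" by (simp add: euclidean_product_topology)
  then have "seq_compact ?S" by (rule compact_imp_seq_compact)
  moreover have "\<forall>n. F n \<in> ?S" using B by (auto simp: abs_le_iff minus_le_iff)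
  ultimately obtain l r where r: "strict_mono r" "(F \<circ> r) \<longlonglongrightarrow> l"
    unfolding seq_compact_def by blast
  have "convergent (\<lambda>n. F (r n) j)" for j
  proof -
    have "continuous_on UNIV (\<lambda>f::nat \<Rightarrow> real. f j)" by (rule continuous_on_product_coordinates)
    then have "isCont (\<lambda>f::nat \<Rightarrow> real. f j) l" by (rule continuous_on_interior) simp
    from isCont_tendsto_compose[OF this r(2)] show ?thesis by (auto simp: o_def convergent_def)
  qed
  with r(1) that show thesis by blast
qed

text \<open>The averages are equi-Lipschitz, so convergence on a countable dense set spreads everywhere.\<close>
lemma averages_subsequence_convergent:
  fixes \<phi> :: "nat \<Rightarrow> 'a::euclidean_space \<Rightarrow> real"
  assumes p: "p \<ge> 1" and t: "\<And>n. test_fun \<Omega> (\<phi> n)"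
    and K: "\<And>n. pint lborel p (\<phi> n) \<le> K" and M: "\<And>n. pint lborel p (grad (\<phi> n)) \<le> M"
  obtains r where "strict_mono r" "\<And>k x. convergent (\<lambda>n. avg (1 / real (Suc k)) (\<phi> (r n)) x)"
proof -
  define v where "v k = measure lborel (cball (0::'a) (1 / real (Suc k)))" for k
  have v: "v k > 0" for k unfolding v_def by (rule uniform_cball(2)) simp
  obtain D :: "'a set" where D: "countable D" "\<And>X. open X \<Longrightarrow> X \<noteq> {} \<Longrightarrow> \<exists>d\<in>D. d \<in> X"
    using countable_dense_setE by blast
  have Dne: "D \<noteq> {}" using D(2)[of UNIV] by auto
  \<comment> \<open>Radii and points are enumerated jointly, so that one extraction serves all radii
    1/(k+1) and all points of the dense set.\<close>
  define f where "f = from_nat_into ((UNIV :: nat set) \<times> D)"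
  have rf: "range f = UNIV \<times> D"
    unfolding f_def by (rule range_from_nat_into) (use D(1) Dne in auto)
  have bnd: "\<bar>avg (1 / real (Suc k)) (\<phi> n) x\<bar> \<le> (K / v k) powr (1/p)" for k n x
    unfolding v_def by (rule avg_bound) (use p ccont_test[OF t] K in auto)
  obtain r where r: "strict_mono r"
    "\<And>j. convergent (\<lambda>n. avg (1 / real (Suc (fst (f j)))) (\<phi> (r n)) (snd (f j)))"
    using diagonal_subsequence_bounded[of "\<lambda>n j. avg (1 / real (Suc (fst (f j)))) (\<phi> n) (snd (f j))"
      "\<lambda>j. (K / v (fst (f j))) powr (1/p)"] bnd by blast
  have onD: "convergent (\<lambda>n. avg (1 / real (Suc k)) (\<phi> (r n)) y)" if "y \<in> D" for k y
  proof -
    have "(k, y) \<in> range f" using that rf by simp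
    then obtain j where "f j = (k, y)" by (metis imageE)
    then show ?thesis using r(2)[of j] by simp
  qed
  have "Cauchy (\<lambda>n. avg (1 / real (Suc k)) (\<phi> (r n)) x)" for k x
  proof (rule metric_CauchyI)
    fix e :: real assume e: "e > 0"
    define L where "L = (M / v k) powr (1/p)"
    have L0: "L \<ge> 0" by (simp add: L_def)
    have lip: "\<bar>avg (1 / real (Suc k)) (\<phi> n) (y + h) - avg (1 / real (Suc k)) (\<phi> n) y\<bar> \<le> norm h * L" for n y h
    proof -
      have "\<bar>avg (1 / real (Suc k)) (\<phi> n) (y + h) - avg (1 / real (Suc k)) (\<phi> n) y\<bar> powr p
        \<le> norm h powr p * pint lborel p (grad (\<phi> n)) / v k"
        unfolding v_def by (rule avg_translation) (use p t in auto)
      also have "\<dots> \<le> norm h powr p * M / v k"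
        using v[of k] M by (intro divide_right_mono mult_left_mono) auto
      finally have "(\<bar>avg (1 / real (Suc k)) (\<phi> n) (y + h) - avg (1 / real (Suc k)) (\<phi> n) y\<bar> powr p) powr (1/p)
        \<le> (norm h powr p * (M / v k)) powr (1/p)"
        using p by (intro powr_mono2) auto
      moreover have "M \<ge> 0" using M[of 0] pint_nonneg order_trans by blast
      ultimately show ?thesis using p v[of k] by (simp add: L_def powr_powr powr_mult powr_divide)
    qed
    \<comment> \<open>L is a Lipschitz constant for the averages of the fixed radius, common to all
      n. Dividing by L + 1 covers L = 0 and leaves room for a strict inequality.\<close>
    define \<rho> where "\<rho> = e / (3 * (L + 1))"
    have \<rho>: "\<rho> > 0" "\<rho> * L < e / 3" using e L0 by (auto simp: \<rho>_def divide_simps algebra_simps)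
    obtain y where y: "y \<in> D" "y \<in> ball x \<rho>" using D(2)[of "ball x \<rho>"] \<rho> by auto
    have close: "\<bar>avg (1 / real (Suc k)) (\<phi> n) x - avg (1 / real (Suc k)) (\<phi> n) y\<bar> < e / 3" for n
    proof -
      have "\<bar>avg (1 / real (Suc k)) (\<phi> n) x - avg (1 / real (Suc k)) (\<phi> n) y\<bar> \<le> norm (x - y) * L"
        using lip[of n y "x - y"] by simp
      also have "\<dots> \<le> \<rho> * L" using y L0 by (intro mult_right_mono) (auto simp: dist_norm)
      finally show ?thesis using \<rho> by simp
    qed
    have "Cauchy (\<lambda>n. avg (1 / real (Suc k)) (\<phi> (r n)) y)" using onD[OF y(1)] by (rule convergent_Cauchy)
    then obtain N where N: "\<forall>m\<ge>N. \<forall>n\<ge>N. dist (avg (1 / real (Suc k)) (\<phi> (r m)) y) (avg (1 / real (Suc k)) (\<phi> (r n)) y) < e / 3"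
      using e by (meson metric_CauchyD divide_pos_pos zero_less_numeral)
    show "\<exists>N. \<forall>m\<ge>N. \<forall>n\<ge>N. dist (avg (1 / real (Suc k)) (\<phi> (r m)) x) (avg (1 / real (Suc k)) (\<phi> (r n)) x) < e"
    proof (intro exI allI impI)
      fix m n assume "N \<le> m" "N \<le> n"
      then show "dist (avg (1 / real (Suc k)) (\<phi> (r m)) x) (avg (1 / real (Suc k)) (\<phi> (r n)) x) < e"
        using N[rule_format, of m n] close[of "r m"] close[of "r n"] unfolding dist_real_def by linarith
    qed
  qed
  then have "convergent (\<lambda>n. avg (1 / real (Suc k)) (\<phi> (r n)) x)" for k x
    by (simp add: Cauchy_convergent_iff)
  with r(1) that show thesis by blast
qed

text \<open>Dominated convergence with majorant (2 B)^q on S. Finite measure of S is essential,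
  which is why the tails are removed beforehand.\<close>

lemma bounded_convergent_Lp_Cauchy:
  fixes f :: "nat \<Rightarrow> 'a \<Rightarrow> real"
  assumes q: "q \<ge> 1" and S: "S \<in> sets M" "emeasure M S < \<infinity>"
    and m[measurable]: "\<And>n. f n \<in> borel_measurable M" and B: "\<And>n x. \<bar>f n x\<bar> \<le> B"
    and c: "\<And>x. convergent (\<lambda>n. f n x)"
  shows "Lp_Cauchy M q (\<lambda>n x. indicator S x * f n x)"
proof -
  note [measurable] = S(1)
  define g where "g x = lim (\<lambda>n. f n x)" for x
  have gl: "(\<lambda>n. f n x) \<longlonglongrightarrow> g x" for x using c[of x] by (simp add: g_def convergent_LIMSEQ_iff)
  have [measurable]: "g \<in> borel_measurable M" unfolding g_def by measurable
  have gB: "\<bar>g x\<bar> \<le> B" for x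
    using LIMSEQ_le_const2[OF tendsto_rabs[OF gl]] B by blast
  have IS: "integrable M (\<lambda>x. c * indicator S x :: real)" for c
    using S by (intro integrable_mult_right integrable_real_indicator) auto
  have Lq: "inLp M q (\<lambda>x. indicator S x * h x)"
    if [measurable]: "h \<in> borel_measurable M" and hB: "\<And>x. \<bar>h x\<bar> \<le> B" for h
  proof -
    have "integrable M (\<lambda>x. norm (indicator S x * h x) powr q)"
      by (rule Bochner_Integration.integrable_bound[OF IS[of "B powr q"]])
        (use hB q in \<open>auto simp: indicator_def intro!: powr_mono2\<close>)
    then show ?thesis by (simp add: inLp_def)
  qed
  have lim: "(\<lambda>n. pint M q (\<lambda>x. indicator S x * f n x - indicator S x * g x)) \<longlonglongrightarrow> 0"
  proof -
    have "(\<lambda>n. pint M q (\<lambda>x. indicator S x * f n x - indicator S x * g x)) \<longlonglongrightarrow> (\<integral>x. 0 \<partial>M)"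
      unfolding pint_def
    proof (rule integral_dominated_convergence[where w="\<lambda>x. (2 * B) powr q * indicator S x"])
      show "AE x in M. (\<lambda>n. norm (indicator S x * f n x - indicator S x * g x) powr q) \<longlonglongrightarrow> 0"
      proof (intro AE_I2)
        fix x
        have "(\<lambda>n. norm (indicator S x * f n x - indicator S x * g x) powr q) \<longlonglongrightarrow> norm (indicator S x * g x - indicator S x * g x) powr q"
          using q by (intro tendsto_powr' tendsto_norm tendsto_diff tendsto_mult tendsto_const gl) auto
        then show "(\<lambda>n. norm (indicator S x * f n x - indicator S x * g x) powr q) \<longlonglongrightarrow> 0" using q by simp
      qed
      show "AE x in M. norm (norm (indicator S x * f n x - indicator S x * g x) powr q) \<le> (2 * B) powr q * indicator S x" for n
      proof (intro AE_I2)
        fix x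
        have "\<bar>f n x - g x\<bar> \<le> 2 * B" using B[of n x] gB[of x] by linarith
        then have "\<bar>f n x - g x\<bar> powr q \<le> (2 * B) powr q" using q by (intro powr_mono2) auto
        then show "norm (norm (indicator S x * f n x - indicator S x * g x) powr q) \<le> (2 * B) powr q * indicator S x"
          by (simp add: indicator_def)
      qed
    qed (use IS in auto)
    then show ?thesis by simp
  qed
  show ?thesis
    by (rule Lp_convergent_Cauchy[OF _ _ lim]) (use q in \<open>auto intro!: inLp_diff Lq simp: B gB\<close>)
qed

text \<open>Differences of members of the sequence are again test functions of bounded energy, so
  every estimate applies to them. Outside a large box the tail estimate suffices; inside, the
  averages converge boundedly, and the error of averaging is small uniformly in the indices. The
  choices depend on each other in the order box, \<delta>, radius, index.\<close>

lemma Rellich_Lq: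
  fixes \<Omega> :: "'a::euclidean_space set" and \<phi> :: "nat \<Rightarrow> 'a \<Rightarrow> real"
  assumes q: "q \<ge> 1" and qp: "q < p" and C0: "C > 0"
    and C: "\<And>\<phi>. test_fun \<Omega> \<phi> \<Longrightarrow> pint lborel q \<phi> \<le> C * pint lborel p (grad \<phi>) powr (q/p)"
    and t: "\<And>n. test_fun \<Omega> (\<phi> n)" and M: "\<And>n. pint lborel p (grad (\<phi> n)) \<le> M"
  obtains r where "strict_mono r" "Lp_Cauchy lborel q (\<lambda>n. \<phi> (r n))"
proof -
  have p: "p \<ge> 1" "p > 0" using q qp by auto
  have M0: "M \<ge> 0" using M[of 0] pint_nonneg order_trans by blast
  obtain D where D: "D > 0" "\<And>\<phi>. test_fun \<Omega> \<phi> \<Longrightarrow> pint lborel p \<phi> \<le> D * pint lborel p (grad \<phi>)"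
    using Poincare_Lp[OF q qp C0 C] by blast
  have K: "pint lborel p (\<phi> n) \<le> D * M" for n
    using D(2)[OF t] mult_left_mono[OF M, of D] D(1) by (meson less_imp_le order_trans)
  obtain r where r: "strict_mono r" "\<And>k x. convergent (\<lambda>n. avg (1 / real (Suc k)) (\<phi> (r n)) x)"
    using averages_subsequence_convergent[of p \<Omega> \<phi> "D * M" M] p t K M by blast
  define M2 where "M2 = 2 powr p * (M + M)"
  have M20: "M2 \<ge> 0" using M0 by (simp add: M2_def)
  define w where "w a b x = \<phi> (r a) x - \<phi> (r b) x" for a b x
  have tw: "test_fun \<Omega> (w a b)" for a b unfolding w_def by (intro test_fun_diff t)
  have Mw: "pint lborel p (grad (w a b)) \<le> M2" for a b
  proof -
    have "grad (w a b) = (\<lambda>x. grad (\<phi> (r a)) x - grad (\<phi> (r b)) x)"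
      unfolding w_def using grad_diff[OF test_fun_smooth[OF t] test_fun_smooth[OF t]] by blast
    then have "pint lborel p (grad (w a b)) \<le> 2 powr p * (pint lborel p (grad (\<phi> (r a))) + pint lborel p (grad (\<phi> (r b))))"
      using p by (simp only:) (intro pint_diff_le ccont_inLp ccont_test_grad[OF t]; simp)
    also have "\<dots> \<le> M2" unfolding M2_def by (intro mult_left_mono add_mono M) auto
    finally show ?thesis .
  qed
  have "Lp_Cauchy lborel q (\<lambda>n. \<phi> (r n))"
    unfolding Lp_Cauchy_def
  proof (intro allI impI)
    fix e :: real assume e: "e > 0"
    \<comment> \<open>The budget is e/4 for the tail and three times e/8 inside the box. Adding 1
      keeps the denominator positive and the tail bound strict even if \<open>M2\<close> is
      zero.\<close>
    define \<epsilon> where "\<epsilon> = e / (4 * (M2 powr (q/p) + 1))"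
    have \<epsilon>: "\<epsilon> > 0" using e by (simp add: \<epsilon>_def add_nonneg_pos)
    obtain R where R: "R > 0" "\<And>\<phi>. test_fun \<Omega> \<phi> \<Longrightarrow>
      (\<integral>x. indicator (- origin_box R) x * \<bar>\<phi> x\<bar> powr q \<partial>lborel) \<le> \<epsilon> * pint lborel p (grad \<phi>) powr (q/p)"
      using tail_estimate[OF q qp C0 C \<epsilon>] by blast
    define S :: "'a set" where "S = origin_box R"
    have S[measurable]: "S \<in> sets borel" unfolding S_def by (rule borel_open[OF open_origin_box])
    have Sfin: "emeasure lborel S < \<infinity>" unfolding S_def origin_box_eq by (rule emeasure_bounded_finite) simp
    define m where "m = measure lborel S"
    have m0: "m \<ge> 0" by (simp add: m_def)
    have tail: "(\<integral>x. indicator (- S) x * \<bar>w a b x\<bar> powr q \<partial>lborel) < e / 4" for a b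
    proof -
      have "(\<integral>x. indicator (- S) x * \<bar>w a b x\<bar> powr q \<partial>lborel) \<le> \<epsilon> * pint lborel p (grad (w a b)) powr (q/p)"
        unfolding S_def by (rule R(2)[OF tw])
      also have "\<dots> \<le> \<epsilon> * M2 powr (q/p)"
        using \<epsilon> q p by (intro mult_left_mono powr_mono2 pint_nonneg Mw) auto
      also have "\<dots> < \<epsilon> * (M2 powr (q/p) + 1)" using \<epsilon> by (intro mult_strict_left_mono) auto
      also have "\<dots> = e / 4"
      proof -
        have "\<epsilon> * X = e / 4" if "\<epsilon> = e / (4 * X)" "X > 0" for X using that by simp
        from this[OF \<epsilon>_def] show ?thesis by (simp add: add_nonneg_pos)
      qed
      finally show ?thesis .
    qed
    \<comment> \<open>Chosen after the box, so that \<delta> times its volume m, with the factor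
      2^q, stays within e/8.\<close>
    define \<delta> where "\<delta> = e / (8 * 2 powr q * (m + 1))"
    have \<delta>: "\<delta> > 0" using e m0 by (simp add: \<delta>_def)
    have \<delta>m: "2 powr q * (\<delta> * m) \<le> e / 8"
    proof -
      have "2 powr q * (\<delta> * m) = (e / 8) * (m / (m + 1))" using m0 by (simp add: \<delta>_def)
      also have "\<dots> \<le> (e / 8) * 1" using e m0 by (intro mult_left_mono) auto
      finally show ?thesis by simp
    qed
    \<comment> \<open>This coefficient may be large since \<delta> is small, but it no longer
      changes; the radius of averaging is picked to make c times its p-th power less than
      e/8.\<close>
    define c where "c = 2 powr q * \<delta> powr (1 - p/q) * M2"
    have "(\<lambda>k. c * (1 / real (Suc k)) powr p) \<longlonglongrightarrow> c * 0 powr p"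
      using p LIMSEQ_Suc[OF lim_1_over_n] by (intro tendsto_mult tendsto_const tendsto_powr') auto
    then have "(\<lambda>k. c * (1 / real (Suc k)) powr p) \<longlonglongrightarrow> 0" by simp
    from order_tendstoD(2)[OF this, of "e / 8"] e
    obtain k where k: "c * (1 / real (Suc k)) powr p < e / 8" by (auto simp: eventually_sequentially)
    define \<eta> where "\<eta> = 1 / real (Suc k)"
    have \<eta>: "\<eta> > 0" by (simp add: \<eta>_def)
    have bnd: "\<bar>avg \<eta> (\<phi> n) x\<bar> \<le> (D * M / measure lborel (cball (0::'a) \<eta>)) powr (1/p)" for n x
      by (rule avg_bound[OF \<eta> p(1) ccont_test[OF t] K])
    have "Lp_Cauchy lborel q (\<lambda>n x. indicator S x * avg \<eta> (\<phi> (r n)) x)"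
    proof (rule bounded_convergent_Lp_Cauchy[OF q _ Sfin])
      show "avg \<eta> (\<phi> (r n)) \<in> borel_measurable lborel" for n
        using avg_Lq(1)[OF \<eta> q ccont_test[OF t]] by (rule inLp_measurable)
    qed (use bnd r(2) in \<open>auto simp: \<eta>_def\<close>)
    then obtain N where N: "\<And>a b. a \<ge> N \<Longrightarrow> b \<ge> N \<Longrightarrow>
        pint lborel q (\<lambda>x. indicator S x * avg \<eta> (\<phi> (r a)) x - indicator S x * avg \<eta> (\<phi> (r b)) x) < e / (8 * 2 powr q)"
      unfolding Lp_Cauchy_def using e by (metis divide_pos_pos mult_pos_pos powr_gt_zero zero_less_numeral zero_neq_numeral)
    have "pint lborel q (w a b) < e" if ab: "a \<ge> N" "b \<ge> N" for a b
    proof -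
      let ?A = "avg \<eta> (w a b)"
      note cw = ccont_test[OF tw[of a b]]
      have wq: "integrable lborel (\<lambda>x. \<bar>w a b x\<bar> powr q)" using ccont_inLp[OF cw, of q] q by (simp add: inLp_def)
      have Aeq: "?A x = avg \<eta> (\<phi> (r a)) x - avg \<eta> (\<phi> (r b)) x" for x
        unfolding w_def by (rule avg_diff[OF \<eta> ccont_test[OF t] ccont_test[OF t]])
      have dif: "inLp lborel p (\<lambda>x. w a b x - ?A x)"
        "pint lborel p (\<lambda>x. w a b x - ?A x) \<le> \<eta> powr p * M2"
        using avg_diff_Lp[OF \<eta> p(1) tw[of a b]] mult_left_mono[OF Mw[of a b], of "\<eta> powr p"]
        by (auto simp del: mult_le_cancel_left_pos intro: order_trans)
      have Aq: "integrable lborel (\<lambda>x. \<bar>?A x\<bar> powr q)" using avg_Lq(1)[OF \<eta> q cw] by (simp add: inLp_def)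
      \<comment> \<open>The averaging error is controlled in L^p but needed in L^q. With t = |w -
        avg|^q, the inequality t <= \<delta> + \<delta>^(1 - p/q) t^(p/q) lowers the exponent at the
        cost of \<delta> on the finite-measure set S.\<close>
      have pw: "indicator S x * \<bar>w a b x\<bar> powr q \<le> 2 powr q * (\<delta> * indicator S x
          + \<delta> powr (1 - p/q) * \<bar>w a b x - ?A x\<bar> powr p + indicator S x * \<bar>?A x\<bar> powr q)" for x
      proof (cases "x \<in> S")
        case True
        have "\<bar>w a b x\<bar> powr q \<le> 2 powr q * (\<bar>w a b x - ?A x\<bar> powr q + \<bar>?A x\<bar> powr q)"
          using norm_add_powr_le[of q "w a b x - ?A x" "?A x"] q by simp
        moreover have "\<bar>w a b x - ?A x\<bar> powr q \<le> \<delta> + \<delta> powr (1 - p/q) * (\<bar>w a b x - ?A x\<bar> powr q) powr (p/q)"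
          using q qp \<delta> by (intro le_eps_plus_powr) auto
        then have "\<bar>w a b x - ?A x\<bar> powr q \<le> \<delta> + \<delta> powr (1 - p/q) * \<bar>w a b x - ?A x\<bar> powr p"
          using q by (simp add: powr_powr)
        then have "2 powr q * (\<bar>w a b x - ?A x\<bar> powr q + \<bar>?A x\<bar> powr q)
          \<le> 2 powr q * (\<delta> + \<delta> powr (1 - p/q) * \<bar>w a b x - ?A x\<bar> powr p + \<bar>?A x\<bar> powr q)"
          by (intro mult_left_mono) auto
        ultimately have "\<bar>w a b x\<bar> powr q \<le> 2 powr q * (\<delta> + \<delta> powr (1 - p/q) * \<bar>w a b x - ?A x\<bar> powr p + \<bar>?A x\<bar> powr q)"
          by (meson order_trans)
        then show ?thesis using True by simp
      qed simp
      have iS: "integrable lborel (indicator S :: 'a \<Rightarrow> real)"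
        using Sfin by (intro integrable_real_indicator) auto
      have i1: "integrable lborel (\<lambda>x. indicator S x * \<bar>w a b x\<bar> powr q)"
        and i2: "integrable lborel (\<lambda>x. indicator (- S) x * \<bar>w a b x\<bar> powr q)"
        using integrable_mult_indicator[OF _ wq, of S] integrable_mult_indicator[OF _ wq, of "- S"] by auto
      have i3: "integrable lborel (\<lambda>x. indicator S x * \<bar>?A x\<bar> powr q)"
        using integrable_mult_indicator[OF _ Aq, of S] by auto
      have i4: "integrable lborel (\<lambda>x. \<bar>w a b x - ?A x\<bar> powr p)" using dif(1) by (simp add: inLp_def)
      have "(\<integral>x. indicator S x * \<bar>w a b x\<bar> powr q \<partial>lborel) \<le> (\<integral>x. 2 powr q * (\<delta> * indicator S x
          + \<delta> powr (1 - p/q) * \<bar>w a b x - ?A x\<bar> powr p + indicator S x * \<bar>?A x\<bar> powr q) \<partial>lborel)"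
        using pw i1 i3 i4 iS by (intro integral_mono) auto
      also have "\<dots> = 2 powr q * (\<delta> * m + \<delta> powr (1 - p/q) * pint lborel p (\<lambda>x. w a b x - ?A x)
          + (\<integral>x. indicator S x * \<bar>?A x\<bar> powr q \<partial>lborel))"
        using i3 i4 iS by (simp add: pint_def m_def)
      also have "\<dots> \<le> 2 powr q * (\<delta> * m + \<delta> powr (1 - p/q) * (\<eta> powr p * M2)
          + (\<integral>x. indicator S x * \<bar>?A x\<bar> powr q \<partial>lborel))"
        using dif(2) by (intro mult_left_mono add_right_mono add_left_mono) auto
      also have "\<dots> = 2 powr q * (\<delta> * m) + c * \<eta> powr p + 2 powr q * (\<integral>x. indicator S x * \<bar>?A x\<bar> powr q \<partial>lborel)"
        by (simp add: c_def algebra_simps)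
      also have "\<dots> < e / 8 + e / 8 + e / 8"
      proof (intro add_le_less_mono add_mono \<delta>m)
        show "c * \<eta> powr p \<le> e / 8" using k by (simp add: \<eta>_def)
        have "(\<integral>x. indicator S x * \<bar>?A x\<bar> powr q \<partial>lborel)
          = pint lborel q (\<lambda>x. indicator S x * avg \<eta> (\<phi> (r a)) x - indicator S x * avg \<eta> (\<phi> (r b)) x)"
          unfolding pint_def Aeq
          by (intro Bochner_Integration.integral_cong) (use q in \<open>auto simp: indicator_def\<close>)
        then have "(\<integral>x. indicator S x * \<bar>?A x\<bar> powr q \<partial>lborel) < e / (8 * 2 powr q)" using N[OF ab] by simp
        then have "2 powr q * (\<integral>x. indicator S x * \<bar>?A x\<bar> powr q \<partial>lborel) < 2 powr q * (e / (8 * 2 powr q))"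
          by (intro mult_strict_left_mono) auto
        then show "2 powr q * (\<integral>x. indicator S x * \<bar>?A x\<bar> powr q \<partial>lborel) < e / 8" by simp
      qed
      finally have inner: "(\<integral>x. indicator S x * \<bar>w a b x\<bar> powr q \<partial>lborel) < e / 8 + e / 8 + e / 8" .
      have "pint lborel q (w a b) = (\<integral>x. indicator S x * \<bar>w a b x\<bar> powr q + indicator (- S) x * \<bar>w a b x\<bar> powr q \<partial>lborel)"
        unfolding pint_def by (intro Bochner_Integration.integral_cong) (auto simp: indicator_def)
      also have "\<dots> = (\<integral>x. indicator S x * \<bar>w a b x\<bar> powr q \<partial>lborel) + (\<integral>x. indicator (- S) x * \<bar>w a b x\<bar> powr q \<partial>lborel)"
        using i1 i2 by simp
      finally show ?thesis using inner tail[of a b] e by linarith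
    qed
    then show "\<exists>N. \<forall>m\<ge>N. \<forall>n\<ge>N. pint lborel q (\<lambda>x. \<phi> (r m) x - \<phi> (r n) x) < e"
      unfolding w_def by blast
  qed
  with r(1) that show thesis by blast
qed

section \<open>Weak gradients and approximation\<close>

lemma test_fun_weak_grad:
  assumes \<Omega>: "open \<Omega>" and t: "test_fun \<Omega> \<phi>"
  shows "weak_grad \<Omega> \<phi> (grad \<phi>)"
  unfolding weak_grad_def
proof (intro allI impI ballI)
  fix \<psi> i assume \<psi>: "test_fun \<Omega> \<psi>" and i: "i \<in> (Basis :: 'a set)"
  note [measurable] = ccont_measurable[OF ccont_test[OF t]] ccont_measurable[OF ccont_test[OF \<psi>]]
    ccont_measurable[OF ccont_test_deriv[OF t]] ccont_measurable[OF ccont_test_deriv[OF \<psi>]]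
  obtain K where K: "K \<subseteq> \<Omega>" "\<And>x. x \<notin> K \<Longrightarrow> \<phi> x = 0" "\<And>x v. x \<notin> K \<Longrightarrow> frechet_derivative \<phi> (at x) v = 0"
    by (rule test_funE[OF t], rule that)
  have z: "\<phi> x = 0" "frechet_derivative \<phi> (at x) v = 0" if "x \<notin> \<Omega>" for x v
    using K that by blast+
  have "(\<integral>x. \<phi> x * frechet_derivative \<psi> (at x) i \<partial>lebesgue_on \<Omega>) = (\<integral>x. \<phi> x * frechet_derivative \<psi> (at x) i \<partial>lborel)"
    by (rule lebesgue_on_integral_lborel[OF _ \<Omega>]) (simp_all add: z)
  moreover have "(\<integral>x. frechet_derivative \<phi> (at x) i * \<psi> x \<partial>lebesgue_on \<Omega>) = (\<integral>x. frechet_derivative \<phi> (at x) i * \<psi> x \<partial>lborel)"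
    by (rule lebesgue_on_integral_lborel[OF _ \<Omega>]) (simp_all add: z)
  ultimately show "(\<integral>x. \<phi> x * frechet_derivative \<psi> (at x) i \<partial>lebesgue_on \<Omega>)
    = - (\<integral>x. (grad \<phi> x \<bullet> i) * \<psi> x \<partial>lebesgue_on \<Omega>)"
    using test_fun_weak_grad_lborel[OF t \<psi>] by (simp add: grad_inner_Basis[OF i])
qed

lemma inLp_mult_test_integrable:
  assumes \<Omega>: "open \<Omega>" and r: "r \<ge> 1" and u: "inLp (lebesgue_on \<Omega>) r u" and c: "ccont w"
  shows "integrable (lebesgue_on \<Omega>) (\<lambda>x. (u x :: real) * w x)"
proof -
  obtain B where B: "\<And>x. norm (w x) \<le> B" using ccont_bounded[OF c] by blast
  show ?thesis
    by (rule inLp_mult_integrable[OF r u ccont_lebesgue_on_integrable[OF c \<Omega>], of B]) (use B in simp)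
qed

text \<open>Functions and gradients carry separate exponents because U is only known to lie in L^q
  while its gradient lies in L^p. The exponents serve only to make the pairings with test functions
  integrable.\<close>

lemma weak_grad_add:
  assumes \<Omega>: "open \<Omega>" and e: "r \<ge> 1" "s \<ge> 1" "p \<ge> 1"
    and u: "inLp (lebesgue_on \<Omega>) r u" "weak_grad \<Omega> u g" "inLp (lebesgue_on \<Omega>) p g"
    and v: "inLp (lebesgue_on \<Omega>) s v" "weak_grad \<Omega> v h" "inLp (lebesgue_on \<Omega>) p h"
  shows "weak_grad \<Omega> (\<lambda>x. u x + v x) (\<lambda>x. g x + h x)"
  unfolding weak_grad_def
proof (intro allI impI ballI)
  fix \<psi> i assume \<psi>: "test_fun \<Omega> \<psi>" and i: "i \<in> (Basis :: 'a set)"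
  have 1: "integrable (lebesgue_on \<Omega>) (\<lambda>x. u x * frechet_derivative \<psi> (at x) i)"
    "integrable (lebesgue_on \<Omega>) (\<lambda>x. v x * frechet_derivative \<psi> (at x) i)"
    by (intro inLp_mult_test_integrable[OF \<Omega> e(1) u(1)] inLp_mult_test_integrable[OF \<Omega> e(2) v(1)] ccont_test_deriv[OF \<psi>])+
  have "inLp (lebesgue_on \<Omega>) p (\<lambda>x. g x \<bullet> i)" "inLp (lebesgue_on \<Omega>) p (\<lambda>x. h x \<bullet> i)"
    using e i u v by (auto intro!: inLp_inner)
  then have 2: "integrable (lebesgue_on \<Omega>) (\<lambda>x. (g x \<bullet> i) * \<psi> x)" "integrable (lebesgue_on \<Omega>) (\<lambda>x. (h x \<bullet> i) * \<psi> x)"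
    by (auto intro!: inLp_mult_test_integrable[OF \<Omega> e(3)] ccont_test[OF \<psi>])
  show "(\<integral>x. (u x + v x) * frechet_derivative \<psi> (at x) i \<partial>lebesgue_on \<Omega>)
    = - (\<integral>x. ((g x + h x) \<bullet> i) * \<psi> x \<partial>lebesgue_on \<Omega>)"
    using 1 2 u(2) v(2) \<psi> i unfolding weak_grad_def by (simp add: distrib_right inner_add_left)
qed

lemma pint_inner_le:
  fixes g :: "'a \<Rightarrow> 'b::euclidean_space"
  assumes "p \<ge> 0" "inLp M p g" "i \<in> Basis"
  shows "pint M p (\<lambda>x. g x \<bullet> i) \<le> pint M p g"
  unfolding pint_def using assms inLp_inner[OF assms]
  by (intro integral_mono powr_mono2) (auto simp: inLp_def Basis_le_norm)

text \<open>Both sides of the defining identity are pairings with bounded integrable weights, which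
  are continuous under L^r and L^p convergence respectively.\<close>

lemma weak_grad_limit:
  assumes \<Omega>: "open \<Omega>" and e: "r \<ge> 1" "p \<ge> 1"
    and un: "\<And>n. inLp (lebesgue_on \<Omega>) r (u n)" "\<And>n. inLp (lebesgue_on \<Omega>) p (g n)" "\<And>n. weak_grad \<Omega> (u n) (g n)"
    and v: "inLp (lebesgue_on \<Omega>) r v" "inLp (lebesgue_on \<Omega>) p h"
    and lim: "(\<lambda>n. pint (lebesgue_on \<Omega>) r (\<lambda>x. u n x - v x)) \<longlonglongrightarrow> 0"
      "(\<lambda>n. pint (lebesgue_on \<Omega>) p (\<lambda>x. g n x - h x)) \<longlonglongrightarrow> 0"
  shows "weak_grad \<Omega> v h"
  unfolding weak_grad_def
proof (intro allI impI ballI)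
  fix \<psi> i assume \<psi>: "test_fun \<Omega> \<psi>" and i: "i \<in> (Basis :: 'a set)"
  let ?M = "lebesgue_on \<Omega>"
  note c1 = ccont_test[OF \<psi>] and c2 = ccont_test_deriv[OF \<psi>, of i]
  obtain B1 where B1: "\<And>x. norm (\<psi> x) \<le> B1" using ccont_bounded[OF c1] by blast
  obtain B2 where B2: "\<And>x. norm (frechet_derivative \<psi> (at x) i) \<le> B2" using ccont_bounded[OF c2] by blast
  have l1: "(\<lambda>n. \<integral>x. u n x * frechet_derivative \<psi> (at x) i \<partial>?M) \<longlonglongrightarrow> (\<integral>x. v x * frechet_derivative \<psi> (at x) i \<partial>?M)"
    by (rule Lp_tendsto_integral_mult[OF e(1) un(1) v(1) ccont_lebesgue_on_integrable[OF c2 \<Omega>] _ lim(1)])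
      (use B2 in simp)
  have "(\<lambda>n. pint ?M p (\<lambda>x. g n x \<bullet> i - h x \<bullet> i)) \<longlonglongrightarrow> 0"
  proof (rule tendsto_sandwich[OF _ _ tendsto_const lim(2)])
    show "\<forall>\<^sub>F n in sequentially. pint ?M p (\<lambda>x. g n x \<bullet> i - h x \<bullet> i) \<le> pint ?M p (\<lambda>x. g n x - h x)"
      using e i un(2) v(2) unfolding inner_diff_left[symmetric]
      by (intro always_eventually allI pint_inner_le inLp_diff) auto
  qed (simp add: pint_nonneg)
  then have l2: "(\<lambda>n. \<integral>x. (g n x \<bullet> i) * \<psi> x \<partial>?M) \<longlonglongrightarrow> (\<integral>x. (h x \<bullet> i) * \<psi> x \<partial>?M)"
    using e i un(2) v(2) B1
    by (intro Lp_tendsto_integral_mult[OF e(2) _ _ ccont_lebesgue_on_integrable[OF c1 \<Omega>], of _ _ B1] inLp_inner) auto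
  have "(\<integral>x. u n x * frechet_derivative \<psi> (at x) i \<partial>?M) = - (\<integral>x. (g n x \<bullet> i) * \<psi> x \<partial>?M)" for n
    using un(3) \<psi> i unfolding weak_grad_def by blast
  then have "(\<lambda>n. \<integral>x. u n x * frechet_derivative \<psi> (at x) i \<partial>?M) \<longlonglongrightarrow> - (\<integral>x. (h x \<bullet> i) * \<psi> x \<partial>?M)"
    using tendsto_minus[OF l2] by simp
  with l1 show "(\<integral>x. v x * frechet_derivative \<psi> (at x) i \<partial>?M) = - (\<integral>x. (h x \<bullet> i) * \<psi> x \<partial>?M)"
    by (rule LIMSEQ_unique)
qed

lemma test_fun_inLp:
  assumes "open \<Omega>" "test_fun \<Omega> \<phi>" "r > 0"
  shows "inLp (lebesgue_on \<Omega>) r \<phi>" "inLp (lebesgue_on \<Omega>) r (grad \<phi>)"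
proof -
  have L: "inLp (lebesgue_on \<Omega>) r f" if "ccont f" for f :: "'a \<Rightarrow> 'b::euclidean_space"
    using ccont_lebesgue_on_integrable[OF that assms(1)] ccont_lebesgue_on_integrable[OF ccont_powr[OF that assms(3)] assms(1)]
    by (auto simp: inLp_def)
  show "inLp (lebesgue_on \<Omega>) r \<phi>" using L[OF ccont_test[OF assms(2)]] .
qed (use assms in \<open>simp add: inLp_def ccont_lebesgue_on_integrable[OF ccont_powr[OF ccont_test_grad]] borel_measurable_integrable[OF ccont_lebesgue_on_integrable[OF ccont_test_grad]]\<close>)

lemma wgrad_Xqp:
  assumes "Xqp \<Omega> q p u"
  shows "weak_grad \<Omega> u (wgrad \<Omega> p u)" "inLp (lebesgue_on \<Omega>) p (wgrad \<Omega> p u)" "inLp (lebesgue_on \<Omega>) q u"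
proof -
  have "\<exists>g. weak_grad \<Omega> u g \<and> Lp \<Omega> p g" using assms by (simp add: Xqp_def)
  from someI_ex[OF this] show "weak_grad \<Omega> u (wgrad \<Omega> p u)" "inLp (lebesgue_on \<Omega>) p (wgrad \<Omega> p u)"
    by (simp_all add: wgrad_def Lp_inLp)
  show "inLp (lebesgue_on \<Omega>) q u" using assms by (simp add: Xqp_def Lp_inLp)
qed

lemma wgrad_AE_eq:
  assumes \<Omega>: "open \<Omega>" and p: "p \<ge> 1" and u: "inLp (lebesgue_on \<Omega>) p g" "weak_grad \<Omega> u g"
  shows "AE x in lebesgue_on \<Omega>. wgrad \<Omega> p u x = g x" "inLp (lebesgue_on \<Omega>) p (wgrad \<Omega> p u)"
proof -
  have "\<exists>g. weak_grad \<Omega> u g \<and> Lp \<Omega> p g" using u by (auto simp: Lp_inLp)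
  from someI_ex[OF this] have "weak_grad \<Omega> u (wgrad \<Omega> p u)" and L: "inLp (lebesgue_on \<Omega>) p (wgrad \<Omega> p u)"
    by (simp_all add: wgrad_def Lp_inLp)
  then show "AE x in lebesgue_on \<Omega>. wgrad \<Omega> p u x = g x" using weak_grad_unique[OF \<Omega> p] u by blast
  show "inLp (lebesgue_on \<Omega>) p (wgrad \<Omega> p u)" by (rule L)
qed

text \<open>Frees the functional from the choice operator: any weak gradient in L^p may be
  inserted.\<close>

lemma Fqa_eq:
  assumes \<Omega>: "open \<Omega>" and p: "p \<ge> 1" and u: "inLp (lebesgue_on \<Omega>) p g" "weak_grad \<Omega> u g"
  shows "Fqa \<Omega> p q \<alpha> u = 1 / p * pint (lebesgue_on \<Omega>) p g - \<alpha> / q * pint (lebesgue_on \<Omega>) q u"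
proof -
  have "pint (lebesgue_on \<Omega>) p (wgrad \<Omega> p u) = pint (lebesgue_on \<Omega>) p g"
    using wgrad_AE_eq[OF assms] u by (intro pint_cong_AE) (auto simp: inLp_measurable)
  then show ?thesis by (simp add: Fqa_def pint_def)
qed

text \<open>The inequality is applied to differences of test functions. The parameters r and s allow
  both uses: r = q with s = q/p, and r = p with s = 1.\<close>

lemma Lp_Cauchy_of_grad_Cauchy:
  fixes \<phi> :: "nat \<Rightarrow> 'a::euclidean_space \<Rightarrow> real"
  assumes \<Omega>: "open \<Omega>" and e: "r \<ge> 1" "p \<ge> 1" and C0: "C > 0" and s: "s > 0"
    and C: "\<And>\<phi>. test_fun \<Omega> \<phi> \<Longrightarrow> pint lborel r \<phi> \<le> C * pint lborel p (grad \<phi>) powr s"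
    and t: "\<And>n. test_fun \<Omega> (\<phi> n)" and G: "Lp_Cauchy (lebesgue_on \<Omega>) p (\<lambda>n. grad (\<phi> n))"
  shows "Lp_Cauchy (lebesgue_on \<Omega>) r \<phi>"
  unfolding Lp_Cauchy_def
proof (intro allI impI)
  fix \<epsilon> :: real assume \<epsilon>: "\<epsilon> > 0"
  define d where "d = (\<epsilon> / C) powr (1/s)"
  have d: "d > 0" using \<epsilon> C0 by (simp add: d_def)
  obtain N where N: "\<And>a b. a \<ge> N \<Longrightarrow> b \<ge> N \<Longrightarrow> pint (lebesgue_on \<Omega>) p (\<lambda>x. grad (\<phi> a) x - grad (\<phi> b) x) < d"
    using G d unfolding Lp_Cauchy_def by meson
  have "pint (lebesgue_on \<Omega>) r (\<lambda>x. \<phi> a x - \<phi> b x) < \<epsilon>" if "a \<ge> N" "b \<ge> N" for a b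
  proof -
    have td: "test_fun \<Omega> (\<lambda>x. \<phi> a x - \<phi> b x)" by (intro test_fun_diff t)
    have gd: "grad (\<lambda>x. \<phi> a x - \<phi> b x) = (\<lambda>x. grad (\<phi> a) x - grad (\<phi> b) x)"
      using grad_diff[OF test_fun_smooth[OF t] test_fun_smooth[OF t]] by blast
    have "pint (lebesgue_on \<Omega>) r (\<lambda>x. \<phi> a x - \<phi> b x) \<le> C * pint (lebesgue_on \<Omega>) p (grad (\<lambda>x. \<phi> a x - \<phi> b x)) powr s"
      using C[OF td] by (simp add: test_fun_pint[OF \<Omega> td])
    also have "\<dots> < C * d powr s"
      unfolding gd using N[OF that] s C0 pint_nonneg
      by (intro mult_strict_left_mono powr_less_mono2) auto
    also have "\<dots> = \<epsilon>" using C0 \<epsilon> s by (simp add: d_def powr_powr)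
    finally show ?thesis .
  qed
  then show "\<exists>N. \<forall>m\<ge>N. \<forall>n\<ge>N. pint (lebesgue_on \<Omega>) r (\<lambda>x. \<phi> m x - \<phi> n x) < \<epsilon>" by blast
qed

text \<open>Convergent gradients make the sequence Cauchy in L^q as well, and its limit there agrees
  almost everywhere with the limit in L^p. This reconciles the L^p closure in \<open>W0\<close> with
  a functional living on L^q.\<close>

lemma test_fun_Lq_limit:
  fixes \<Omega> :: "'a::euclidean_space set"
  assumes \<Omega>: "open \<Omega>" and q: "q \<ge> 1" and qp: "q < p" and C0: "C > 0"
    and C: "\<And>\<phi>. test_fun \<Omega> \<phi> \<Longrightarrow> pint lborel q \<phi> \<le> C * pint lborel p (grad \<phi>) powr (q/p)"
    and w: "inLp (lebesgue_on \<Omega>) p v" "inLp (lebesgue_on \<Omega>) p g" "\<And>n. test_fun \<Omega> (\<phi> n)"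
      "(\<lambda>n. pint (lebesgue_on \<Omega>) p (\<lambda>x. \<phi> n x - v x)) \<longlonglongrightarrow> 0"
      "(\<lambda>n. pint (lebesgue_on \<Omega>) p (\<lambda>x. grad (\<phi> n) x - g x)) \<longlonglongrightarrow> 0"
  shows "inLp (lebesgue_on \<Omega>) q v" "(\<lambda>n. pint (lebesgue_on \<Omega>) q (\<lambda>x. \<phi> n x - v x)) \<longlonglongrightarrow> 0"
proof -
  let ?M = "lebesgue_on \<Omega>"
  have p: "p \<ge> 1" "p > 0" using q qp by auto
  have "Lp_Cauchy ?M p (\<lambda>n. grad (\<phi> n))"
    using p by (intro Lp_convergent_Cauchy[OF _ _ w(5)] inLp_diff w(2) test_fun_inLp(2)[OF \<Omega> w(3)]) auto
  then have "Lp_Cauchy ?M q \<phi>"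
    using Lp_Cauchy_of_grad_Cauchy[OF \<Omega> q p(1) C0 _ C w(3)] q p by simp
  then obtain v' where v': "inLp ?M q v'" "(\<lambda>n. pint ?M q (\<lambda>x. \<phi> n x - v' x)) \<longlonglongrightarrow> 0"
    using Lp_complete[OF q, of ?M \<phi>] test_fun_inLp(1)[OF \<Omega> w(3)] q by auto
  have ae: "AE x in ?M. v x = v' x"
    using p q by (intro Lp_limits_AE_eq[of p q ?M \<phi>] inLp_diff test_fun_inLp(1)[OF \<Omega> w(3)] w(1) v' w(4)) auto
  note [measurable] = inLp_measurable[OF w(1)] inLp_measurable[OF v'(1)]
    inLp_measurable[OF test_fun_inLp(1)[OF \<Omega> w(3) p(2)]]
  have "integrable ?M (\<lambda>x. norm (v x) powr q)"
    by (rule integrable_cong_AE_imp[of _ "\<lambda>x. norm (v' x) powr q"])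
      (use v'(1) ae in \<open>auto simp: inLp_def elim!: eventually_mono\<close>)
  then show vq: "inLp ?M q v" by (simp add: inLp_def)
  have "pint ?M q (\<lambda>x. \<phi> n x - v x) = pint ?M q (\<lambda>x. \<phi> n x - v' x)" for n
    by (rule pint_cong_AE) (use ae in \<open>auto elim!: eventually_mono\<close>)
  then show "(\<lambda>n. pint ?M q (\<lambda>x. \<phi> n x - v x)) \<longlonglongrightarrow> 0" using v'(2) by simp
qed

lemma W0_approx:
  fixes \<Omega> :: "'a::euclidean_space set"
  assumes \<Omega>: "open \<Omega>" and q: "q \<ge> 1" and qp: "q < p" and C0: "C > 0"
    and C: "\<And>\<phi>. test_fun \<Omega> \<phi> \<Longrightarrow> pint lborel q \<phi> \<le> C * pint lborel p (grad \<phi>) powr (q/p)"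
    and v: "W0 \<Omega> p v"
  obtains \<phi> g where "\<And>n. test_fun \<Omega> (\<phi> n)" "weak_grad \<Omega> v g" "inLp (lebesgue_on \<Omega>) p g"
    "inLp (lebesgue_on \<Omega>) q v"
    "(\<lambda>n. pint (lebesgue_on \<Omega>) q (\<lambda>x. \<phi> n x - v x)) \<longlonglongrightarrow> 0"
    "(\<lambda>n. pint (lebesgue_on \<Omega>) p (\<lambda>x. grad (\<phi> n) x - g x)) \<longlonglongrightarrow> 0"
proof -
  obtain g \<phi> where w: "inLp (lebesgue_on \<Omega>) p v" "weak_grad \<Omega> v g" "inLp (lebesgue_on \<Omega>) p g" "\<And>n. test_fun \<Omega> (\<phi> n)"
    "(\<lambda>n. pint (lebesgue_on \<Omega>) p (\<lambda>x. \<phi> n x - v x)) \<longlonglongrightarrow> 0"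
    "(\<lambda>n. pint (lebesgue_on \<Omega>) p (\<lambda>x. grad (\<phi> n) x - g x)) \<longlonglongrightarrow> 0"
    using v unfolding W0_def Lp_inLp pint_def by auto
  with test_fun_Lq_limit[OF \<Omega> q qp C0 C w(1,3-6)] that show thesis by blast
qed

text \<open>The sequential statement turned into an \<epsilon>-\<delta> one by contradiction. It is
  wanted for midpoints, which are indexed by two numbers and do not form a sequence.\<close>

lemma pint_continuous_eps:
  fixes g :: "'a \<Rightarrow> 'b::euclidean_space"
  assumes p: "p \<ge> 1" and g: "inLp M p g" and e: "e > 0"
  obtains d where "d > 0" "\<And>f. inLp M p f \<Longrightarrow> pint M p (\<lambda>x. f x - g x) < d \<Longrightarrow> \<bar>pint M p f - pint M p g\<bar> < e"
proof (rule ccontr)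
  note thesisI = that
  assume nt: "\<not> thesis"
  have "\<exists>f. inLp M p f \<and> pint M p (\<lambda>x. f x - g x) < d \<and> \<not> \<bar>pint M p f - pint M p g\<bar> < e" if d: "d > 0" for d
    using thesisI[OF d] nt by blast
  then have "\<exists>f. inLp M p f \<and> pint M p (\<lambda>x. f x - g x) < 1 / real (Suc n) \<and> \<not> \<bar>pint M p f - pint M p g\<bar> < e" for n
    by simp
  then obtain f where f: "\<And>n. inLp M p (f n)" "\<And>n. pint M p (\<lambda>x. f n x - g x) < 1 / real (Suc n)"
    "\<And>n. \<not> \<bar>pint M p (f n) - pint M p g\<bar> < e" by metis
  have "(\<lambda>n. pint M p (\<lambda>x. f n x - g x)) \<longlonglongrightarrow> 0"
    by (rule tendsto_sandwich[OF _ _ tendsto_const LIMSEQ_Suc[OF lim_1_over_n]])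
      (intro always_eventually allI pint_nonneg less_imp_le[OF f(2)])+
  from pint_tendsto[OF p f(1) g this] have "(\<lambda>n. pint M p (f n)) \<longlonglongrightarrow> pint M p g" .
  from LIMSEQ_D[OF this e] show False using f(3) by auto
qed

text \<open>Serves as a substitute for weak compactness: convergence of the midpoint defect to zero already
  forces strong convergence.\<close>
lemma Lp_Cauchy_uniform_convexity:
  fixes G :: "nat \<Rightarrow> 'a \<Rightarrow> 'b::euclidean_space"
  assumes p: "p > 1" and G: "\<And>n. inLp M p (G n)" and B: "\<And>n. pint M p (G n) \<le> B"
    and mid: "\<And>e. e > 0 \<Longrightarrow> \<exists>N. \<forall>a\<ge>N. \<forall>b\<ge>N.
      (pint M p (G a) + pint M p (G b)) / 2 - pint M p (\<lambda>x. (1/2) *\<^sub>R (G a x + G b x)) < e"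
  shows "Lp_Cauchy M p G"
  unfolding Lp_Cauchy_def
proof (intro allI impI)
  fix e :: real assume e: "e > 0"
  have B0: "B \<ge> 0" using B[of 0] pint_nonneg order_trans by blast
  \<comment> \<open>Makes the \<delta>-term at most e/2, uniformly in the indices. Only then is C
    determined; a midpoint defect below e / (2 (C + 1)) makes the remaining term strictly smaller
    than e/2.\<close>
  define \<delta> where "\<delta> = e / (4 * (B + 1))"
  have \<delta>: "\<delta> > 0" using e B0 by (simp add: \<delta>_def)
  have \<delta>B: "\<delta> * (B + B) \<le> e / 2" using e B0 by (simp add: \<delta>_def divide_simps)
  obtain C where C: "C \<ge> 0" "\<And>a b::'b. norm (a - b) powr p \<le> \<delta> * (norm a powr p + norm b powr p)
      + C * ((norm a powr p + norm b powr p) / 2 - norm ((1/2) *\<^sub>R (a + b)) powr p)"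
    using uniform_convexity_pointwise[OF p \<delta>] by blast
  have "e / (2 * (C + 1)) > 0" using e C(1) by simp
  from mid[OF this] obtain N where N: "\<And>a b. a \<ge> N \<Longrightarrow> b \<ge> N \<Longrightarrow>
      (pint M p (G a) + pint M p (G b)) / 2 - pint M p (\<lambda>x. (1/2) *\<^sub>R (G a x + G b x)) < e / (2 * (C + 1))" by blast
  have "pint M p (\<lambda>x. G a x - G b x) < e" if ab: "a \<ge> N" "b \<ge> N" for a b
  proof -
    have p0: "p \<ge> 0" using p by simp
    have i: "integrable M (\<lambda>x. norm (G n x) powr p)" for n using G by (simp add: inLp_def)
    have im: "integrable M (\<lambda>x. norm ((1/2) *\<^sub>R (G a x + G b x)) powr p)"
      using inLp_scale[OF inLp_add[OF p0 G G], of "1/2" a b] unfolding inLp_def by simp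
    have id: "integrable M (\<lambda>x. norm (G a x - G b x) powr p)"
      using inLp_diff[OF p0 G G, of a b] unfolding inLp_def by simp
    have "pint M p (\<lambda>x. G a x - G b x) \<le> (\<integral>x. \<delta> * (norm (G a x) powr p + norm (G b x) powr p)
      + C * ((norm (G a x) powr p + norm (G b x) powr p) / 2 - norm ((1/2) *\<^sub>R (G a x + G b x)) powr p) \<partial>M)"
      unfolding pint_def using i im
      by (intro integral_mono id C(2) Bochner_Integration.integrable_add integrable_mult_right
          Bochner_Integration.integrable_diff integrable_divide)
    also have "\<dots> = \<delta> * (pint M p (G a) + pint M p (G b)) + C * ((pint M p (G a) + pint M p (G b)) / 2 - pint M p (\<lambda>x. (1/2) *\<^sub>R (G a x + G b x)))"
      unfolding pint_def using i im
      by (simp only: Bochner_Integration.integral_add integral_mult_right_zero Bochner_Integration.integral_diff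
         integral_divide_zero Bochner_Integration.integrable_add integrable_mult_right
         Bochner_Integration.integrable_diff integrable_divide)
    also have "\<dots> \<le> \<delta> * (B + B) + C * (e / (2 * (C + 1)))"
      using \<delta> C(1) B N[OF ab] by (intro add_mono mult_left_mono) auto
    also have "\<dots> < e"
    proof -
      have "C * (e / (2 * (C + 1))) = (e / 2) * (C / (C + 1))" using C(1) by simp
      also have "\<dots> < (e / 2) * 1" using e C(1) by (intro mult_strict_left_mono) auto
      finally show ?thesis using \<delta>B by linarith
    qed
    finally show ?thesis .
  qed
  then show "\<exists>N. \<forall>m\<ge>N. \<forall>n\<ge>N. pint M p (\<lambda>x. G m x - G n x) < e" by blast
qed

section \<open>Existence of minimizers\<close>

text \<open>The line c P overtakes b P^s at P0 = (b/c)^(1/(1-s)), and below P0 the power is bounded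
  by its value there. This yields coercivity, with s = q/p.\<close>

lemma powr_absorbed_by_linear:
  fixes s :: real
  assumes s: "0 < s" "s < 1" and c: "c > 0" and b: "b \<ge> 0"
  obtains K where "\<And>P. P \<ge> 0 \<Longrightarrow> b * P powr s \<le> c * P + K"
proof -
  define P0 where "P0 = (b / c) powr (1 / (1 - s))"
  have "b * P powr s \<le> c * P + b * P0 powr s" if P: "P \<ge> 0" for P
  proof (cases "P \<le> P0")
    case True
    then have "b * P powr s \<le> b * P0 powr s" using P s b by (intro mult_left_mono powr_mono2) auto
    moreover have "0 \<le> c * P" using c P by simp
    ultimately show ?thesis by linarith
  next
    case False
    have P0: "P0 \<ge> 0" by (simp add: P0_def)
    have Ppos: "P > 0" using False P0 by simp
    have "b / c = P0 powr (1 - s)" using s b c by (simp add: P0_def powr_powr)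
    also have "\<dots> \<le> P powr (1 - s)" using False P0 s by (intro powr_mono2) auto
    finally have "b \<le> c * P powr (1 - s)" using c by (simp add: divide_simps mult.commute)
    then have "b * P powr s \<le> (c * P powr (1 - s)) * P powr s" by (intro mult_right_mono) auto
    also have "\<dots> = c * P" using Ppos by (simp add: mult.assoc flip: powr_add)
    finally show ?thesis using b by (simp add: add_increasing2)
  qed
  then show thesis using that by blast
qed

lemma minimizer_exists:
  fixes \<Omega> :: "'a::euclidean_space set"
  assumes \<alpha>: "\<alpha> > 0" and q: "1 \<le> q" and qp: "q < p"
    and \<Omega>: "open \<Omega>" and adm: "q_admissible \<Omega> p q" and U: "Xqp \<Omega> q p U"
  shows "\<exists>u. minimizer \<Omega> p q \<alpha> U u"
proof -
  let ?M = "lebesgue_on \<Omega>"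
  have p: "p > 1" "p \<ge> 1" "p > 0" "p \<ge> 0" and q0: "q > 0" "q \<ge> 0" using q qp by auto
  define G where "G = wgrad \<Omega> p U"
  have GU: "weak_grad \<Omega> U G" "inLp ?M p G" "inLp ?M q U"
    unfolding G_def by (rule wgrad_Xqp[OF U])+
  obtain C where C0: "C > 0" and C: "\<And>\<phi>. test_fun \<Omega> \<phi> \<Longrightarrow> pint lborel q \<phi> \<le> C * pint lborel p (grad \<phi>) powr (q/p)"
    using q_admissible_bound[OF \<Omega> q p(2) adm] by blast
  obtain D where D0: "D > 0" and D: "\<And>\<phi>. test_fun \<Omega> \<phi> \<Longrightarrow> pint lborel p \<phi> \<le> D * pint lborel p (grad \<phi>)"
    using Poincare_Lp[OF q qp C0 C] by blast
  note tL = test_fun_inLp(1)[OF \<Omega> _ p(3)] test_fun_inLp(2)[OF \<Omega> _ p(3)] test_fun_inLp(1)[OF \<Omega> _ q0(1)]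
  \<comment> \<open>The functional at U + \<phi>, written with an explicit gradient; for test
    functions no choice of weak gradient interferes.\<close>
  define J where "J \<phi> = 1 / p * pint ?M p (\<lambda>x. G x + grad \<phi> x) - \<alpha> / q * pint ?M q (\<lambda>x. U x + \<phi> x)" for \<phi>
  have J_lim: "(\<lambda>n. J (\<phi> n)) \<longlonglongrightarrow> 1 / p * pint ?M p (\<lambda>x. G x + g x) - \<alpha> / q * pint ?M q (\<lambda>x. U x + v x)"
    if t: "\<And>n. test_fun \<Omega> (\<phi> n)" and gv: "inLp ?M p g" "inLp ?M q v"
      and l: "(\<lambda>n. pint ?M q (\<lambda>x. \<phi> n x - v x)) \<longlonglongrightarrow> 0" "(\<lambda>n. pint ?M p (\<lambda>x. grad (\<phi> n) x - g x)) \<longlonglongrightarrow> 0" for \<phi> g v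
    unfolding J_def
    by (intro tendsto_diff tendsto_mult tendsto_const pint_tendsto[OF p(2)] pint_tendsto[OF q] inLp_add p q0 GU gv tL t)
      (use l in simp_all)
  \<comment> \<open>Every admissible energy is a limit of values of J on test functions, so a lower
    bound for J there is a lower bound on the whole admissible class.\<close>
  have adm_lim: "\<exists>\<phi>. (\<forall>n. test_fun \<Omega> (\<phi> n)) \<and> (\<lambda>n. J (\<phi> n)) \<longlonglongrightarrow> Fqa \<Omega> p q \<alpha> \<psi>"
    if \<psi>: "Xqp \<Omega> q p \<psi>" "W0 \<Omega> p (\<lambda>x. \<psi> x - U x)" for \<psi>
  proof -
    obtain \<phi> g where w: "\<And>n. test_fun \<Omega> (\<phi> n)" "weak_grad \<Omega> (\<lambda>x. \<psi> x - U x) g" "inLp ?M p g"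
      "inLp ?M q (\<lambda>x. \<psi> x - U x)" "(\<lambda>n. pint ?M q (\<lambda>x. \<phi> n x - (\<psi> x - U x))) \<longlonglongrightarrow> 0"
      "(\<lambda>n. pint ?M p (\<lambda>x. grad (\<phi> n) x - g x)) \<longlonglongrightarrow> 0"
      by (rule W0_approx[OF \<Omega> q qp C0 C \<psi>(2)], assumption, rule that)
    have "weak_grad \<Omega> (\<lambda>x. U x + (\<psi> x - U x)) (\<lambda>x. G x + g x)"
      by (rule weak_grad_add[OF \<Omega> q q p(2) GU(3,1,2) w(4,2,3)])
    then have "Fqa \<Omega> p q \<alpha> \<psi> = 1 / p * pint ?M p (\<lambda>x. G x + g x) - \<alpha> / q * pint ?M q \<psi>"
      by (intro Fqa_eq[OF \<Omega> p(2)] inLp_add p GU w) simp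
    then show ?thesis using J_lim[OF w(1,3-6)] w(1) by auto
  qed
  have "\<exists>c>0. \<exists>K. \<forall>\<phi>. test_fun \<Omega> \<phi> \<longrightarrow> c * pint ?M p (grad \<phi>) - K \<le> J \<phi>"
  proof -
    \<comment> \<open>Half of the factor 1 / (p 2^p) with which the energy of \<phi> bounds the
      gradient term from below; the other half absorbs the sublinear q-term.\<close>
    define c where "c = 1 / (2 * p * 2 powr p)"
    have c0: "c > 0" using p by (simp add: c_def)
    define b where "b = \<alpha> / q * 2 powr q * C"
    have b0: "b \<ge> 0" using \<alpha> q0 C0 by (simp add: b_def)
    obtain K where K: "\<And>P. P \<ge> 0 \<Longrightarrow> b * P powr (q/p) \<le> c * P + K"
      using powr_absorbed_by_linear[of "q/p" c b] q0 qp p c0 b0 by auto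
    define K' where "K' = K + 1 / p * pint ?M p G + \<alpha> / q * 2 powr q * pint ?M q U"
    have "c * pint ?M p (grad \<phi>) - K' \<le> J \<phi>" if t: "test_fun \<Omega> \<phi>" for \<phi>
    proof -
      define P where "P = pint ?M p (grad \<phi>)"
      have P0: "P \<ge> 0" by (simp add: P_def pint_nonneg)
      have "P = pint ?M p (\<lambda>x. (G x + grad \<phi> x) - G x)" by (simp add: P_def)
      also have "\<dots> \<le> 2 powr p * (pint ?M p (\<lambda>x. G x + grad \<phi> x) + pint ?M p G)"
        by (intro pint_diff_le inLp_add p GU tL t)
      finally have "1 / p * (P / 2 powr p) \<le> 1 / p * (pint ?M p (\<lambda>x. G x + grad \<phi> x) + pint ?M p G)"
        using p by (intro mult_left_mono) (auto simp: divide_simps mult.commute)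
      then have 1: "2 * c * P - 1 / p * pint ?M p G \<le> 1 / p * pint ?M p (\<lambda>x. G x + grad \<phi> x)"
        by (simp add: c_def algebra_simps)
      have "pint ?M q (\<lambda>x. U x + \<phi> x) \<le> 2 powr q * (pint ?M q U + pint ?M q \<phi>)"
        by (intro pint_add_le q0 GU tL t)
      also have "\<dots> \<le> 2 powr q * (pint ?M q U + C * P powr (q/p))"
        using C[OF t] by (intro mult_left_mono add_left_mono) (auto simp: P_def test_fun_pint[OF \<Omega> t])
      finally have "\<alpha> / q * pint ?M q (\<lambda>x. U x + \<phi> x) \<le> \<alpha> / q * (2 powr q * (pint ?M q U + C * P powr (q/p)))"
        using \<alpha> q0 by (intro mult_left_mono) auto
      also have "\<dots> = \<alpha> / q * 2 powr q * pint ?M q U + b * P powr (q/p)" by (simp add: b_def algebra_simps)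
      also have "\<dots> \<le> \<alpha> / q * 2 powr q * pint ?M q U + (c * P + K)" using K[OF P0] by simp
      finally have 2: "\<alpha> / q * pint ?M q (\<lambda>x. U x + \<phi> x) \<le> \<alpha> / q * 2 powr q * pint ?M q U + (c * P + K)" .
      show ?thesis using 1 2 unfolding J_def K'_def P_def[symmetric] by linarith
    qed
    with c0 show ?thesis by blast
  qed
  then obtain c K where c0: "c > 0" and K: "\<And>\<phi>. test_fun \<Omega> \<phi> \<Longrightarrow> c * pint ?M p (grad \<phi>) - K \<le> J \<phi>" by blast
  define m where "m = Inf (J ` {\<phi>. test_fun \<Omega> \<phi>})"
  have bdd: "bdd_below (J ` {\<phi>. test_fun \<Omega> \<phi>})"
  proof (rule bdd_belowI2)
    fix \<phi> assume "\<phi> \<in> {\<phi>. test_fun \<Omega> \<phi>}"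
    then have "c * pint ?M p (grad \<phi>) - K \<le> J \<phi>" using K by simp
    moreover have "0 \<le> c * pint ?M p (grad \<phi>)" using c0 pint_nonneg[of ?M p "grad \<phi>"] by simp
    ultimately show "- K \<le> J \<phi>" by linarith
  qed
  have m_le: "m \<le> J \<phi>" if "test_fun \<Omega> \<phi>" for \<phi>
    unfolding m_def using that by (intro cInf_lower bdd) auto
  have "\<exists>\<phi>. test_fun \<Omega> \<phi> \<and> J \<phi> < m + 1 / real (Suc n)" for n
  proof -
    have "\<exists>y\<in>J ` {\<phi>. test_fun \<Omega> \<phi>}. y < m + 1 / real (Suc n)"
      unfolding m_def using bdd test_fun_0[of \<Omega>] by (subst cInf_less_iff[symmetric]) auto
    then show ?thesis by auto
  qed
  then obtain \<Phi> where \<Phi>: "\<And>n. test_fun \<Omega> (\<Phi> n)" "\<And>n. J (\<Phi> n) < m + 1 / real (Suc n)" by metis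
  have \<Phi>P: "pint lborel p (grad (\<Phi> n)) \<le> (m + 1 + K) / c" for n
  proof -
    have "1 / real (Suc n) \<le> 1" by simp
    then have "c * pint ?M p (grad (\<Phi> n)) \<le> m + 1 + K" using K[OF \<Phi>(1)[of n]] \<Phi>(2)[of n] by linarith
    then show ?thesis using c0 by (simp add: test_fun_pint[OF \<Omega> \<Phi>(1)] divide_simps mult.commute)
  qed
  obtain r where r: "strict_mono r" "Lp_Cauchy lborel q (\<lambda>n. \<Phi> (r n))"
    by (rule Rellich_Lq[OF q qp C0 C \<Phi>(1) \<Phi>P], assumption, rule that)
  define \<psi> where "\<psi> n = \<Phi> (r n)" for n
  have t: "test_fun \<Omega> (\<psi> n)" for n by (simp add: \<psi>_def \<Phi>)
  have s: "smooth_fun (\<psi> n)" for n by (rule test_fun_smooth[OF t])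
  have J\<psi>: "(\<lambda>n. J (\<psi> n)) \<longlonglongrightarrow> m"
  proof (rule tendsto_sandwich[of "\<lambda>_. m" _ _ "\<lambda>n. m + 1 / real (Suc n)"])
    have "(\<lambda>n. m + 1 / real (Suc n)) \<longlonglongrightarrow> m + 0"
      by (intro tendsto_add tendsto_const LIMSEQ_Suc[OF lim_1_over_n])
    then show "(\<lambda>n. m + 1 / real (Suc n)) \<longlonglongrightarrow> m" by simp
    show "\<forall>\<^sub>F n in sequentially. J (\<psi> n) \<le> m + 1 / real (Suc n)"
    proof (intro always_eventually allI)
      fix n
      have "1 / real (Suc (r n)) \<le> 1 / real (Suc n)"
        using seq_suble[OF r(1), of n] by (intro divide_left_mono) auto
      then show "J (\<psi> n) \<le> m + 1 / real (Suc n)" using \<Phi>(2)[of "r n"] by (simp add: \<psi>_def)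
    qed
  qed (auto simp: m_le t)
  have "Lp_Cauchy ?M q \<psi>"
    using r(2) unfolding Lp_Cauchy_def \<psi>_def[symmetric] test_fun_pint(1)[OF \<Omega> test_fun_diff[OF t t]] .
  then obtain w where w: "inLp ?M q w" "(\<lambda>n. pint ?M q (\<lambda>x. \<psi> n x - w x)) \<longlonglongrightarrow> 0"
    using Lp_complete[OF q, of ?M \<psi>] tL(3)[OF t] by auto
  \<comment> \<open>Midpoints are admissible, so their energy is at least \<open>m\<close>; as the \<open>q\<close>-integrals converge, the
    midpoint defect of the gradient term tends to zero.\<close>
  have "Lp_Cauchy ?M p (\<lambda>n x. G x + grad (\<psi> n) x)"
  proof (rule Lp_Cauchy_uniform_convexity[OF p(1)])
    show "inLp ?M p (\<lambda>x. G x + grad (\<psi> n) x)" for n by (intro inLp_add p GU tL t)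
    show "pint ?M p (\<lambda>x. G x + grad (\<psi> n) x) \<le> 2 powr p * (pint ?M p G + (m + 1 + K) / c)" for n
    proof -
      have "pint ?M p (\<lambda>x. G x + grad (\<psi> n) x) \<le> 2 powr p * (pint ?M p G + pint ?M p (grad (\<psi> n)))"
        by (intro pint_add_le p GU tL t)
      also have "\<dots> \<le> 2 powr p * (pint ?M p G + (m + 1 + K) / c)"
        using \<Phi>P[of "r n"] by (intro mult_left_mono add_left_mono) (auto simp: \<psi>_def test_fun_pint[OF \<Omega> \<Phi>(1)])
      finally show ?thesis .
    qed
    fix e :: real assume e: "e > 0"
    \<comment> \<open>The gradient defect will be at most p (e1 + \<alpha>/q (2 e1)), and this
      choice makes that equal to e/2.\<close>
    define e1 where "e1 = e / (2 * (p * (1 + \<alpha> / q * 2)))"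
    have pos: "p * (1 + \<alpha> / q * 2) > 0" using p \<alpha> q0 by (intro mult_pos_pos add_pos_pos) auto
    have e1: "e1 > 0" "p * (e1 + \<alpha> / q * (2 * e1)) = e / 2"
    proof -
      show "e1 > 0" unfolding e1_def using e pos by simp
      have "p * (e1 + \<alpha> / q * (2 * e1)) = (p * (1 + \<alpha> / q * 2)) * e1" by (simp add: algebra_simps)
      also have "\<dots> = e / 2"
      proof -
        have "X * (e / (2 * X)) = e / 2" if "X > 0" for X using that by simp
        from this[OF pos] show ?thesis by (simp only: e1_def)
      qed
      finally show "p * (e1 + \<alpha> / q * (2 * e1)) = e / 2" .
    qed
    define L where "L = pint ?M q (\<lambda>x. U x + w x)"
    have Uw: "inLp ?M q (\<lambda>x. U x + w x)" by (intro inLp_add q0 GU w)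
    obtain d where d: "d > 0" "\<And>f. inLp ?M q f \<Longrightarrow> pint ?M q (\<lambda>x. f x - (U x + w x)) < d \<Longrightarrow> \<bar>pint ?M q f - L\<bar> < e1"
      using pint_continuous_eps[OF q Uw e1(1)] unfolding L_def by blast
    \<comment> \<open>The first entry keeps each member of the sequence within d of the limit. The
      second does so for midpoints, whose distance is estimated with the factor 2^q.\<close>
    define d' where "d' = min d (d / (2 * 2 powr q))"
    have d': "d' > 0" "d' \<le> d" "2 powr q * (d' + d') \<le> d"
    proof -
      show "d' > 0" "d' \<le> d" using d(1) by (auto simp: d'_def)
      have "2 powr q * (d' + d') \<le> 2 powr q * (d / (2 * 2 powr q) + d / (2 * 2 powr q))"
        by (intro mult_left_mono add_mono) (auto simp: d'_def)
      also have "\<dots> = d" by simp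
      finally show "2 powr q * (d' + d') \<le> d" .
    qed
    obtain N1 where N1: "\<And>n. n \<ge> N1 \<Longrightarrow> pint ?M q (\<lambda>x. \<psi> n x - w x) < d'"
      using order_tendstoD(2)[OF w(2) d'(1)] by (auto simp: eventually_sequentially)
    obtain N2 where N2: "\<And>n. n \<ge> N2 \<Longrightarrow> J (\<psi> n) < m + e1"
      using order_tendstoD(2)[OF J\<psi>, of "m + e1"] e1(1) by (auto simp: eventually_sequentially)
    have "(pint ?M p (\<lambda>x. G x + grad (\<psi> a) x) + pint ?M p (\<lambda>x. G x + grad (\<psi> b) x)) / 2 -
        pint ?M p (\<lambda>x. (1/2) *\<^sub>R ((G x + grad (\<psi> a) x) + (G x + grad (\<psi> b) x))) < e"
      if ab: "a \<ge> max N1 N2" "b \<ge> max N1 N2" for a b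
    proof -
      define \<mu> where "\<mu> x = (1/2) * (\<psi> a x + \<psi> b x)" for x
      have t\<mu>: "test_fun \<Omega> \<mu>" unfolding \<mu>_def by (intro test_fun_cmult test_fun_add t)
      have "grad \<mu> x = (1/2) *\<^sub>R (grad (\<psi> a) x + grad (\<psi> b) x)" for x
        unfolding \<mu>_def by (simp only: grad_cmult[OF smooth_add[OF s s]] grad_add[OF s s])
      then have gm: "(1/2) *\<^sub>R ((G x + grad (\<psi> a) x) + (G x + grad (\<psi> b) x)) = G x + grad \<mu> x" for x
        by (simp add: scaleR_add_right flip: scaleR_add_left)
      have Un: "\<bar>pint ?M q (\<lambda>x. U x + \<psi> n x) - L\<bar> < e1" if "n \<ge> max N1 N2" for n
        using N1[of n] that d'(2) by (intro d(2) inLp_add q0 GU tL t) simp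
      have "pint ?M q (\<lambda>x. \<mu> x - w x) = pint ?M q (\<lambda>x. (1/2) *\<^sub>R (\<psi> a x - w x) + (1/2) *\<^sub>R (\<psi> b x - w x))"
        by (rule arg_cong[of _ _ "pint ?M q"]) (simp add: fun_eq_iff \<mu>_def field_simps)
      also have "\<dots> \<le> 2 powr q * (pint ?M q (\<lambda>x. (1/2) *\<^sub>R (\<psi> a x - w x)) + pint ?M q (\<lambda>x. (1/2) *\<^sub>R (\<psi> b x - w x)))"
        by (intro pint_add_le inLp_scale inLp_diff q0 w tL t)
      also have "\<dots> < 2 powr q * (d' + d')"
      proof -
        have "pint ?M q (\<lambda>x. (1/2) *\<^sub>R (\<psi> n x - w x)) < d'" if "n \<ge> N1" for n
        proof -
          have "pint ?M q (\<lambda>x. (1/2) *\<^sub>R (\<psi> n x - w x)) = (1/2) powr q * pint ?M q (\<lambda>x. \<psi> n x - w x)"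
            by (subst pint_scale) simp
          also have "\<dots> \<le> 1 powr q * pint ?M q (\<lambda>x. \<psi> n x - w x)"
            using q0 by (intro mult_right_mono powr_mono2 pint_nonneg) auto
          finally show ?thesis using N1[OF that] by simp
        qed
        then show ?thesis using ab by (intro mult_strict_left_mono add_strict_mono) auto
      qed
      also note d'(3)
      finally have "\<bar>pint ?M q (\<lambda>x. U x + \<mu> x) - L\<bar> < e1"
        by (intro d(2) inLp_add q0 GU tL t\<mu>) simp
      then have V: "(pint ?M q (\<lambda>x. U x + \<psi> a x) + pint ?M q (\<lambda>x. U x + \<psi> b x)) / 2 - pint ?M q (\<lambda>x. U x + \<mu> x) < 2 * e1"
      proof -
        have "(A + B) / 2 - M' < 2 * e1" if "\<bar>M' - L\<bar> < e1" "\<bar>A - L\<bar> < e1" "\<bar>B - L\<bar> < e1" for A B M'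
        proof -
          have "A < L + e1" "B < L + e1" "L - e1 < M'" using that by (auto simp: abs_less_iff)
          then show ?thesis by (simp add: field_simps)
        qed
        then show ?thesis using Un[OF ab(1)] Un[OF ab(2)] \<open>\<bar>pint ?M q (\<lambda>x. U x + \<mu> x) - L\<bar> < e1\<close> by blast
      qed
      \<comment> \<open>The midpoint is U plus a test function, so its value is at least m, while
        the two endpoint values are below m + e1.\<close>
      have E: "(J (\<psi> a) + J (\<psi> b)) / 2 - J \<mu> < e1"
        using m_le[OF t\<mu>] N2[of a] N2[of b] ab by (simp add: field_simps)
      \<comment> \<open>The definition of J solved for the gradient integrals: the gradient defect
        is p times the sum of the defect of J and \<alpha>/q times the defect of the
        q-integrals.\<close>
      have "(pint ?M p (\<lambda>x. G x + grad (\<psi> a) x) + pint ?M p (\<lambda>x. G x + grad (\<psi> b) x)) / 2 - pint ?M p (\<lambda>x. G x + grad \<mu> x)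
        = p * (((J (\<psi> a) + J (\<psi> b)) / 2 - J \<mu>) + \<alpha> / q * ((pint ?M q (\<lambda>x. U x + \<psi> a x) + pint ?M q (\<lambda>x. U x + \<psi> b x)) / 2 - pint ?M q (\<lambda>x. U x + \<mu> x)))"
        using p q0 unfolding J_def by (simp add: field_simps)
      also have "\<dots> \<le> p * (e1 + \<alpha> / q * (2 * e1))"
        using p q0 \<alpha> E V by (intro mult_left_mono add_mono) auto
      also have "\<dots> = e / 2" by (rule e1(2))
        also have "e / 2 < e" using e by simp
      finally show ?thesis unfolding gm .
    qed
    then show "\<exists>N. \<forall>a\<ge>N. \<forall>b\<ge>N. (pint ?M p (\<lambda>x. G x + grad (\<psi> a) x) + pint ?M p (\<lambda>x. G x + grad (\<psi> b) x)) / 2 -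
        pint ?M p (\<lambda>x. (1/2) *\<^sub>R ((G x + grad (\<psi> a) x) + (G x + grad (\<psi> b) x))) < e" by blast
  qed
  then have gC: "Lp_Cauchy ?M p (\<lambda>n. grad (\<psi> n))" by (simp add: Lp_Cauchy_def)
  then obtain H where H: "inLp ?M p H" "(\<lambda>n. pint ?M p (\<lambda>x. grad (\<psi> n) x - H x)) \<longlonglongrightarrow> 0"
    using Lp_complete[OF p(2), of ?M "\<lambda>n. grad (\<psi> n)"] tL(2)[OF t] by auto
  \<comment> \<open>So far the functions themselves converge only in L^q, whereas \<open>W0\<close>
    asks for convergence in L^p; the L^p Poincare inequality supplies it.\<close>
  have "Lp_Cauchy ?M p \<psi>"
  proof (rule Lp_Cauchy_of_grad_Cauchy[OF \<Omega> p(2) p(2) D0 zero_less_one _ t gC])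
    show "pint lborel p \<phi> \<le> D * pint lborel p (grad \<phi>) powr 1" if "test_fun \<Omega> \<phi>" for \<phi>
      using D[OF that] by (simp add: pint_nonneg)
  qed
  then obtain v where v: "inLp ?M p v" "(\<lambda>n. pint ?M p (\<lambda>x. \<psi> n x - v x)) \<longlonglongrightarrow> 0"
    using Lp_complete[OF p(2), of ?M \<psi>] tL(1)[OF t] by auto
  note vq = test_fun_Lq_limit[OF \<Omega> q qp C0 C v(1) H(1) t v(2) H(2)]
  have vH: "weak_grad \<Omega> v H"
    by (rule weak_grad_limit[OF \<Omega> p(2) p(2) tL(1)[OF t] tL(2)[OF t] test_fun_weak_grad[OF \<Omega> t] v(1) H(1) v(2) H(2)])
  have W: "W0 \<Omega> p v"
    unfolding W0_def Lp_inLp using v H vH t by (auto simp: pint_def intro!: exI[of _ H] exI[of _ \<psi>])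
  define u where "u x = U x + v x" for x
  have uw: "weak_grad \<Omega> u (\<lambda>x. G x + H x)"
    unfolding u_def by (rule weak_grad_add[OF \<Omega> q q p(2) GU(3,1,2) vq(1) vH H(1)])
  have uL: "inLp ?M q u" "inLp ?M p (\<lambda>x. G x + H x)" 
    using inLp_add[OF q0(2) GU(3) vq(1)] inLp_add[OF p(4) GU(2) H(1)] by (simp_all add: u_def[abs_def])
  have "minimizer \<Omega> p q \<alpha> U u"
    unfolding minimizer_def
  proof (intro conjI allI impI)
    show "Xqp \<Omega> q p u" unfolding Xqp_def Lp_inLp using uL uw by blast
    show "W0 \<Omega> p (\<lambda>x. u x - U x)" using W by (simp add: u_def)
    fix \<eta> assume \<eta>: "Xqp \<Omega> q p \<eta> \<and> W0 \<Omega> p (\<lambda>x. \<eta> x - U x)"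
    have "Fqa \<Omega> p q \<alpha> u = 1 / p * pint ?M p (\<lambda>x. G x + H x) - \<alpha> / q * pint ?M q (\<lambda>x. U x + v x)"
      using Fqa_eq[OF \<Omega> p(2) uL(2) uw] by (simp add: u_def[abs_def])
    also have "\<dots> = m" by (rule LIMSEQ_unique[OF J_lim[OF t H(1) vq H(2)] J\<psi>])
    also have "m \<le> Fqa \<Omega> p q \<alpha> \<eta>"
    proof -
      obtain \<phi> where "\<And>n. test_fun \<Omega> (\<phi> n)" "(\<lambda>n. J (\<phi> n)) \<longlonglongrightarrow> Fqa \<Omega> p q \<alpha> \<eta>"
        using adm_lim[of \<eta>] \<eta> by blast
      then show ?thesis using m_le by (intro LIMSEQ_le_const) auto
    qed
    finally show "Fqa \<Omega> p q \<alpha> u \<le> Fqa \<Omega> p q \<alpha> \<eta>" .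
  qed
  then show ?thesis by blast
qed

section \<open>Euler-Lagrange relations\<close>

text \<open>Adding a multiple of a test function keeps a competitor admissible: shifting the
  approximating sequence by the same function shows that the \<open>W0\<close> condition persists.
  The gradient of the competitor is then explicit and affine in c.\<close>

lemma minimizer_variation:
  fixes \<Omega> :: "'a::euclidean_space set"
  assumes q: "1 \<le> q" and p: "1 \<le> p" and \<Omega>: "open \<Omega>"
    and u: "minimizer \<Omega> p q \<alpha> U u" and t: "test_fun \<Omega> \<phi>"
  shows "1 / p * pint (lebesgue_on \<Omega>) p (wgrad \<Omega> p u) - \<alpha> / q * pint (lebesgue_on \<Omega>) q u
    \<le> 1 / p * pint (lebesgue_on \<Omega>) p (\<lambda>x. wgrad \<Omega> p u x + c *\<^sub>R grad \<phi> x)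
      - \<alpha> / q * pint (lebesgue_on \<Omega>) q (\<lambda>x. u x + c *\<^sub>R \<phi> x)"
proof -
  let ?M = "lebesgue_on \<Omega>"
  have p0: "p > 0" "p \<ge> 0" and q0: "q > 0" "q \<ge> 0" using p q by auto
  have uX: "Xqp \<Omega> q p u" "W0 \<Omega> p (\<lambda>x. u x - U x)" using u by (auto simp: minimizer_def)
  note g = wgrad_Xqp[OF uX(1)]
  define c\<phi> where "c\<phi> x = c * \<phi> x" for x
  have tc: "test_fun \<Omega> c\<phi>" unfolding c\<phi>_def by (rule test_fun_cmult[OF t])
  have gc: "grad c\<phi> x = c *\<^sub>R grad \<phi> x" for x
    unfolding c\<phi>_def by (rule grad_cmult[OF test_fun_smooth[OF t]])
  note tL = test_fun_inLp(1)[OF \<Omega> tc p0(1)] test_fun_inLp(2)[OF \<Omega> tc p0(1)] test_fun_inLp(1)[OF \<Omega> tc q0(1)]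
  note wc = test_fun_weak_grad[OF \<Omega> tc]
  have w: "weak_grad \<Omega> (\<lambda>x. u x + c\<phi> x) (\<lambda>x. wgrad \<Omega> p u x + grad c\<phi> x)"
    by (rule weak_grad_add[OF \<Omega> q q p g(3,1,2) tL(3) wc tL(2)])
  have L: "inLp ?M p (\<lambda>x. wgrad \<Omega> p u x + grad c\<phi> x)" "inLp ?M q (\<lambda>x. u x + c\<phi> x)"
    by (intro inLp_add p0 q0 g tL)+
  have X: "Xqp \<Omega> q p (\<lambda>x. u x + c\<phi> x)" unfolding Xqp_def Lp_inLp using w L by blast
  have W: "W0 \<Omega> p (\<lambda>x. (u x + c\<phi> x) - U x)"
  proof -
    obtain h \<psi> where h: "inLp ?M p (\<lambda>x. u x - U x)" "weak_grad \<Omega> (\<lambda>x. u x - U x) h" "inLp ?M p h" "\<And>k. test_fun \<Omega> (\<psi> k)"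
      "(\<lambda>k. \<integral>x. \<bar>\<psi> k x - (u x - U x)\<bar> powr p \<partial>?M) \<longlonglongrightarrow> 0" "(\<lambda>k. \<integral>x. norm (grad (\<psi> k) x - h x) powr p \<partial>?M) \<longlonglongrightarrow> 0"
      using uX(2) unfolding W0_def Lp_inLp by auto
    have gk: "grad (\<lambda>x. \<psi> k x + c\<phi> x) x = grad (\<psi> k) x + grad c\<phi> x" for k x
      by (rule grad_add[OF test_fun_smooth[OF h(4)] test_fun_smooth[OF tc]])
    have eq: "(u x + c\<phi> x) - U x = (u x - U x) + c\<phi> x" for x by simp
    show ?thesis
      unfolding W0_def Lp_inLp eq
    proof (intro conjI exI[of _ "\<lambda>x. h x + grad c\<phi> x"] exI[of _ "\<lambda>k x. \<psi> k x + c\<phi> x"] allI)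
      show "inLp ?M p (\<lambda>x. (u x - U x) + c\<phi> x)" "inLp ?M p (\<lambda>x. h x + grad c\<phi> x)" by (intro inLp_add p0 h tL)+
      show "weak_grad \<Omega> (\<lambda>x. (u x - U x) + c\<phi> x) (\<lambda>x. h x + grad c\<phi> x)"
        by (rule weak_grad_add[OF \<Omega> p p p h(1,2,3) tL(1) wc tL(2)])
    qed (use h tc in \<open>simp_all add: gk test_fun_add\<close>)
  qed
  have "Fqa \<Omega> p q \<alpha> u \<le> Fqa \<Omega> p q \<alpha> (\<lambda>x. u x + c\<phi> x)"
    using u X W unfolding minimizer_def by blast
  then show ?thesis
    unfolding Fqa_eq[OF \<Omega> p g(2,1)] Fqa_eq[OF \<Omega> p L(1) w] by (simp add: gc c\<phi>_def)
qed

text \<open>Only right-hand difference quotients are compared, so a lower bound on increments for t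
  > 0 is enough; mirroring gives the companion bound from t < 0. The two together serve the case q =
  1.\<close>

lemma has_real_derivative_ge:
  fixes h :: "real \<Rightarrow> real"
  assumes "(h has_real_derivative D) (at 0)" "\<And>t. t > 0 \<Longrightarrow> h t - h 0 \<ge> c * t"
  shows "c \<le> D"
proof -
  have "((\<lambda>t. (h t - h 0) / t) \<longlongrightarrow> D) (at_right 0)"
    using assms(1) by (auto simp: DERIV_def intro: tendsto_mono[OF at_le])
  moreover have "\<forall>\<^sub>F t in at_right 0. c \<le> (h t - h 0) / t"
    using eventually_at_right_less[of 0] by eventually_elim (use assms(2) in \<open>simp add: field_simps\<close>)
  ultimately show ?thesis by (intro tendsto_lowerbound) auto
qed

lemma has_real_derivative_le:
  fixes h :: "real \<Rightarrow> real"
  assumes "(h has_real_derivative D) (at 0)" "\<And>t. t < 0 \<Longrightarrow> h t - h 0 \<ge> c * t"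
  shows "D \<le> c"
proof -
  have "((\<lambda>t. h (- t)) has_real_derivative - D) (at 0)"
    using DERIV_mirror[of h D 0] assms(1) by simp
  then have "- c \<le> - D" by (rule has_real_derivative_ge) (use assms(2)[of "- t" for t] in auto)
  then show ?thesis by simp
qed

lemma gradient_energy_derivative:
  fixes \<Omega> :: "'a::euclidean_space set"
  assumes p: "1 < p" and \<Omega>: "open \<Omega>" and u: "Xqp \<Omega> q p u" and t: "test_fun \<Omega> \<phi>"
  shows "((\<lambda>c. 1 / p * pint (lebesgue_on \<Omega>) p (\<lambda>x. wgrad \<Omega> p u x + c *\<^sub>R grad \<phi> x))
    has_real_derivative plap_pair \<Omega> p u \<phi>) (at 0)"
proof -
  have "inLp (lebesgue_on \<Omega>) p (grad \<phi>)" using p by (intro test_fun_inLp(2)[OF \<Omega> t]) auto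
  from DERIV_cmult[OF pint_has_derivative[OF p wgrad_Xqp(2)[OF u] this], of "1 / p"]
  show ?thesis using p by (simp add: plap_pair_def)
qed

text \<open>With both exponents above 1 each integral is differentiable along u + c \<phi>, and c =
  0 is a minimum over all real c, so the derivative vanishes.\<close>

lemma minimizer_Euler_Lagrange:
  fixes \<Omega> :: "'a::euclidean_space set"
  assumes q: "1 < q" and p: "1 < p" and \<Omega>: "open \<Omega>" and u: "minimizer \<Omega> p q \<alpha> U u"
  shows "weak_plap_sol \<Omega> p u (\<lambda>x. \<alpha> * (sgn (u x) * \<bar>u x\<bar> powr (q - 1)))"
  unfolding weak_plap_sol_def
proof (intro allI impI)
  fix \<phi> assume t: "test_fun \<Omega> \<phi>"
  let ?M = "lebesgue_on \<Omega>"
  have uX: "Xqp \<Omega> q p u" using u by (simp add: minimizer_def)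
  have "inLp ?M q \<phi>" using q by (intro test_fun_inLp(1)[OF \<Omega> t]) auto
  from DERIV_cmult[OF pint_has_derivative[OF q wgrad_Xqp(3)[OF uX] this], of "\<alpha> / q"]
  have "((\<lambda>c. \<alpha> / q * pint ?M q (\<lambda>x. u x + c *\<^sub>R \<phi> x)) has_real_derivative
      \<alpha> * (\<integral>x. \<bar>u x\<bar> powr (q - 2) * (u x * \<phi> x) \<partial>?M)) (at 0)"
    using q by simp
  from DERIV_diff[OF gradient_energy_derivative[OF p \<Omega> uX t] this]
  have "plap_pair \<Omega> p u \<phi> - \<alpha> * (\<integral>x. \<bar>u x\<bar> powr (q - 2) * (u x * \<phi> x) \<partial>?M) = 0"
    by (rule DERIV_local_min[OF _ zero_less_one])
      (use minimizer_variation[OF _ _ \<Omega> u t] p q in simp)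
  \<comment> \<open>The form with \<open>sgn\<close> has the positive exponent q - 1; where u
    vanishes both expressions are zero, even if q - 2 is negative.\<close>
  moreover have "\<bar>u x\<bar> powr (q - 2) * (u x * \<phi> x) = sgn (u x) * \<bar>u x\<bar> powr (q - 1) * \<phi> x" for x
  proof (cases "u x = 0")
    case False
    have "q - 1 = (q - 2) + 1" by simp
    then have "\<bar>u x\<bar> powr (q - 1) = \<bar>u x\<bar> powr (q - 2) * \<bar>u x\<bar> powr 1" by (simp only: powr_add)
    then have "sgn (u x) * \<bar>u x\<bar> powr (q - 1) = \<bar>u x\<bar> powr (q - 2) * (sgn (u x) * \<bar>u x\<bar>)" using False by simp
    then show ?thesis by (simp add: sgn_mult_abs mult.assoc)
  qed simp
  ultimately show "plap_pair \<Omega> p u \<phi> = (\<integral>x. \<alpha> * (sgn (u x) * \<bar>u x\<bar> powr (q - 1)) * \<phi> x \<partial>?M)"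
    by (simp add: mult.assoc)
qed

text \<open>For \<open>q = 1\<close> the subtracted term is not differentiable, but its increments still bound the
  derivative of the gradient term from both sides.\<close>
lemma minimizer_L1_variation:
  fixes \<Omega> :: "'a::euclidean_space set"
  assumes p: "1 < p" and \<Omega>: "open \<Omega>" and u: "minimizer \<Omega> p 1 \<alpha> U u" and t: "test_fun \<Omega> \<phi>"
  shows "\<alpha> * ((\<integral>x. \<bar>u x + c * \<phi> x\<bar> \<partial>lebesgue_on \<Omega>) - (\<integral>x. \<bar>u x\<bar> \<partial>lebesgue_on \<Omega>))
    \<le> 1 / p * pint (lebesgue_on \<Omega>) p (\<lambda>x. wgrad \<Omega> p u x + c *\<^sub>R grad \<phi> x)
      - 1 / p * pint (lebesgue_on \<Omega>) p (\<lambda>x. wgrad \<Omega> p u x + 0 *\<^sub>R grad \<phi> x)"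
  using minimizer_variation[OF _ _ \<Omega> u t, of c] p by (simp add: pint_def algebra_simps)

text \<open>The triangle inequality bounds the increment of the L^1 norm below by -|c| times the
  integral of \<phi>. Read for c > 0 this gives the lower bound on the derivative of the gradient
  term, read for c < 0 the upper one.\<close>

lemma minimizer_L1_bounds:
  fixes \<Omega> :: "'a::euclidean_space set"
  assumes \<alpha>: "\<alpha> > 0" and p: "1 < p" and \<Omega>: "open \<Omega>" and u: "minimizer \<Omega> p 1 \<alpha> U u"
    and t: "test_fun \<Omega> \<phi>" and pos: "\<And>x. 0 \<le> \<phi> x"
  shows "- \<alpha> * integral\<^sup>L (lebesgue_on \<Omega>) \<phi> \<le> plap_pair \<Omega> p u \<phi>"
    "plap_pair \<Omega> p u \<phi> \<le> \<alpha> * integral\<^sup>L (lebesgue_on \<Omega>) \<phi>"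
proof -
  let ?M = "lebesgue_on \<Omega>"
  have uX: "Xqp \<Omega> 1 p u" using u by (simp add: minimizer_def)
  note um = inLp_measurable[OF wgrad_Xqp(3)[OF uX]]
  have "integrable ?M (\<lambda>x. \<bar>u x\<bar>)" using wgrad_Xqp(3)[OF uX] by (simp add: inLp_def)
  then have ui: "integrable ?M u" by (rule integrable_abs_cancel) (rule um)
  have \<phi>i: "integrable ?M \<phi>" by (rule ccont_lebesgue_on_integrable[OF ccont_test[OF t] \<Omega>])
  have lower: "- \<alpha> * (\<bar>c\<bar> * integral\<^sup>L ?M \<phi>) \<le> \<alpha> * ((\<integral>x. \<bar>u x + c * \<phi> x\<bar> \<partial>?M) - (\<integral>x. \<bar>u x\<bar> \<partial>?M))" for c
  proof -
    have "(\<integral>x. \<bar>u x\<bar> \<partial>?M) \<le> (\<integral>x. \<bar>u x + c * \<phi> x\<bar> + \<bar>c\<bar> * \<phi> x \<partial>?M)"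
    proof (rule integral_mono)
      fix x
      have "\<bar>u x\<bar> \<le> \<bar>u x + c * \<phi> x\<bar> + \<bar>c * \<phi> x\<bar>" by linarith
      then show "\<bar>u x\<bar> \<le> \<bar>u x + c * \<phi> x\<bar> + \<bar>c\<bar> * \<phi> x" using pos[of x] by (simp add: abs_mult)
    qed (use ui \<phi>i in auto)
    also have "\<dots> = (\<integral>x. \<bar>u x + c * \<phi> x\<bar> \<partial>?M) + \<bar>c\<bar> * integral\<^sup>L ?M \<phi>" using ui \<phi>i by simp
    finally have "- (\<bar>c\<bar> * integral\<^sup>L ?M \<phi>) \<le> (\<integral>x. \<bar>u x + c * \<phi> x\<bar> \<partial>?M) - (\<integral>x. \<bar>u x\<bar> \<partial>?M)" by simp
    from mult_left_mono[OF this, of \<alpha>] \<alpha> show ?thesis by simp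
  qed
  note bound = order_trans[OF lower minimizer_L1_variation[OF p \<Omega> u t]]
  note der = gradient_energy_derivative[OF p \<Omega> uX t]
  show "- \<alpha> * integral\<^sup>L ?M \<phi> \<le> plap_pair \<Omega> p u \<phi>"
  proof (rule has_real_derivative_ge[OF der], goal_cases)
    case (1 t)
    then show ?case using bound[of t] by (simp add: mult_ac)
  qed
  show "plap_pair \<Omega> p u \<phi> \<le> \<alpha> * integral\<^sup>L ?M \<phi>"
  proof (rule has_real_derivative_le[OF der], goal_cases)
    case (1 t)
    then show ?case using bound[of t] by (simp add: mult_ac)
  qed
qed

text \<open>For nonnegative u, the integral of |u + c \<phi>| is at least that of u + c \<phi>, with
  equality at c = 0. The increments thus have a lower bound linear in c, with the same slope on both
  sides, and \<phi> may have any sign.\<close>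

lemma nonneg_minimizer_L1:
  fixes \<Omega> :: "'a::euclidean_space set"
  assumes \<alpha>: "\<alpha> > 0" and p: "1 < p" and \<Omega>: "open \<Omega>" and u: "minimizer \<Omega> p 1 \<alpha> U u"
    and pos: "AE x in lebesgue_on \<Omega>. 0 \<le> u x"
  shows "weak_plap_sol \<Omega> p u (\<lambda>x. \<alpha>)"
  unfolding weak_plap_sol_def
proof (intro allI impI)
  fix \<phi> assume t: "test_fun \<Omega> \<phi>"
  let ?M = "lebesgue_on \<Omega>"
  have uX: "Xqp \<Omega> 1 p u" using u by (simp add: minimizer_def)
  note um = inLp_measurable[OF wgrad_Xqp(3)[OF uX]]
  have "integrable ?M (\<lambda>x. \<bar>u x\<bar>)" using wgrad_Xqp(3)[OF uX] by (simp add: inLp_def)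
  then have ui: "integrable ?M u" by (rule integrable_abs_cancel) (rule um)
  have \<phi>i: "integrable ?M \<phi>" by (rule ccont_lebesgue_on_integrable[OF ccont_test[OF t] \<Omega>])
  have lower: "\<alpha> * (c * integral\<^sup>L ?M \<phi>) \<le> \<alpha> * ((\<integral>x. \<bar>u x + c * \<phi> x\<bar> \<partial>?M) - (\<integral>x. \<bar>u x\<bar> \<partial>?M))" for c
  proof -
    have "(\<integral>x. \<bar>u x\<bar> \<partial>?M) = integral\<^sup>L ?M u"
      using um pos by (intro integral_cong_AE) (auto elim!: eventually_mono)
    moreover have "integral\<^sup>L ?M u + c * integral\<^sup>L ?M \<phi> = (\<integral>x. u x + c * \<phi> x \<partial>?M)" using ui \<phi>i by simp
    moreover have "\<dots> \<le> (\<integral>x. \<bar>u x + c * \<phi> x\<bar> \<partial>?M)" using ui \<phi>i by (intro integral_mono) auto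
    ultimately show ?thesis using \<alpha> by (intro mult_left_mono) auto
  qed
  note bound = order_trans[OF lower minimizer_L1_variation[OF p \<Omega> u t]]
  note der = gradient_energy_derivative[OF p \<Omega> uX t]
  have "\<alpha> * integral\<^sup>L ?M \<phi> \<le> plap_pair \<Omega> p u \<phi>"
  proof (rule has_real_derivative_ge[OF der], goal_cases)
    case (1 t)
    then show ?case using bound[of t] by (simp add: mult_ac)
  qed
  moreover have "plap_pair \<Omega> p u \<phi> \<le> \<alpha> * integral\<^sup>L ?M \<phi>"
  proof (rule has_real_derivative_le[OF der], goal_cases)
    case (1 t)
    then show ?case using bound[of t] by (simp add: mult_ac)
  qed
  ultimately show "plap_pair \<Omega> p u \<phi> = (\<integral>x. \<alpha> * \<phi> x \<partial>?M)" by simp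
qed

theorem theorem3p3:
  fixes \<Omega> :: "'a::euclidean_space set" and U :: "'a \<Rightarrow> real" and p q \<alpha> :: real
  assumes "\<alpha> > 0" and "1 \<le> q" and "q < p"
    and "open \<Omega>" and "q_admissible \<Omega> p q"
    and "Xqp \<Omega> q p U"
  shows "(\<exists>u. minimizer \<Omega> p q \<alpha> U u)
    \<and> (1 < q \<longrightarrow> (\<forall>u. minimizer \<Omega> p q \<alpha> U u \<longrightarrow>
          weak_plap_sol \<Omega> p u (\<lambda>x. \<alpha> * (sgn (u x) * \<bar>u x\<bar> powr (q - 1)))))
    \<and> (q = 1 \<longrightarrow> (\<forall>u. minimizer \<Omega> p q \<alpha> U u \<longrightarrow>
          (\<forall>\<phi>. test_fun \<Omega> \<phi> \<and> (\<forall>x. 0 \<le> \<phi> x) \<longrightarrow>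
             - \<alpha> * integral\<^sup>L (lebesgue_on \<Omega>) \<phi> \<le> plap_pair \<Omega> p u \<phi>
             \<and> plap_pair \<Omega> p u \<phi> \<le> \<alpha> * integral\<^sup>L (lebesgue_on \<Omega>) \<phi>)))
    \<and> (q = 1 \<longrightarrow> (\<forall>u. minimizer \<Omega> p q \<alpha> U u \<and> (AE x in lebesgue_on \<Omega>. 0 \<le> u x) \<longrightarrow>
          weak_plap_sol \<Omega> p u (\<lambda>x. \<alpha>)))"
proof -
  have p: "1 < p" using assms(2,3) by simp
  show ?thesis
    using minimizer_exists[OF assms] minimizer_Euler_Lagrange[OF _ p assms(4)]
      minimizer_L1_bounds[OF assms(1) p assms(4)] nonneg_minimizer_L1[OF assms(1) p assms(4)]
    by auto
qed

end
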